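(* Let $s\in\mathbb Z$, let $\alpha:\mathbb R_+\to\mathbb R_+$ be a weight function, piecewise continuous and bounded on compact sets, let $\{{}_s\Psi_\rho\}_{\rho\in\mathbb R_+}$ be an admissible spherical wavelet of spin weight $s$ with respect to $\alpha$, with wavelet transform $\mathcal W_\Psi$, and let ${}_sf,{}_sg\in\mathcal L_s^2(\mathcal S)$. Then $$ \left<\mathcal W_\Psi\,{}_sf,\mathcal W_\Psi\,{}_sg\right>_{\mathcal L^2(\mathbb R_+\times SO(3))}=\left<{}_sf,{}_sg\right>_{\mathcal L^2(\mathcal S)}, $$ where the scalar product in the wavelet phase space is given by $$ \left<F,G\right>_{\mathcal L^2(\mathbb R_+\times SO(3))}=\int_0^\infty\!\!\int_{SO(3)}\overline{F(\rho,\Upsilon)}\,G(\rho,\Upsilon)\,d\nu(\Upsilon)\,\alpha(\rho)\,d\rho. $$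
   Context: $\mathcal S$ is the unit sphere in $\mathbb R^3$ with spherical coordinates $(\vartheta,\varphi)\in[0,\pi]\times[0,2\pi)$, $x=(\sin\vartheta\cos\varphi,\sin\vartheta\sin\varphi,\cos\vartheta)$, and surface measure $d\sigma=\sin\vartheta\,d\vartheta\,d\varphi$. Scalar product: $\langle f,g\rangle_{\mathcal L^2(\mathcal S)}=\int_{\mathcal S}\overline{f}\,g\,d\sigma$. $\mathbb R_+=(0,\infty)$. Spherical harmonics: for $l\in\mathbb N_0$, $Y_l^m(\vartheta,\varphi)=(-1)^m\sqrt{\frac{2l+1}{4\pi}\frac{(l-m)!}{(l+m)!}}\,P_l^m(\cos\vartheta)\,e^{im\varphi}$ for $0\le m\le l$ ($P_l^m$ the associated Legendre function), and $Y_l^m=\overline{Y_l^{-m}}$ for $-l\le m<0$. A spin weight $s$ function ($s\in\mathbb Z$) is represented as a scalar function of $(\vartheta,\varphi)$; $\mathcal L_s^2(\mathcal S)$ is the space of square integrable functions of spin weight $s$. The spin-raising and spin-lowering operators, acting on a function ${}_sf$ of spin weight $s$, are $$\eth\,{}_sf=-\left(\partial_\vartheta+\tfrac{i}{\sin\vartheta}\partial_\varphi-s\cot\vartheta\right){}_sf,\qquad \bar\eth\,{}_sf=-\left(\partial_\vartheta-\tfrac{i}{\sin\vartheta}\partial_\varphi+s\cot\vartheta\right){}_sf,$$ which raise, respectively lower, the spin weight by $1$; scalar functions have spin weight $0$. The spin weighted spherical harmonics are ${}_sY_l^m=\sqrt{\frac{(l-s)!}{(l+s)!}}\,\eth^sY_l^m$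 for $0\le s\le l$ and ${}_sY_l^m=\sqrt{\frac{(l+s)!}{(l-s)!}}\,(-1)^s\,\bar\eth^{-s}Y_l^m$ for $-l\le s\le0$. For each $s$, $\{{}_sY_l^m: l\ge|s|,\ -l\le m\le l\}$ is an orthonormal basis of $\mathcal L_s^2(\mathcal S)$. Fourier coefficients: ${}_s\widehat f_l^m=\langle{}_sY_l^m,{}_sf\rangle$. Rotations: $\Upsilon=(\alpha,\beta,\gamma)\in SO(3)$ in Euler angles denotes the rotation of points, in a fixed coordinate system, about the $z$-, $y$-, $z$-axes by $\gamma,\beta,\alpha$ (in this order). The rotation of a spin weight $s$ function is $$(\mathcal R_\Upsilon\,{}_sf)(x)=\exp(-is\kappa)\cdot{}_sf(\Upsilon^{-1}x),$$ where $\kappa\in[0,2\pi)$ is the third Euler angle of $\Upsilon^{-1}\Xi$, and $\Xi$ is the rotation with Euler angles $(\varphi,\vartheta,0)$ for $x=(\vartheta,\varphi)$. $d\nu$ is the Haar measure on $SO(3)$ normalized so that $\int_{SO(3)}d\nu=8\pi^2$. Admissible wavelet: given a weight function $\alpha:\mathbb R_+\to\mathbb R_+$, piecewise continuous and bounded on compact sets, a family $\{{}_s\Psi_\rho\}_{\rho\in\mathbb R_+}\subseteq\mathcal L_s^2(\mathcal S)$ is an admissible spherical wavelet of spin weight $s$ if (1) for every $l\in\mathbb N_0$ with $l\ge|s|$, $\sum_{m=-l}^{l}\int_0^\infty|{}_s(\widehat{\Psi_\rho})_l^m|^2\,\alpha(\rho)\,d\rho=\frac{2l+1}{8\pi^2}$;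 and (2) for each fixed $\rho$, $\sum_{l=|s|}^\infty l^{2|s|}\sum_{m=-l}^{l}|{}_s(\widehat{\Psi_\rho})_l^m|^2<\infty$. Wavelet transform: for ${}_sf\in\mathcal L_s^2(\mathcal S)$, $(\mathcal W_\Psi\,{}_sf)(\rho,\Upsilon)=\int_{\mathcal S}\overline{(\mathcal R_\Upsilon\,{}_s\Psi_\rho)(x)}\cdot{}_sf(x)\,d\sigma(x)$, for $\rho\in\mathbb R_+$, $\Upsilon\in SO(3)$. *)

theory Defs
  imports "HOL-Analysis.Analysis"
begin

text \<open>
  Functions on the sphere, of any spin weight, are functions of the coordinates
  (theta, phi) in [0, pi] x [0, 2 pi); values outside of this rectangle are irrelevant.  The spin
  weight is not part of the function: it is an argument of the operations that depend on it.
  Integrals over the sphere are taken on a completed measure, so null sets (the poles, in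
  particular) never affect measurability.
\<close>

definition sphere_coords :: "(real \<times> real) set" where
  "sphere_coords = {0..pi} \<times> {0..<2 * pi}"

definition sphere_measure :: "(real \<times> real) measure" where
  "sphere_measure = density (lebesgue_on sphere_coords) (\<lambda>(\<theta>, \<phi>). ennreal (sin \<theta>))"

definition sphere_point :: "real \<times> real \<Rightarrow> real ^ 3" where
  "sphere_point = (\<lambda>(\<theta>, \<phi>). vector [sin \<theta> * cos \<phi>, sin \<theta> * sin \<phi>, cos \<theta>])"

text \<open>At the poles, where phi is not determined by the point, it is chosen to be 0.\<close>

definition coords_of_point :: "real ^ 3 \<Rightarrow> real \<times> real" where
  "coords_of_point x =
     (THE (\<theta>, \<phi>). (\<theta>, \<phi>) \<in> sphere_coords \<and> (sin \<theta> = 0 \<longrightarrow> \<phi> = 0) \<and> sphere_point (\<theta>, \<phi>) = x)"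

definition L2_sphere :: "(real \<times> real \<Rightarrow> complex) set" where
  "L2_sphere = {f. f \<in> borel_measurable sphere_measure \<and>
                   integrable sphere_measure (\<lambda>p. (cmod (f p))\<^sup>2)}"

definition sphere_inner :: "(real \<times> real \<Rightarrow> complex) \<Rightarrow> (real \<times> real \<Rightarrow> complex) \<Rightarrow> complex" where
  "sphere_inner f g = (LINT p|sphere_measure. cnj (f p) * g p)"

text \<open>
  The polynomial part of the associated Legendre function is given by Rodrigues' formula
  P_l = (1 / (2^l l!)) (d/dt)^l (t^2 - 1)^l.  The Condon-Shortley sign (-1)^m is not included here;
  it is the explicit factor in the definition of the spherical harmonics.
\<close>

definition assoc_legendre :: "nat \<Rightarrow> nat \<Rightarrow> real \<Rightarrow> real" where
  "assoc_legendre l m t =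
     sqrt (1 - t\<^sup>2) ^ m / (2 ^ l * fact l) * (deriv ^^ (l + m)) (\<lambda>u. (u\<^sup>2 - 1) ^ l) t"

definition sph_harm_nonneg :: "nat \<Rightarrow> nat \<Rightarrow> real \<times> real \<Rightarrow> complex" where
  "sph_harm_nonneg l m = (\<lambda>(\<theta>, \<phi>).
     (-1) ^ m *
     of_real (sqrt ((2 * real l + 1) / (4 * pi) * (fact (l - m) / fact (l + m)))
              * assoc_legendre l m (cos \<theta>)) *
     exp (\<i> * of_nat m * of_real \<phi>))"

definition sph_harm :: "nat \<Rightarrow> int \<Rightarrow> real \<times> real \<Rightarrow> complex" where
  "sph_harm l m p =
     (if m \<ge> 0 then sph_harm_nonneg l (nat m) p else cnj (sph_harm_nonneg l (nat (- m)) p))"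

definition eth :: "int \<Rightarrow> (real \<times> real \<Rightarrow> complex) \<Rightarrow> real \<times> real \<Rightarrow> complex" where
  "eth s f = (\<lambda>(\<theta>, \<phi>).
     - (vector_derivative (\<lambda>t. f (t, \<phi>)) (at \<theta>)
        + \<i> / of_real (sin \<theta>) * vector_derivative (\<lambda>t. f (\<theta>, t)) (at \<phi>)
        - of_int s * of_real (cot \<theta>) * f (\<theta>, \<phi>)))"

definition ethbar :: "int \<Rightarrow> (real \<times> real \<Rightarrow> complex) \<Rightarrow> real \<times> real \<Rightarrow> complex" where
  "ethbar s f = (\<lambda>(\<theta>, \<phi>).
     - (vector_derivative (\<lambda>t. f (t, \<phi>)) (at \<theta>)
        - \<i> / of_real (sin \<theta>) * vector_derivative (\<lambda>t. f (\<theta>, t)) (at \<phi>)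
        + of_int s * of_real (cot \<theta>) * f (\<theta>, \<phi>)))"

text \<open>Powers of eth and eth-bar applied to a function of spin weight 0.\<close>

primrec eth_power :: "nat \<Rightarrow> (real \<times> real \<Rightarrow> complex) \<Rightarrow> real \<times> real \<Rightarrow> complex" where
  "eth_power 0 f = f"
| "eth_power (Suc n) f = eth (int n) (eth_power n f)"

primrec ethbar_power :: "nat \<Rightarrow> (real \<times> real \<Rightarrow> complex) \<Rightarrow> real \<times> real \<Rightarrow> complex" where
  "ethbar_power 0 f = f"
| "ethbar_power (Suc n) f = ethbar (- int n) (ethbar_power n f)"

text \<open>Meaningful for |s| \<le> l and |m| \<le> l only.\<close>

definition spin_sph_harm :: "int \<Rightarrow> nat \<Rightarrow> int \<Rightarrow> real \<times> real \<Rightarrow> complex" where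
  "spin_sph_harm s l m p =
     (if s \<ge> 0
      then of_real (sqrt (fact (nat (int l - s)) / fact (nat (int l + s))))
           * eth_power (nat s) (sph_harm l m) p
      else of_real (sqrt (fact (nat (int l + s)) / fact (nat (int l - s))))
           * (-1) ^ nat (- s) * ethbar_power (nat (- s)) (sph_harm l m) p)"

definition spin_coeff :: "int \<Rightarrow> (real \<times> real \<Rightarrow> complex) \<Rightarrow> nat \<Rightarrow> int \<Rightarrow> complex" where
  "spin_coeff s f l m = sphere_inner (spin_sph_harm s l m) f"

definition SO3 :: "(real ^ 3 ^ 3) set" where
  "SO3 = {R. rotation_matrix R}"

definition rot_y :: "real \<Rightarrow> real ^ 3 ^ 3" where
  "rot_y t = vector [vector [cos t, 0, sin t], vector [0, 1, 0], vector [- sin t, 0, cos t]]"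

definition rot_z :: "real \<Rightarrow> real ^ 3 ^ 3" where
  "rot_z t = vector [vector [cos t, - sin t, 0], vector [sin t, cos t, 0], vector [0, 0, 1]]"

definition euler_rot :: "real \<times> real \<times> real \<Rightarrow> real ^ 3 ^ 3" where
  "euler_rot = (\<lambda>(\<alpha>, \<beta>, \<gamma>). rot_z \<alpha> ** rot_y \<beta> ** rot_z \<gamma>)"

text \<open>
  The Euler angles of a rotation are not unique if the second one is 0 or pi; the first one is
  chosen to be 0 then.  This agrees with the choice made for the coordinates of the poles:
  the first two Euler angles of R are (phi, theta), where (theta, phi) are the coordinates
  of the image of the north pole.
\<close>

definition euler_angles :: "real ^ 3 ^ 3 \<Rightarrow> real \<times> real \<times> real" where
  "euler_angles R =
     (THE (\<alpha>, \<beta>, \<gamma>). \<alpha> \<in> {0..<2 * pi} \<and> \<beta> \<in> {0..pi} \<and> \<gamma> \<in> {0..<2 * pi} \<and>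
        (sin \<beta> = 0 \<longrightarrow> \<alpha> = 0) \<and> euler_rot (\<alpha>, \<beta>, \<gamma>) = R)"

definition third_euler_angle :: "real ^ 3 ^ 3 \<Rightarrow> real" where
  "third_euler_angle R = snd (snd (euler_angles R))"

definition spin_rotate ::
    "int \<Rightarrow> real ^ 3 ^ 3 \<Rightarrow> (real \<times> real \<Rightarrow> complex) \<Rightarrow> real \<times> real \<Rightarrow> complex" where
  "spin_rotate s R f = (\<lambda>(\<theta>, \<phi>).
     exp (- \<i> * of_int s * of_real (third_euler_angle (matrix_inv R ** euler_rot (\<phi>, \<theta>, 0)))) *
     f (coords_of_point (matrix_inv R *v sphere_point (\<theta>, \<phi>))))"

text \<open>
  The Haar measure on SO(3) with total mass 8 pi^2: the left invariant Borel measure with this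
  mass.  It is determined uniquely by this property.
\<close>

definition haar_SO3 :: "(real ^ 3 ^ 3) measure \<Rightarrow> bool" where
  "haar_SO3 \<nu> \<longleftrightarrow>
     sets \<nu> = sets (restrict_space borel SO3) \<and>
     emeasure \<nu> SO3 = ennreal (8 * pi\<^sup>2) \<and>
     (\<forall>Q \<in> SO3. distr \<nu> \<nu> (\<lambda>R. Q ** R) = \<nu>)"

text \<open>
  Piecewise continuity of the weight is understood as having finitely many discontinuities in each
  compact interval; the existence of one-sided limits at these is not required.
\<close>

definition weight_function :: "(real \<Rightarrow> real) \<Rightarrow> bool" where
  "weight_function \<alpha> \<longleftrightarrow>
     (\<forall>\<rho>>0. \<alpha> \<rho> > 0) \<and>
     (\<forall>a b. 0 < a \<longrightarrow> finite {\<rho> \<in> {a..b}. \<not> isCont \<alpha> \<rho>}) \<and>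
     (\<forall>K. compact K \<and> K \<subseteq> {0<..} \<longrightarrow> bounded (\<alpha> ` K))"

text \<open>
  The integrability requirement states that the integrals in the first condition exist; the
  Bochner integral of a function that is not integrable would be 0.
\<close>

definition admissible_wavelet ::
    "int \<Rightarrow> (real \<Rightarrow> real) \<Rightarrow> (real \<Rightarrow> real \<times> real \<Rightarrow> complex) \<Rightarrow> bool" where
  "admissible_wavelet s \<alpha> \<Psi> \<longleftrightarrow>
     (\<forall>\<rho>>0. \<Psi> \<rho> \<in> L2_sphere) \<and>
     (\<forall>l. \<bar>s\<bar> \<le> int l \<longrightarrow>
        (\<forall>m \<in> {- int l..int l}.
           integrable (lebesgue_on {0<..}) (\<lambda>\<rho>. (cmod (spin_coeff s (\<Psi> \<rho>) l m))\<^sup>2 * \<alpha> \<rho>)) \<and>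
        (\<Sum>m = - int l..int l.
           LINT \<rho>|lebesgue_on {0<..}. (cmod (spin_coeff s (\<Psi> \<rho>) l m))\<^sup>2 * \<alpha> \<rho>)
          = (2 * real l + 1) / (8 * pi\<^sup>2)) \<and>
     (\<forall>\<rho>>0. (\<lambda>l. real l ^ (2 * nat \<bar>s\<bar>) *
                (\<Sum>m = - int l..int l. (cmod (spin_coeff s (\<Psi> \<rho>) l m))\<^sup>2))
              summable_on {nat \<bar>s\<bar>..})"

definition wavelet_transform ::
    "int \<Rightarrow> (real \<Rightarrow> real \<times> real \<Rightarrow> complex) \<Rightarrow> (real \<times> real \<Rightarrow> complex) \<Rightarrow>
     real \<Rightarrow> real ^ 3 ^ 3 \<Rightarrow> complex" where
  "wavelet_transform s \<Psi> f \<rho> R =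
     (LINT p|sphere_measure. cnj (spin_rotate s R (\<Psi> \<rho>) p) * f p)"

definition phase_inner ::
    "(real \<Rightarrow> real) \<Rightarrow> (real ^ 3 ^ 3) measure \<Rightarrow> (real \<Rightarrow> real ^ 3 ^ 3 \<Rightarrow> complex) \<Rightarrow>
     (real \<Rightarrow> real ^ 3 ^ 3 \<Rightarrow> complex) \<Rightarrow> complex" where
  "phase_inner \<alpha> \<nu> F G =
     (LINT \<rho>|lebesgue_on {0<..}. (LINT R|\<nu>. cnj (F \<rho> R) * G \<rho> R) * of_real (\<alpha> \<rho>))"

text \<open>
  The scalar product in phase space is an iterated integral; no joint measurability in the scale and
  the rotation is involved.  The next predicate rules out the default value 0 of the Bochner
  integral of a function that is not integrable.
\<close>

definition phase_inner_exists ::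
    "(real \<Rightarrow> real) \<Rightarrow> (real ^ 3 ^ 3) measure \<Rightarrow> (real \<Rightarrow> real ^ 3 ^ 3 \<Rightarrow> complex) \<Rightarrow>
     (real \<Rightarrow> real ^ 3 ^ 3 \<Rightarrow> complex) \<Rightarrow> bool" where
  "phase_inner_exists \<alpha> \<nu> F G \<longleftrightarrow>
     (\<forall>\<rho>>0. integrable \<nu> (\<lambda>R. cnj (F \<rho> R) * G \<rho> R)) \<and>
     integrable (lebesgue_on {0<..})
       (\<lambda>\<rho>. (LINT R|\<nu>. cnj (F \<rho> R) * G \<rho> R) * of_real (\<alpha> \<rho>))"

end

theory Submission
  imports Defs
begin

text \<open>
  The rotations act on the functions of spin weight s unitarily and mix the spin weighted harmonics of a
  fixed degree by matrices D, so that the wavelet transform is a series in the entries of D with the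
  Fourier coefficients as factors.  Parseval's identity then follows from the Schur orthogonality of
  these entries, from the admissibility condition, and from the completeness of the harmonics.

  The action on the harmonics is made explicit by lifting them to the rotation group as the coefficients
  of the polynomials \<open>A^(l+s) B^(l-s)\<close>, with A and B linear in X: the rotations of the columns of a matrix
  become Moebius substitutions of X.  The orthogonality relations come from the invariance of the Haar
  measure under the rotations about the z-axis, for which D is diagonal, and under the quarter turn
  about the y-axis, for which the entries of the row m = l do not vanish: the former annihilates the
  integrals with different m, and the latter compares the remaining ones.  Completeness is
  reduced to the Stone-Weierstrass theorem.
\<close>

section \<open>Wigner functions as coefficients of polynomials\<close>

text \<open>A spin weighted function depends on a frame and not only on a point. Hence its rotation
  carries the phase exp (- i s \<kappa>), whose angle jumps and is fixed by convention at the poles.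
  On the rotation group this phase becomes a right translation, a rotation becomes a mere left
  translation, and D does not depend on the point. The polynomials in X are the representation of
  SU(2) on binary forms of degree 2 l, whence the half angles. Unitarity of D is not computed but
  follows from the invariance of the surface measure, which in turn is proved in coordinates by a
  divergence-free flow, tested on polynomials. Both transforms use the same wavelet, so the columns
  of D can be contracted with its coefficients before integrating. Only row indices remain, and for
  these left invariance of the Haar measure suffices. The contracted rows have squared norm 8 pi^2 /
  (2 l + 1) times the sum of the squared wavelet coefficients of degree l; this constant is the
  inverse of the right-hand side of the admissibility condition. The iterated derivatives that
  define the harmonics are controlled only off the poles, so they are replaced almost everywhere by
  continuous functions.\<close>

definition poly_has_deriv :: "(real \<Rightarrow> real poly) \<Rightarrow> real poly \<Rightarrow> real \<Rightarrow> bool" where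
  "poly_has_deriv P P' t \<longleftrightarrow> (\<forall>k. ((\<lambda>u. coeff (P u) k) has_real_derivative coeff P' k) (at t))"

lemma poly_eq_fun:
  fixes p q :: "'a :: {comm_ring_1, ring_no_zero_divisors, ring_char_0} poly"
  assumes "\<And>x. poly p x = poly q x"
  shows "p = q"
  using assms by (simp add: poly_eq_poly_eq_iff[symmetric] fun_eq_iff)

lemma poly_has_deriv_mult:
  assumes "poly_has_deriv P P' t" "poly_has_deriv Q Q' t"
  shows "poly_has_deriv (\<lambda>u. P u * Q u) (P' * Q t + P t * Q') t"
  unfolding poly_has_deriv_def coeff_mult coeff_add
proof
  fix k
  show "((\<lambda>u. \<Sum>i\<le>k. coeff (P u) i * coeff (Q u) (k - i)) has_real_derivative
          (\<Sum>i\<le>k. coeff P' i * coeff (Q t) (k - i)) + (\<Sum>i\<le>k. coeff (P t) i * coeff Q' (k - i))) (at t)"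
    unfolding sum.distrib[symmetric]
    by (intro DERIV_sum) (use assms in \<open>auto simp: poly_has_deriv_def intro!: derivative_eq_intros\<close>)
qed

lemma poly_has_deriv_power:
  assumes "poly_has_deriv P P' t"
  shows "poly_has_deriv (\<lambda>u. P u ^ n) (smult (of_nat n) (P t ^ (n - 1) * P')) t"
proof (induction n)
  case 0
  show ?case by (auto simp: poly_has_deriv_def)
next
  case (Suc n)
  have "P' * P t ^ n + P t * smult (of_nat n) (P t ^ (n - 1) * P')
      = smult (of_nat (Suc n)) (P t ^ (Suc n - 1) * P')"
    by (cases n) (auto intro!: poly_eq_fun simp: algebra_simps)
  then show ?case
    using poly_has_deriv_mult[OF assms Suc.IH] by simp
qed

text \<open>\<open>halfA t\<close> and \<open>halfB t\<close> are the forms into which X and 1 pass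
  under the element of SU(2) over the rotation by t about the y-axis. The half angle makes
  differentiation in t a rotation of this pair, up to the factor 1/2.\<close>

definition halfA :: "real \<Rightarrow> real poly" where
  "halfA t = [:sin (t / 2), cos (t / 2):]"

definition halfB :: "real \<Rightarrow> real poly" where
  "halfB t = [:cos (t / 2), - sin (t / 2):]"

text \<open>
  Up to a constant, \<open>wig (l + s) (l - s) (l - m)\<close> is Wigner's function \<open>d\<^sup>l\<close> for the indices m and s.
\<close>

definition wig :: "nat \<Rightarrow> nat \<Rightarrow> nat \<Rightarrow> real \<Rightarrow> real" where
  "wig p q k t = coeff (halfA t ^ p * halfB t ^ q) k"

lemma halfA_deriv: "poly_has_deriv halfA (smult (1/2) (halfB t)) t"
  unfolding poly_has_deriv_def halfA_def halfB_def
  by (auto simp: coeff_pCons split: nat.split intro!: derivative_eq_intros)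

lemma halfB_deriv: "poly_has_deriv halfB (smult (-1/2) (halfA t)) t"
  unfolding poly_has_deriv_def halfA_def halfB_def
  by (auto simp: coeff_pCons split: nat.split intro!: derivative_eq_intros)

lemma sin_double_half: "sin (t::real) = 2 * sin (t / 2) * cos (t / 2)"
  using sin_double[of "t / 2"] by simp

lemma cos_double_half: "cos (t::real) = (cos (t / 2))\<^sup>2 - (sin (t / 2))\<^sup>2"
  using cos_double[of "t / 2"] by simp

lemma cos_half_squared: "(cos (t / 2 :: real))\<^sup>2 = (1 + cos t) / 2"
  using cos_double_half[of t] sin_cos_squared_add[of "t / 2"] by argo

lemma sin_half_squared: "(sin (t / 2 :: real))\<^sup>2 = (1 - cos t) / 2"
  using cos_double_half[of t] sin_cos_squared_add[of "t / 2"] by argo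

text \<open>
  Up to the factor sin t, the operators eth and eth-bar act on the polynomials
  \<open>halfA ^ p * halfB ^ q\<close> as a derivation in t plus or minus the derivation X d/dX.
\<close>

lemma pderiv_halfAB:
  "pCons 0 (pderiv (halfA t ^ p * halfB t ^ q)) =
     smult (of_nat p * cos (t / 2)) ([:0, 1:] * (halfA t ^ (p - 1) * halfB t ^ q))
     - smult (of_nat q * sin (t / 2)) ([:0, 1:] * (halfA t ^ p * halfB t ^ (q - 1)))"
proof -
  have "pderiv (halfA t ^ p) = smult (of_nat p * cos (t / 2)) (halfA t ^ (p - 1))"
    by (cases p) (auto intro!: poly_eq_fun simp: pderiv_power_Suc halfA_def pderiv_pCons algebra_simps simp del: power_Suc)
  moreover have "pderiv (halfB t ^ q) = smult (- of_nat q * sin (t / 2)) (halfB t ^ (q - 1))"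
    by (cases q) (auto intro!: poly_eq_fun simp: pderiv_power_Suc halfB_def pderiv_pCons algebra_simps simp del: power_Suc)
  ultimately have "pderiv (halfA t ^ p * halfB t ^ q) =
     smult (of_nat p * cos (t / 2)) (halfA t ^ (p - 1) * halfB t ^ q)
     - smult (of_nat q * sin (t / 2)) (halfA t ^ p * halfB t ^ (q - 1))"
    by (simp add: pderiv_mult algebra_simps)
  then show ?thesis
    by (auto intro!: poly_eq_fun simp: algebra_simps)
qed

lemma halfAB_deriv:
  "poly_has_deriv (\<lambda>u. halfA u ^ p * halfB u ^ q)
     (smult (of_nat p / 2) (halfA t ^ (p - 1) * halfB t ^ (q + 1))
      - smult (of_nat q / 2) (halfA t ^ (p + 1) * halfB t ^ (q - 1))) t"
proof -
  have "smult (real p) (halfA t ^ (p - 1) * smult (1/2) (halfB t)) * halfB t ^ q +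
     halfA t ^ p * smult (real q) (halfB t ^ (q - 1) * smult (- 1/2) (halfA t)) =
     smult (of_nat p / 2) (halfA t ^ (p - 1) * halfB t ^ (q + 1))
      - smult (of_nat q / 2) (halfA t ^ (p + 1) * halfB t ^ (q - 1))"
    by (auto intro!: poly_eq_fun simp: algebra_simps)
  then show ?thesis
    using poly_has_deriv_mult[OF poly_has_deriv_power[OF halfA_deriv, of p t]
        poly_has_deriv_power[OF halfB_deriv, of q t]] by simp
qed

text \<open>The half-angle matrix is orthogonal, so its transpose recovers X. This removes the
  factor X from \<open>pderiv_halfAB\<close> and leaves products of powers of A and B.\<close>

lemma X_halfA: "[:0, 1:] = smult (cos (t / 2)) (halfA t) - smult (sin (t / 2)) (halfB t)"
  by (simp add: halfA_def halfB_def flip: power2_eq_square)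

definition wig' :: "nat \<Rightarrow> nat \<Rightarrow> nat \<Rightarrow> real \<Rightarrow> real" where
  "wig' p q k t = coeff (smult (of_nat p / 2) (halfA t ^ (p - 1) * halfB t ^ (q + 1))
      - smult (of_nat q / 2) (halfA t ^ (p + 1) * halfB t ^ (q - 1))) k"

lemma wig_deriv: "(wig p q k has_real_derivative wig' p q k t) (at t)"
  using halfAB_deriv[of p q t] unfolding poly_has_deriv_def wig_def[abs_def] wig'_def by blast

text \<open>X d/dX is diagonal on the powers of X. With k = l - m its eigenvalue k carries the
  derivative in phi.\<close>

lemma coeff_X_pderiv: "coeff (pCons 0 (pderiv P)) k = of_nat k * coeff P k"
  by (cases k) (simp_all add: coeff_pderiv)

text \<open>After the substitution for X, the derivation X d/dX yields the raised and the lowered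
  product with equal signs, the t-derivative yields them with opposite signs. Hence sum and
  difference keep one neighbour each.\<close>

lemma ladder_poly:
  fixes A B X D E :: "real poly"
  assumes X: "X = smult c A - smult s B"
    and D: "D = smult (of_nat p / 2) (A ^ (p - 1) * B ^ (q + 1)) - smult (of_nat q / 2) (A ^ (p + 1) * B ^ (q - 1))"
    and E: "E = smult (of_nat p * c) (X * (A ^ (p - 1) * B ^ q)) - smult (of_nat q * s) (X * (A ^ p * B ^ (q - 1)))"
  shows "smult (2 * s * c) D + E = smult (of_nat p * c\<^sup>2 + of_nat q * s\<^sup>2) (A ^ p * B ^ q)
             - smult (of_nat q * (2 * s * c)) (A ^ (p + 1) * B ^ (q - 1))"
    and "- smult (2 * s * c) D + E = smult (of_nat p * c\<^sup>2 + of_nat q * s\<^sup>2) (A ^ p * B ^ q)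
             - smult (of_nat p * (2 * s * c)) (A ^ (p - 1) * B ^ (q + 1))"
proof -
  have "2 * s * c * (real p / 2 * (a ^ (p - 1) * b ^ (q + 1)) - real q / 2 * (a ^ (p + 1) * b ^ (q - 1)))
      + (real p * c * ((c * a - s * b) * (a ^ (p - 1) * b ^ q)) - real q * s * ((c * a - s * b) * (a ^ p * b ^ (q - 1))))
      = (real p * c\<^sup>2 + real q * s\<^sup>2) * (a ^ p * b ^ q) - real q * (2 * s * c) * (a ^ (p + 1) * b ^ (q - 1))"
    "- (2 * s * c * (real p / 2 * (a ^ (p - 1) * b ^ (q + 1)) - real q / 2 * (a ^ (p + 1) * b ^ (q - 1))))
      + (real p * c * ((c * a - s * b) * (a ^ (p - 1) * b ^ q)) - real q * s * ((c * a - s * b) * (a ^ p * b ^ (q - 1))))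
      = (real p * c\<^sup>2 + real q * s\<^sup>2) * (a ^ p * b ^ q) - real p * (2 * s * c) * (a ^ (p - 1) * b ^ (q + 1))"
    for a b :: real
  proof -
    show "2 * s * c * (real p / 2 * (a ^ (p - 1) * b ^ (q + 1)) - real q / 2 * (a ^ (p + 1) * b ^ (q - 1)))
      + (real p * c * ((c * a - s * b) * (a ^ (p - 1) * b ^ q)) - real q * s * ((c * a - s * b) * (a ^ p * b ^ (q - 1))))
      = (real p * c\<^sup>2 + real q * s\<^sup>2) * (a ^ p * b ^ q) - real q * (2 * s * c) * (a ^ (p + 1) * b ^ (q - 1))"
      \<comment> \<open>The exponents \<open>p - 1\<close> and \<open>q - 1\<close> are truncated,
        but where this happens the term has the factor p = 0 or q = 0.\<close>
      by (cases p; cases q) (simp_all add: field_simps power2_eq_square)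
    show "- (2 * s * c * (real p / 2 * (a ^ (p - 1) * b ^ (q + 1)) - real q / 2 * (a ^ (p + 1) * b ^ (q - 1))))
      + (real p * c * ((c * a - s * b) * (a ^ (p - 1) * b ^ q)) - real q * s * ((c * a - s * b) * (a ^ p * b ^ (q - 1))))
      = (real p * c\<^sup>2 + real q * s\<^sup>2) * (a ^ p * b ^ q) - real p * (2 * s * c) * (a ^ (p - 1) * b ^ (q + 1))"
      by (cases p; cases q) (simp_all add: field_simps power2_eq_square)
  qed
  from this[of "poly A x" "poly B x" for x]
  show "smult (2 * s * c) D + E = smult (of_nat p * c\<^sup>2 + of_nat q * s\<^sup>2) (A ^ p * B ^ q)
             - smult (of_nat q * (2 * s * c)) (A ^ (p + 1) * B ^ (q - 1))"
    and "- smult (2 * s * c) D + E = smult (of_nat p * c\<^sup>2 + of_nat q * s\<^sup>2) (A ^ p * B ^ q)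
             - smult (of_nat p * (2 * s * c)) (A ^ (p - 1) * B ^ (q + 1))"
    unfolding X D E by (intro poly_eq_fun; simp only: poly_add poly_diff poly_minus poly_smult poly_mult poly_power)+
qed

text \<open>Raising and lowering of the spin weight, multiplied by sin t to remain valid at the
  poles. With p = l + s, q = l - s and k = l - m the diagonal factor is m + s cos t.\<close>

lemma wig_ladder:
  "sin t * wig' p q k t =
     (of_nat p * (cos (t/2))\<^sup>2 + of_nat q * (sin (t/2))\<^sup>2 - of_nat k) * wig p q k t
     - of_nat q * sin t * wig (p + 1) (q - 1) k t"
  "- sin t * wig' p q k t =
     (of_nat p * (cos (t/2))\<^sup>2 + of_nat q * (sin (t/2))\<^sup>2 - of_nat k) * wig p q k t
     - of_nat p * sin t * wig (p - 1) (q + 1) k t"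
proof -
  note L = ladder_poly[OF X_halfA[of t] refl pderiv_halfAB[of t p q]]
  show "sin t * wig' p q k t =
     (of_nat p * (cos (t/2))\<^sup>2 + of_nat q * (sin (t/2))\<^sup>2 - of_nat k) * wig p q k t
     - of_nat q * sin t * wig (p + 1) (q - 1) k t"
    using arg_cong[OF L(1), of "\<lambda>P. coeff P k"] 
    unfolding wig_def wig'_def sin_double_half[of t] coeff_add coeff_X_pderiv
    by (simp add: algebra_simps)
  show "- sin t * wig' p q k t =
     (of_nat p * (cos (t/2))\<^sup>2 + of_nat q * (sin (t/2))\<^sup>2 - of_nat k) * wig p q k t
     - of_nat p * sin t * wig (p - 1) (q + 1) k t"
    using arg_cong[OF L(2), of "\<lambda>P. coeff P k"] 
    unfolding wig_def wig'_def sin_double_half[of t] coeff_add coeff_X_pderiv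
    by (simp add: algebra_simps)
qed

lemma continuous_on_wig [continuous_intros]: "continuous_on T (wig p q k)"
  by (rule DERIV_continuous_on) (use wig_deriv has_field_derivative_at_within in blast)

section \<open>Scalar products of the Wigner functions in theta\<close>

definition wig_inner :: "nat \<Rightarrow> nat \<Rightarrow> nat \<Rightarrow> nat \<Rightarrow> nat \<Rightarrow> nat \<Rightarrow> real" where
  "wig_inner p q k p' q' k' = integral {0..pi} (\<lambda>t. wig p q k t * wig p' q' k' t * sin t)"

lemma wig_inner_commute: "wig_inner p q k p' q' k' = wig_inner p' q' k' p q k"
  unfolding wig_inner_def by (simp add: mult.commute)

text \<open>Integration by parts: up to sign, eth and eth-bar are adjoint to each other.\<close>

lemma wig_inner_ladder:
  assumes "p + q' = p' + q + 1" "p + 1 + q + 2 * k' = p' + q' + 2 * k"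
  shows "real (p + 1) * wig_inner p (q + 1) k p' q' k' = real q' * wig_inner (p + 1) q k (p' + 1) (q' - 1) k'"
proof -
  \<comment> \<open>By the hypotheses \<open>U\<close> and \<open>V\<close> have the same m, and the
    spin weight of \<open>U\<close> is higher by 1. The diagonal terms of the two ladders therefore
    differ by cos t, which cancels against the derivative of the weight sin t; this weight also
    annihilates the boundary terms.\<close>
  define U where "U = wig (p + 1) q k"
  define V where "V = wig p' q' k'"
  define W where "W t = (real (p + 1) * (wig p (q + 1) k t * wig p' q' k' t * sin t)
         - real q' * (wig (p + 1) q k t * wig (p' + 1) (q' - 1) k' t * sin t))" for t
  have D: "((\<lambda>t. sin t * U t * V t) has_real_derivative W t) (at t)" for t
  proof -
    have eqs: "real p' = real p + real q' - real q - 1" "real k' = real k + real q' - real q - 1"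
      using assms by linarith+
    have U': "sin t * wig' (p + 1) q k t = - ((real (p + 1) * (cos (t/2))\<^sup>2 + real q * (sin (t/2))\<^sup>2 - real k) * U t
        - real (p + 1) * sin t * wig p (q + 1) k t)"
      using wig_ladder(2)[of t "p + 1" q k] unfolding U_def by simp
    have V': "sin t * wig' p' q' k' t = (real p' * (cos (t/2))\<^sup>2 + real q' * (sin (t/2))\<^sup>2 - real k') * V t
        - real q' * sin t * wig (p' + 1) (q' - 1) k' t"
      using wig_ladder(1)[of t p' q' k'] unfolding V_def by simp
    have "cos t * U t * V t + (sin t * wig' (p + 1) q k t) * V t + U t * (sin t * wig' p' q' k' t)
      = U t * V t * (cos t - (real (p + 1) * (cos (t/2))\<^sup>2 + real q * (sin (t/2))\<^sup>2 - real k)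
          + (real p' * (cos (t/2))\<^sup>2 + real q' * (sin (t/2))\<^sup>2 - real k')) + W t"
      unfolding U' V' W_def U_def[symmetric] V_def[symmetric] by (simp add: algebra_simps)
    also have "cos t - (real (p + 1) * (cos (t/2))\<^sup>2 + real q * (sin (t/2))\<^sup>2 - real k)
          + (real p' * (cos (t/2))\<^sup>2 + real q' * (sin (t/2))\<^sup>2 - real k')
      = 0"
      unfolding eqs cos_double_half[of t] by (simp add: algebra_simps sin_squared_eq)
    finally have "cos t * U t * V t + (sin t * wig' (p + 1) q k t) * V t + U t * (sin t * wig' p' q' k' t) = W t"
      by simp
    moreover have "((\<lambda>t. sin t * U t * V t) has_real_derivative
       (cos t * U t * V t + (sin t * wig' (p + 1) q k t) * V t + U t * (sin t * wig' p' q' k' t))) (at t)"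
      unfolding U_def V_def
      by (rule derivative_eq_intros wig_deriv refl | simp add: algebra_simps)+
    ultimately show ?thesis by simp
  qed
  have "(W has_integral (sin pi * U pi * V pi - sin 0 * U 0 * V 0)) {0..pi}"
    by (rule fundamental_theorem_of_calculus)
      (use D in \<open>auto simp flip: has_real_derivative_iff_has_vector_derivative intro: has_field_derivative_at_within\<close>)
  then have "integral {0..pi} W = 0" by (simp add: integral_unique)
  then show ?thesis
    unfolding wig_inner_def W_def
    by (subst (asm) integral_diff)
      (auto simp del: of_nat_add of_nat_Suc intro!: integrable_continuous_interval continuous_intros)
qed

lemma wig_q0: "wig p 0 k t = of_nat (p choose k) * cos (t / 2) ^ k * sin (t / 2) ^ (p - k)"
proof (cases "k \<le> p")
  case True
  then show ?thesis unfolding wig_def halfA_def by (simp add: coeff_linear_poly_power)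
next
  case False
  have "degree (halfA t ^ p) \<le> p"
    using degree_power_le[of "halfA t" p] by (auto simp: halfA_def intro: le_trans split: if_splits)
  with False show ?thesis by (simp add: wig_def coeff_eq_0 binomial_eq_0)
qed

text \<open>The Beta integral B (a + 1, b + 1) in the variable u = sin^2 (t / 2), for which sin t dt
  = 2 du; hence the factor 2.\<close>

lemma integral_half_angle_powers:
  "((\<lambda>t. sin (t / 2) ^ (2 * a) * cos (t / 2) ^ (2 * b) * sin t) has_integral
      2 * fact a * fact b / fact (a + b + 1)) {0..pi}"
proof (induction b arbitrary: a)
  case 0
  have "((\<lambda>t. sin (t / 2) ^ (2 * a) * sin t) has_integral
          2 * sin (pi / 2) ^ (2 * a + 2) / (a + 1) - 2 * sin (0 / 2) ^ (2 * a + 2) / (a + 1)) {0..pi}"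
  proof (rule fundamental_theorem_of_calculus)
    fix t :: real
    have "((\<lambda>t. 2 * sin (t / 2) ^ (2 * a + 2) / (a + 1)) has_real_derivative
        sin (t / 2) ^ (2 * a) * sin t) (at t)"
      by (rule derivative_eq_intros refl | simp)+
        (simp add: sin_double_half[of t] field_simps power2_eq_square)
    then show "((\<lambda>t. 2 * sin (t / 2) ^ (2 * a + 2) / (a + 1)) has_vector_derivative
        sin (t / 2) ^ (2 * a) * sin t) (at t within {0..pi})"
      using has_field_derivative_at_within has_real_derivative_iff_has_vector_derivative by blast
  qed auto
  moreover have "2 * fact a * fact 0 / fact (a + 0 + 1) = 2 * sin (pi / 2) ^ (2 * a + 2) / (a + 1) - 2 * sin (0 / 2) ^ (2 * a + 2) / (a + 1)"
    by (simp add: divide_simps)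
  ultimately show ?case by simp
next
  case (Suc b)
  \<comment> \<open>\<open>F\<close> vanishes at 0 and pi, and its derivative is a combination of
    the integrands for (a, b + 1) and (a + 1, b). This trades a cosine square for a sine square,
    which is why the induction on b needs arbitrary a.\<close>
  define F where "F t = sin (t / 2) ^ (2 * a + 2) * cos (t / 2) ^ (2 * b + 2) / (a + 1)" for t :: real
  define G where "G t = sin (t / 2) ^ (2 * a) * cos (t / 2) ^ (2 * Suc b) * sin t" for t :: real
  define H where "H t = sin (t / 2) ^ (2 * Suc a) * cos (t / 2) ^ (2 * b) * sin t" for t :: real
  have "((\<lambda>t. G t / 2 - (b + 1) / (a + 1) * H t / 2) has_integral F pi - F 0) {0..pi}"
  proof (rule fundamental_theorem_of_calculus)
    fix t :: real
    have "(F has_real_derivative G t / 2 - (b + 1) / (a + 1) * H t / 2) (at t)"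
      unfolding F_def
      by (rule derivative_eq_intros refl | simp)+
        (simp add: G_def H_def sin_double_half[of t] field_simps power2_eq_square)
    then show "(F has_vector_derivative G t / 2 - (b + 1) / (a + 1) * H t / 2) (at t within {0..pi})"
      using has_field_derivative_at_within has_real_derivative_iff_has_vector_derivative by blast
  qed auto
  moreover have "F pi - F 0 = 0" by (simp add: F_def)
  ultimately have "((\<lambda>t. G t / 2 - (b + 1) / (a + 1) * H t / 2) has_integral 0) {0..pi}" by simp
  from has_integral_add[OF has_integral_mult_right[OF this, of 2] 
      has_integral_mult_right[OF Suc.IH[of "Suc a"], of "(b + 1) / (a + 1)"]]
  have "((\<lambda>t. 2 * (G t / 2 - (b + 1) / (a + 1) * H t / 2) + (b + 1) / (a + 1) * H t) has_integral
      2 * 0 + (b + 1) / (a + 1) * (2 * fact (Suc a) * fact b / fact (Suc a + b + 1))) {0..pi}"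
    unfolding H_def[symmetric] .
  moreover have "(\<lambda>t. 2 * (G t / 2 - (b + 1) / (a + 1) * H t / 2) + (b + 1) / (a + 1) * H t) = G"
  proof
    fix t
    have "2 * (x / 2 - c * y / 2) + c * y = x" for c x y :: real
      by (simp add: field_simps)
    then show "2 * (G t / 2 - (b + 1) / (a + 1) * H t / 2) + (b + 1) / (a + 1) * H t = G t" .
  qed
  ultimately have "(G has_integral (b + 1) / (a + 1) * (2 * fact (Suc a) * fact b / fact (Suc a + b + 1))) {0..pi}"
    by simp
  moreover have "real (b + 1) / real (a + 1) * (2 * fact (Suc a) * fact b / fact (Suc a + b + 1))
     = (2 * fact a * fact (Suc b) / fact (a + Suc b + 1) :: real)"
  proof -
    have "real (b + 1) / real (a + 1) * (2 * fact (Suc a) * fact b / fact (Suc a + b + 1))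
      = 2 * (fact (Suc a) / real (a + 1)) * (real (b + 1) * fact b) / (fact (a + Suc b + 1) :: real)"
      by simp
    also have "fact (Suc a) / real (a + 1) = (fact a :: real)" by (simp del: of_nat_Suc)
    also have "real (b + 1) * fact b = (fact (Suc b) :: real)" by simp
    finally show ?thesis .
  qed
  ultimately show ?case unfolding G_def by (simp only:)
qed

text \<open>The norm is computed for q = 0 and carried over to the other weights by the ladder.\<close>

lemma wig_inner_norm:
  assumes "k \<le> p + q"
  shows "wig_inner p q k p q k =
    2 / (real (p + q) + 1) * (fact p * fact q / (fact k * fact (p + q - k)))"
  using assms
proof (induction q arbitrary: p)
  case 0
  have "wig_inner p 0 k p 0 k = (real (p choose k))\<^sup>2 * integral {0..pi} (\<lambda>t. sin (t / 2) ^ (2 * (p - k)) * cos (t / 2) ^ (2 * k) * sin t)"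
    unfolding wig_inner_def wig_q0 integral_mult_right[symmetric]
    by (rule arg_cong[of _ _ "integral _"]) (simp add: fun_eq_iff power_mult power2_eq_square power_mult_distrib)
  also have "\<dots> = (real (p choose k))\<^sup>2 * (2 * fact (p - k) * fact k / fact (p + 1))"
    using integral_half_angle_powers[of "p - k" k] 0 by (simp add: integral_unique)
  also have "\<dots> = 2 / (real p + 1) * (fact p / (fact k * fact (p - k)))"
    using 0 by (simp add: binomial_fact power2_eq_square divide_simps)
  finally show ?case by simp
next
  case (Suc q)
  have "real (p + 1) * wig_inner p (q + 1) k p (Suc q) k = real (Suc q) * wig_inner (p + 1) q k (p + 1) q k"
    using wig_inner_ladder[of p "Suc q" p q k k] by simp
  moreover have "wig_inner (p + 1) q k (p + 1) q k =
    2 / (real (p + Suc q) + 1) * (fact (p + 1) * fact q / (fact k * fact (p + Suc q - k)))"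
    using Suc.IH[of "p + 1"] Suc.prems by simp
  ultimately have "real (p + 1) * wig_inner p (Suc q) k p (Suc q) k =
    real (Suc q) * (2 / (real (p + Suc q) + 1) * (fact (p + 1) * fact q / (fact k * fact (p + Suc q - k))))"
    by (simp only: Suc_eq_plus1)
  then have "wig_inner p (Suc q) k p (Suc q) k =
    real (Suc q) * (2 / (real (p + Suc q) + 1) * (fact (p + 1) * fact q / (fact k * fact (p + Suc q - k)))) / real (p + 1)"
    by (metis nonzero_mult_div_cancel_left of_nat_eq_0_iff add_is_0 one_neq_zero)
  also have "\<dots> = 2 / (real (p + Suc q) + 1) * ((fact (p + 1) / real (p + 1)) * (real (Suc q) * fact q) / (fact k * fact (p + Suc q - k)))"
    by simp
  also have "fact (p + 1) / real (p + 1) = (fact p :: real)" by (simp del: of_nat_Suc)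
  also have "real (Suc q) * fact q = (fact (Suc q) :: real)" by simp
  finally show ?case .
qed

text \<open>The spin weights of both factors are raised together. The factor with the smaller l
  reaches q = 0 first and is then annihilated, while the q of the other one is still
  positive.\<close>

lemma wig_inner_orthogonal:
  assumes "p + q \<noteq> p' + q'" "p + q' = p' + q" "p + q + 2 * k' = p' + q' + 2 * k"
  shows "wig_inner p q k p' q' k' = 0"
proof -
  have *: "wig_inner p q k p' q' k' = 0"
    if less: "p + q < p' + q'" and sh: "p + q' = p' + q" "p + q + 2 * k' = p' + q' + 2 * k"
    for p q k p' q' k'
    using less sh
  proof (induction q arbitrary: p p' q')
    case 0
    from 0 obtain d where d: "q' = Suc d" by (cases q') auto
    have "real (p' + 1) * wig_inner p' (d + 1) k' p 0 k = real 0 * wig_inner (p' + 1) d k' (p + 1) (0 - 1) k"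
      by (rule wig_inner_ladder) (use 0 d in auto)
    then have "wig_inner p' q' k' p 0 k = 0" using d by simp
    then show ?case by (simp add: wig_inner_commute)
  next
    case (Suc q)
    from Suc obtain d where d: "q' = Suc d" by (cases q') auto
    have "real (p + 1) * wig_inner p (q + 1) k p' q' k' = real q' * wig_inner (p + 1) q k (p' + 1) (q' - 1) k'"
      by (rule wig_inner_ladder) (use Suc d in auto)
    also have "wig_inner (p + 1) q k (p' + 1) (q' - 1) k' = 0"
      by (rule Suc.IH) (use Suc d in auto)
    finally show ?case by simp
  qed
  show ?thesis
  proof (cases "p + q < p' + q'")
    case True then show ?thesis using * assms by simp
  next
    case False
    then have "wig_inner p' q' k' p q k = 0" by (intro *) (use assms in auto)
    then show ?thesis by (simp add: wig_inner_commute)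
  qed
qed

section \<open>Closed form of the spin weighted spherical harmonics\<close>

lemma higher_deriv_poly: "(deriv ^^ n) (poly p) = poly ((pderiv ^^ n) (p :: real poly))"
proof (induction n)
  case (Suc n)
  have "deriv (poly q) = poly (pderiv q)" for q :: "real poly"
    by (rule ext) (intro DERIV_imp_deriv poly_DERIV)
  then show ?case using Suc by simp
qed simp

lemma higher_pderiv_pcompose_shift:
  fixes p :: "real poly"
  shows "(pderiv ^^ n) (p \<circ>\<^sub>p [:x, 1:]) = (pderiv ^^ n) p \<circ>\<^sub>p [:x, 1:]"
  by (induction n) (simp_all add: pderiv_pcompose pderiv_pCons)

lemma poly_higher_pderiv_eq_coeff:
  fixes p :: "real poly"
  shows "poly ((pderiv ^^ n) p) x = fact n * coeff (p \<circ>\<^sub>p [:x, 1:]) n"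
proof -
  have "poly ((pderiv ^^ n) p) x = poly ((pderiv ^^ n) (p \<circ>\<^sub>p [:x, 1:])) 0"
    by (simp add: higher_pderiv_pcompose_shift poly_pcompose)
  also have "\<dots> = fact n * coeff (p \<circ>\<^sub>p [:x, 1:]) n"
    by (simp add: poly_0_coeff_0 coeff_higher_pderiv pochhammer_fact)
  finally show ?thesis .
qed

lemma pcompose_power: "(p ^ n) \<circ>\<^sub>p q = (p \<circ>\<^sub>p q) ^ n" for p q :: "'a :: comm_ring_1 poly"
  by (induction n) (simp_all add: pcompose_mult pcompose_1)

lemma minus_as_smult: "- p = smult (-1) p" for p :: "'a :: comm_ring_1 poly"
  by simp

lemma halfA_times_halfB:
  "halfA t * halfB t = smult (1/2) [:sin t, 2 * cos t, - sin t:]"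
  unfolding halfA_def halfB_def
  by (simp add: sin_double_half[of t] cos_double_half[of t] power2_eq_square algebra_simps)

text \<open>
  Taylor expansion of (u^2 - 1)^l at cos t, in the variable - X sin t, turns Rodrigues' formula into
  the coefficients of \<open>(halfA * halfB) ^ l\<close>.
\<close>

lemma legendre_deriv_eq_wig:
  assumes "sin t > 0"
  shows "(- sin t) ^ m * (deriv ^^ (l + m)) (\<lambda>u. (u\<^sup>2 - 1) ^ l) (cos t) = fact (l + m) * 2 ^ l * wig l l (l + m) t"
proof -
  define q where "q = ([:-1, 0, 1:] :: real poly)"
  have "(\<lambda>u::real. (u\<^sup>2 - 1) ^ l) = poly (q ^ l)"
    by (auto simp: q_def power2_eq_square algebra_simps poly_power)
  then have 1: "(deriv ^^ (l + m)) (\<lambda>u. (u\<^sup>2 - 1) ^ l) (cos t) = fact (l + m) * coeff (q ^ l \<circ>\<^sub>p [:cos t, 1:]) (l + m)"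
    by (simp add: higher_deriv_poly poly_higher_pderiv_eq_coeff)
  have "(- sin t) ^ (l + m) * coeff (q ^ l \<circ>\<^sub>p [:cos t, 1:]) (l + m) =
     coeff ((q ^ l \<circ>\<^sub>p [:cos t, 1:]) \<circ>\<^sub>p [:0, - sin t:]) (l + m)"
    by (simp add: coeff_pcompose_linear)
  also have "(q ^ l \<circ>\<^sub>p [:cos t, 1:]) \<circ>\<^sub>p [:0, - sin t:] = (smult (- (2 * sin t)) (halfA t * halfB t)) ^ l"
  proof -
    have "(q \<circ>\<^sub>p [:cos t, 1:]) \<circ>\<^sub>p [:0, - sin t:] = smult (- (2 * sin t)) (halfA t * halfB t)"
      unfolding halfA_times_halfB q_def
      by (rule poly_eq_fun, simp add: poly_pcompose, insert sin_cos_squared_add[of t], algebra)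
    then show ?thesis by (simp add: pcompose_power)
  qed
  also have "coeff \<dots> (l + m) = (- sin t) ^ l * 2 ^ l * wig l l (l + m) t"
  proof -
    have "(- (2 * sin t)) ^ l = (- sin t) ^ l * 2 ^ l" by (simp add: mult.commute flip: power_mult_distrib)
    then show ?thesis unfolding wig_def smult_power coeff_smult power_mult_distrib by simp
  qed
  finally have "(- sin t) ^ l * ((- sin t) ^ m * coeff (q ^ l \<circ>\<^sub>p [:cos t, 1:]) (l + m)) = (- sin t) ^ l * (2 ^ l * wig l l (l + m) t)"
    by (simp add: power_add mult_ac)
  then have "(- sin t) ^ m * coeff (q ^ l \<circ>\<^sub>p [:cos t, 1:]) (l + m) = 2 ^ l * wig l l (l + m) t"
    using assms by simp
  then show ?thesis unfolding 1 by (simp add: mult_ac)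
qed

text \<open>The product A B changes only its sign and its powers of X under X to - 1 / X, the
  antipodal map, and this exchanges the coefficients l + m and l - m of its l-th power. As
  \<open>reflect_poly\<close> reverses at the actual degree, sin t \<noteq> 0 is needed to keep the
  degree at 2 l.\<close>

lemma wig_reflect:
  assumes "sin t \<noteq> 0" "m \<le> l"
  shows "wig l l (l + m) t = (-1) ^ m * wig l l (l - m) t"
proof -
  define Q where "Q = halfA t * halfB t"
  have Q: "Q = smult (1/2) [:sin t, 2 * cos t, - sin t:]"
    unfolding Q_def by (rule halfA_times_halfB)
  have deg: "degree (Q ^ l) = 2 * l"
    using assms by (simp add: degree_power_eq Q)
  have "reflect_poly Q = - (Q \<circ>\<^sub>p [:0, -1:])"
    using assms(1) unfolding Q
    by (simp add: reflect_poly_smult reflect_poly_pCons' monom_altdef pcompose_pCons power2_eq_square)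
  then have "reflect_poly (Q ^ l) = smult ((-1) ^ l) (Q ^ l \<circ>\<^sub>p [:0, -1:])"
    unfolding reflect_poly_power pcompose_power
    by (simp only: minus_as_smult smult_power)
  then have "coeff (reflect_poly (Q ^ l)) (l - m) = (-1) ^ l * (-1) ^ (l - m) * coeff (Q ^ l) (l - m)"
    by (simp add: coeff_pcompose_linear)
  moreover have "2 * l - (l - m) = l + m" using assms by simp
  ultimately have "coeff (Q ^ l) (l + m) = (-1) ^ l * (-1) ^ (l - m) * coeff (Q ^ l) (l - m)"
    using assms unfolding coeff_reflect_poly deg by (simp only: \<open>2 * l - (l - m) = l + m\<close> split: if_splits)
  moreover have "(-1) ^ l * (-1) ^ (l - m) = ((-1) ^ m :: real)"
  proof -
    obtain d where "l = m + d" using assms le_Suc_ex by blast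
    then show ?thesis by (simp add: power_add flip: power_mult_distrib)
  qed
  ultimately show ?thesis unfolding wig_def Q_def by (simp add: power_mult_distrib)
qed

text \<open>The Taylor variable - X sin t brings in the sign (-1)^m, and the reflection from l + m
  to l - m removes it.\<close>

lemma assoc_legendre_cos:
  assumes "sin t > 0" "m \<le> l"
  shows "assoc_legendre l m (cos t) = fact (l + m) / fact l * wig l l (l - m) t"
proof -
  have sq: "(-1) ^ m * ((-1) ^ m * x) = (x :: real)" for x
    by (simp add: mult.assoc[symmetric] flip: power_mult_distrib)
  define D where "D = (deriv ^^ (l + m)) (\<lambda>u. (u\<^sup>2 - 1) ^ l) (cos t)"
  have "sqrt (1 - (cos t)\<^sup>2) = sin t"
    using assms by (simp flip: sin_squared_eq)
  moreover have "sin t ^ m * D = (-1) ^ m * ((- sin t) ^ m * D)"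
    unfolding power_minus[of "sin t" m] mult.assoc sq ..
  moreover have "\<dots> = fact (l + m) * 2 ^ l * wig l l (l - m) t"
    unfolding D_def legendre_deriv_eq_wig[OF assms(1)]
    using assms by (simp add: wig_reflect)
  ultimately show ?thesis
    unfolding assoc_legendre_def D_def[symmetric] by simp
qed

text \<open>Normalization concerns only the square of c. Its sign is left open, since it alternates
  with m for m \<ge> 0 and is constant for m < 0, where conjugation and \<open>wig_reflect\<close>
  compensate each other.\<close>

lemma sph_harm_closed_form:
  assumes "\<bar>m\<bar> \<le> int l"
  obtains c :: real where
    "c\<^sup>2 = (2 * real l + 1) / (4 * pi) * (fact (nat (int l - m)) * fact (nat (int l + m))) / (fact l)\<^sup>2"
    "\<And>t \<phi>. sin t > 0 \<Longrightarrow> sph_harm l m (t, \<phi>) = of_real (c * wig l l (nat (int l - m)) t) * exp (\<i> * of_int m * of_real \<phi>)"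
proof -
  define n where "n = nat \<bar>m\<bar>"
  have n: "n \<le> l" using assms by (simp add: n_def)
  define c where "c = sqrt ((2 * real l + 1) / (4 * pi) * (fact (l - n) / fact (l + n))) * (fact (l + n) / fact l)"
  have nonneg: "sph_harm_nonneg l n (t, \<phi>) = (-1) ^ n * of_real (c * wig l l (l - n) t) * exp (\<i> * of_nat n * of_real \<phi>)"
    if "sin t > 0" for t \<phi>
    using assoc_legendre_cos[OF that n] by (simp add: sph_harm_nonneg_def c_def mult_ac)
  have "c\<^sup>2 = (2 * real l + 1) / (4 * pi) * (fact (l - n) / fact (l + n)) * (fact (l + n) / fact l)\<^sup>2"
    unfolding c_def power_mult_distrib by (subst real_sqrt_pow2) auto
  also have "\<dots> = (2 * real l + 1) / (4 * pi) * (fact (l - n) * fact (l + n)) / (fact l)\<^sup>2"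
    by (simp add: power2_eq_square)
  finally have c: "c\<^sup>2 = (2 * real l + 1) / (4 * pi) * (fact (l - n) * fact (l + n)) / (fact l)\<^sup>2" .
  show ?thesis
  proof (cases "m \<ge> 0")
    case True
    then have mn: "m = int n" by (simp add: n_def)
    have sq: "((-1) ^ n)\<^sup>2 = (1 :: real)" by (simp flip: power_mult)
    have ln: "nat (int l - m) = l - n" "nat (int l + m) = l + n" using n mn by auto
    show ?thesis
    proof (rule that[of "(-1) ^ n * c"])
      show "((-1) ^ n * c)\<^sup>2 = (2 * real l + 1) / (4 * pi) * (fact (nat (int l - m)) * fact (nat (int l + m))) / (fact l)\<^sup>2"
        using c sq unfolding ln power_mult_distrib by simp
      fix t \<phi> :: real assume t: "sin t > 0"
      show "sph_harm l m (t, \<phi>) = of_real ((-1) ^ n * c * wig l l (nat (int l - m)) t) * exp (\<i> * of_int m * of_real \<phi>)"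
        using nonneg[OF t, of \<phi>] unfolding ln by (simp add: mn sph_harm_def)
    qed
  next
    case False
    then have mn: "m = - int n" by (simp add: n_def)
    have ln: "nat (int l - m) = l + n" "nat (int l + m) = l - n" using n mn by auto
    show ?thesis
    proof (rule that[of c])
      show "c\<^sup>2 = (2 * real l + 1) / (4 * pi) * (fact (nat (int l - m)) * fact (nat (int l + m))) / (fact l)\<^sup>2"
        using c unfolding ln by (simp add: mult_ac)
      fix t \<phi> :: real assume t: "sin t > 0"
      have "sph_harm l m (t, \<phi>) = (-1) ^ n * of_real (c * wig l l (l - n) t) * exp (- (\<i> * of_nat n * of_real \<phi>))"
        using False mn nonneg[OF t, of \<phi>] by (simp add: sph_harm_def exp_cnj)
      also have "\<dots> = of_real (c * ((-1) ^ n * wig l l (l - n) t)) * exp (- (\<i> * of_nat n * of_real \<phi>))"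
        by simp
      also have "(-1) ^ n * wig l l (l - n) t = wig l l (l + n) t"
        using wig_reflect[of t n l] t n by simp
      finally show "sph_harm l m (t, \<phi>) = of_real (c * wig l l (nat (int l - m)) t) * exp (\<i> * of_int m * of_real \<phi>)"
        unfolding ln by (simp add: mn)
    qed
  qed
qed


section \<open>The operators eth and eth-bar on separated functions\<close>

text \<open>The identity is demanded for every real phi, beyond the coordinate rectangle, because
  the operators differentiate in phi also at the edge phi = 0. The poles are excluded since the
  operators divide by sin theta.\<close>

definition separated_on_strip :: "(real \<times> real \<Rightarrow> complex) \<Rightarrow> complex \<Rightarrow> (real \<Rightarrow> real) \<Rightarrow> int \<Rightarrow> bool" where
  "separated_on_strip f a w m \<longleftrightarrow>
     (\<forall>t\<in>{0<..<pi}. \<forall>\<phi>. f (t, \<phi>) = a * of_real (w t) * exp (\<i> * of_int m * of_real \<phi>))"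

lemma separated_derivs:
  assumes f: "separated_on_strip f a w m" and t: "t \<in> {0<..<pi}"
    and w: "(w has_real_derivative w') (at t)"
  shows "vector_derivative (\<lambda>u. f (u, \<phi>)) (at t) = a * of_real w' * exp (\<i> * of_int m * of_real \<phi>)"
    and "vector_derivative (\<lambda>u. f (t, u)) (at \<phi>) = a * of_real (w t) * (\<i> * of_int m) * exp (\<i> * of_int m * of_real \<phi>)"
proof -
  have "((\<lambda>u. of_real (w u)) has_vector_derivative (of_real w' :: complex)) (at t)"
    using w by (intro has_vector_derivative_of_real) (simp add: has_real_derivative_iff_has_vector_derivative)
  then have "((\<lambda>u. a * of_real (w u) * exp (\<i> * of_int m * of_real \<phi>)) has_vector_derivative
         a * of_real w' * exp (\<i> * of_int m * of_real \<phi>)) (at t)"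
    by (intro has_vector_derivative_mult_left has_vector_derivative_mult_right)
  then have "((\<lambda>u. f (u, \<phi>)) has_vector_derivative a * of_real w' * exp (\<i> * of_int m * of_real \<phi>)) (at t)"
    by (rule has_vector_derivative_transform_within_open[where S = "{0<..<pi}"])
      (use f t in \<open>auto simp: separated_on_strip_def\<close>)
  then show "vector_derivative (\<lambda>u. f (u, \<phi>)) (at t) = a * of_real w' * exp (\<i> * of_int m * of_real \<phi>)"
    by (rule vector_derivative_at)
  have "((\<lambda>u. exp (\<i> * of_int m * of_real u)) has_vector_derivative
      (\<i> * of_int m) * exp (\<i> * of_int m * of_real \<phi>)) (at \<phi>)"
  proof -
    have "((\<lambda>z. exp (\<i> * of_int m * z)) has_field_derivative (\<i> * of_int m) * exp (\<i> * of_int m * of_real \<phi>)) (at (of_real \<phi>))"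
      by (auto intro!: derivative_eq_intros)
    then show ?thesis by (rule has_vector_derivative_real_field)
  qed
  then have "((\<lambda>u. (a * of_real (w t)) * exp (\<i> * of_int m * of_real u)) has_vector_derivative
      (a * of_real (w t)) * ((\<i> * of_int m) * exp (\<i> * of_int m * of_real \<phi>))) (at \<phi>)"
    by (rule has_vector_derivative_mult_right)
  moreover have "(\<lambda>u. f (t, u)) = (\<lambda>u. (a * of_real (w t)) * exp (\<i> * of_int m * of_real u))"
    using f t by (auto simp: separated_on_strip_def)
  ultimately have "((\<lambda>u. f (t, u)) has_vector_derivative
      (a * of_real (w t)) * ((\<i> * of_int m) * exp (\<i> * of_int m * of_real \<phi>))) (at \<phi>)"
    by simp
  then show "vector_derivative (\<lambda>u. f (t, u)) (at \<phi>) = a * of_real (w t) * (\<i> * of_int m) * exp (\<i> * of_int m * of_real \<phi>)"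
    by (simp add: vector_derivative_at mult.assoc)
qed

lemma eth_separated:
  assumes f: "separated_on_strip f a (wig p q k) m"
    and m: "2 * m = int p + int q - 2 * int k" and s: "2 * s = int p - int q"
  shows "separated_on_strip (eth s f) (a * of_nat q) (wig (p + 1) (q - 1) k) m"
    and "separated_on_strip (ethbar s f) (a * - of_nat p) (wig (p - 1) (q + 1) k) m"
proof -
  have pq: "2 * real_of_int m = real p + real q - 2 * real k" "2 * real_of_int s = real p - real q"
    using arg_cong[OF m, of real_of_int] arg_cong[OF s, of real_of_int] by simp_all
  \<comment> \<open>The diagonal term of the ladder is exactly the multiplier m + s cos t that the
    operators contribute after multiplication by sin t. The two cancel, and only the neighbouring
    weight remains.\<close>
  have W: "real p * (cos (t/2))\<^sup>2 + real q * (sin (t/2))\<^sup>2 - real k = of_int m + of_int s * cos t" for t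
  proof -
    have e: "real q = real p - 2 * of_int s" "real k = real p - of_int s - of_int m" using pq by linarith+
    show ?thesis unfolding e cos_half_squared sin_half_squared by (simp add: field_simps)
  qed
  have "eth s f (t, \<phi>) = a * of_nat q * of_real (wig (p + 1) (q - 1) k t) * exp (\<i> * of_int m * of_real \<phi>)
    \<and> ethbar s f (t, \<phi>) = a * - of_nat p * of_real (wig (p - 1) (q + 1) k t) * exp (\<i> * of_int m * of_real \<phi>)"
    if t: "t \<in> {0<..<pi}" for t \<phi>
  proof
    have sin: "sin t > 0" using t by (auto intro: sin_gt_zero)
    define E where "E = exp (\<i> * of_int m * of_real \<phi>)"
    note D = separated_derivs[OF f t wig_deriv]
    have ft: "f (t, \<phi>) = a * of_real (wig p q k t) * E"
      using f t by (simp add: separated_on_strip_def E_def)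
    have "wig' p q k t - (of_int m / sin t + of_int s * cot t) * wig p q k t = - real q * wig (p + 1) (q - 1) k t"
      using wig_ladder(1)[of t p q k] sin unfolding W by (simp add: cot_def field_simps)
    then have "complex_of_real (wig' p q k t) - (of_int m / of_real (sin t) + of_int s * of_real (cot t)) * of_real (wig p q k t)
        = - of_nat q * of_real (wig (p + 1) (q - 1) k t)"
      by (metis (no_types, lifting) of_real_add of_real_diff of_real_divide of_real_minus of_real_mult of_real_of_int_eq of_real_of_nat_eq)
    moreover have "eth s f (t, \<phi>) = - (a * E * (complex_of_real (wig' p q k t) - (of_int m / of_real (sin t) + of_int s * of_real (cot t)) * of_real (wig p q k t)))"
      unfolding eth_def prod.case D ft E_def[symmetric] by (simp add: algebra_simps)
    ultimately have "eth s f (t, \<phi>) = - (a * E * (- of_nat q * of_real (wig (p + 1) (q - 1) k t)))"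
      by (simp only:)
    then show "eth s f (t, \<phi>) = a * of_nat q * of_real (wig (p + 1) (q - 1) k t) * exp (\<i> * of_int m * of_real \<phi>)"
      unfolding E_def[symmetric] by (simp add: algebra_simps)
    have "wig' p q k t + (of_int m / sin t + of_int s * cot t) * wig p q k t = real p * wig (p - 1) (q + 1) k t"
      using wig_ladder(2)[of t p q k] sin unfolding W by (simp add: cot_def field_simps)
    then have "complex_of_real (wig' p q k t) + (of_int m / of_real (sin t) + of_int s * of_real (cot t)) * of_real (wig p q k t)
        = of_nat p * of_real (wig (p - 1) (q + 1) k t)"
      by (metis (no_types, lifting) of_real_add of_real_diff of_real_divide of_real_minus of_real_mult of_real_of_int_eq of_real_of_nat_eq)
    moreover have "ethbar s f (t, \<phi>) = - (a * E * (complex_of_real (wig' p q k t) + (of_int m / of_real (sin t) + of_int s * of_real (cot t)) * of_real (wig p q k t)))"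
      unfolding ethbar_def prod.case D ft E_def[symmetric] by (simp add: algebra_simps)
    ultimately have "ethbar s f (t, \<phi>) = - (a * E * (of_nat p * of_real (wig (p - 1) (q + 1) k t)))"
      by (simp only:)
    then show "ethbar s f (t, \<phi>) = a * - of_nat p * of_real (wig (p - 1) (q + 1) k t) * exp (\<i> * of_int m * of_real \<phi>)"
      unfolding E_def[symmetric] by (simp add: algebra_simps)
  qed
  then show "separated_on_strip (eth s f) (a * of_nat q) (wig (p + 1) (q - 1) k) m"
    and "separated_on_strip (ethbar s f) (a * - of_nat p) (wig (p - 1) (q + 1) k) m"
    unfolding separated_on_strip_def by blast+
qed

text \<open>The step from n to n + 1 contributes the factor l - n in both directions, whence the
  quotient of factorials; eth-bar adds a sign each time.\<close>

lemma eth_power_separated: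
  assumes "separated_on_strip f a (wig l l (nat (int l - m))) m" "\<bar>m\<bar> \<le> int l" "n \<le> l"
  shows "separated_on_strip (eth_power n f) (a * of_real (fact l / fact (l - n))) (wig (l + n) (l - n) (nat (int l - m))) m
    \<and> separated_on_strip (ethbar_power n f) (a * (-1) ^ n * of_real (fact l / fact (l - n))) (wig (l - n) (l + n) (nat (int l - m))) m"
  using assms(3)
proof (induction n)
  case (Suc n)
  have F: "fact l / fact (l - n) * real (l - n) = fact l / fact (l - Suc n)"
  proof -
    have "fact (l - n) = real (l - n) * fact (l - Suc n)"
      using Suc.prems by (metis Suc_diff_Suc Suc_le_lessD fact_Suc of_nat_fact of_nat_mult)
    then show ?thesis using Suc.prems by simp
  qed
  then have F': "of_real (fact l / fact (l - n)) * of_nat (l - n) = (of_real (fact l / fact (l - Suc n)) :: complex)"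
    by (metis of_real_mult of_real_of_nat_eq)
  have "separated_on_strip (eth (int n) (eth_power n f)) (a * of_real (fact l / fact (l - n)) * of_nat (l - n))
      (wig (l + n + 1) (l - n - 1) (nat (int l - m))) m"
    by (rule eth_separated(1)) (use Suc assms(2) in auto)
  then have "separated_on_strip (eth_power (Suc n) f) (a * of_real (fact l / fact (l - Suc n))) (wig (l + Suc n) (l - Suc n) (nat (int l - m))) m"
    unfolding mult.assoc F' by simp
  moreover have "separated_on_strip (ethbar (- int n) (ethbar_power n f)) (a * (-1) ^ n * of_real (fact l / fact (l - n)) * - of_nat (l - n))
      (wig (l - n - 1) (l + n + 1) (nat (int l - m))) m"
    by (rule eth_separated(2)) (use Suc assms(2) in auto)
  moreover have "a * (-1) ^ n * of_real (fact l / fact (l - n)) * - of_nat (l - n) =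
     a * (-1) ^ Suc n * (of_real (fact l / fact (l - n)) * of_nat (l - n))"
    by simp
  ultimately show ?case unfolding F' by simp
qed (use assms in simp_all)

lemma spin_sph_harm_closed_form:
  assumes "\<bar>m\<bar> \<le> int l" "\<bar>s\<bar> \<le> int l"
  obtains c :: real where
    "c\<^sup>2 = (2 * real l + 1) / (4 * pi) * (fact (nat (int l - m)) * fact (nat (int l + m))) /
       (fact (nat (int l - s)) * fact (nat (int l + s)))"
    "separated_on_strip (spin_sph_harm s l m) (of_real c) (wig (nat (int l + s)) (nat (int l - s)) (nat (int l - m))) m"
proof -
  obtain c where c: "c\<^sup>2 = (2 * real l + 1) / (4 * pi) * (fact (nat (int l - m)) * fact (nat (int l + m))) / (fact l)\<^sup>2"
    "\<And>t \<phi>. sin t > 0 \<Longrightarrow> sph_harm l m (t, \<phi>) = of_real (c * wig l l (nat (int l - m)) t) * exp (\<i> * of_int m * of_real \<phi>)"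
    using sph_harm_closed_form[OF assms(1)] by blast
  have sep: "separated_on_strip (sph_harm l m) (of_real c) (wig l l (nat (int l - m))) m"
    unfolding separated_on_strip_def using c(2) sin_gt_zero by auto
  define n where "n = nat \<bar>s\<bar>"
  have n: "n \<le> l" using assms(2) by (simp add: n_def)
  note P = eth_power_separated[OF sep assms(1) n]
  have sq: "(sqrt (fact (l - n) / fact (l + n)))\<^sup>2 = (fact (l - n) / fact (l + n) :: real)"
    by simp
  \<comment> \<open>The normalizing root times the factor produced by the n operators. Its square is
    symmetric under the exchange of s and - s, so one constant serves both signs of s.\<close>
  define d where "d = c * (sqrt (fact (l - n) / fact (l + n)) * (fact l / fact (l - n)))"
  have "d\<^sup>2 = c\<^sup>2 * (fact (l - n) / fact (l + n) * (fact l / fact (l - n))\<^sup>2)"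
    unfolding d_def power_mult_distrib sq ..
  also have "\<dots> = (2 * real l + 1) / (4 * pi) * (fact (nat (int l - m)) * fact (nat (int l + m))) / (fact (l - n) * fact (l + n))"
    unfolding c(1) by (simp add: power2_eq_square)
  finally have d: "d\<^sup>2 = (2 * real l + 1) / (4 * pi) * (fact (nat (int l - m)) * fact (nat (int l + m))) / (fact (l - n) * fact (l + n))" .
  show ?thesis
  proof (cases "s \<ge> 0")
    case True
    then have ln: "nat (int l - s) = l - n" "nat (int l + s) = l + n" "nat s = n" using n by (auto simp: n_def)
    show ?thesis
    proof (rule that[of d], unfold ln)
      show "separated_on_strip (spin_sph_harm s l m) (of_real d) (wig (l + n) (l - n) (nat (int l - m))) m"
        using conjunct1[OF P] True unfolding separated_on_strip_def spin_sph_harm_def ln d_def by simp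
    qed (use d in simp)
  next
    case False
    then have ln: "nat (int l - s) = l + n" "nat (int l + s) = l - n" "nat (- s) = n" using n by (auto simp: n_def)
    \<comment> \<open>For negative s the sign \<open>(-1) ^ n\<close> in the definition of the
      harmonics cancels the one produced by n applications of eth-bar.\<close>
    have sg: "(-1) ^ n * ((-1) ^ n * x) = (x :: complex)" for x
      by (simp add: mult.assoc[symmetric] flip: power_mult_distrib)
    show ?thesis
    proof (rule that[of d], unfold ln)
      show "separated_on_strip (spin_sph_harm s l m) (of_real d) (wig (l - n) (l + n) (nat (int l - m))) m"
        using conjunct2[OF P] False unfolding separated_on_strip_def spin_sph_harm_def ln d_def
        by (simp add: sg mult.assoc mult.left_commute[of "(-1) ^ n"])
    qed (use d in \<open>simp add: mult.commute\<close>)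
  qed
qed

section \<open>The surface measure and square integrable functions\<close>

text \<open>The null sets of the restriction are the null sets of M inside S, so both orders of the
  operations adjoin the same sets. This exhibits \<open>sphere_measure\<close> as the completion of
  a Borel measure.\<close>

lemma completion_restrict_space:
  assumes S: "S \<in> sets M"
  shows "completion (restrict_space M S) = restrict_space (completion M) S"
proof -
  have S': "S \<inter> space M \<in> sets M" "S \<inter> space (completion M) \<in> sets (completion M)"
    using S by auto
  have "sets (completion (restrict_space M S)) \<subseteq> sets (restrict_space (completion M) S)"
  proof
    fix A assume "A \<in> sets (completion (restrict_space M S))"
    then obtain B N N' where A: "A = B \<union> N'" "B \<in> sets (restrict_space M S)" "N' \<subseteq> N" "N \<in> null_sets (restrict_space M S)"
      by (auto elim: sets_completionE)
    moreover from A S' have "N \<in> null_sets M" "N \<subseteq> S" "B \<in> sets M" "B \<subseteq> S"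
      by (auto simp: null_sets_restrict_space[OF S] sets_restrict_space_iff)
    ultimately show "A \<in> sets (restrict_space (completion M) S)"
      using S' sets_completionI[of A B N' N M] by (auto simp: sets_restrict_space_iff)
  qed
  moreover have "sets (restrict_space (completion M) S) \<subseteq> sets (completion (restrict_space M S))"
  proof
    fix A assume "A \<in> sets (restrict_space (completion M) S)"
    then have "A \<subseteq> S" "A \<in> sets (completion M)" using S' by (auto simp: sets_restrict_space_iff)
    then obtain B N N' where A: "A = B \<union> N'" "B \<in> sets M" "N' \<subseteq> N" "N \<in> null_sets M"
      by (auto elim: sets_completionE)
    have "N \<inter> S \<in> null_sets M" using A(4) S by (rule null_set_Int2)
    moreover have "N' \<subseteq> N \<inter> S" "B \<subseteq> S" using A \<open>A \<subseteq> S\<close> by auto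
    ultimately show "A \<in> sets (completion (restrict_space M S))"
      using A S' by (intro sets_completionI[of _ B N' "N \<inter> S"]) (auto simp: sets_restrict_space_iff null_sets_restrict_space[OF S])
  qed
  ultimately have sets: "sets (completion (restrict_space M S)) = sets (restrict_space (completion M) S)" by blast
  show ?thesis
  proof (rule measure_eqI[OF sets])
    fix A assume "A \<in> sets (completion (restrict_space M S))"
    then obtain B N N' where A: "A = B \<union> N'" "B \<in> sets (restrict_space M S)" "N' \<subseteq> N" "N \<in> null_sets (restrict_space M S)"
      by (auto elim: sets_completionE)
    have N: "N \<in> null_sets M" and AS: "B \<subseteq> S" "N' \<subseteq> S" "B \<in> sets M"
      using A S' by (auto simp: null_sets_restrict_space[OF S] sets_restrict_space_iff)
    have "emeasure (completion (restrict_space M S)) A = emeasure (restrict_space M S) B"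
      unfolding A(1) by (subst emeasure_Un_null_set) (use A(2) null_sets_completion_subset[OF A(3) null_sets_completionI[OF A(4)]] in auto)
    also have "\<dots> = emeasure M B" by (rule emeasure_restrict_space[OF S'(1) AS(1)])
    also have "\<dots> = emeasure (completion M) (B \<union> N')"
      by (subst emeasure_Un_null_set) (use AS(3) null_sets_completion_subset[OF A(3) null_sets_completionI[OF N]] in auto)
    also have "\<dots> = emeasure (restrict_space (completion M) S) A"
      unfolding A(1) using AS by (intro emeasure_restrict_space[symmetric, OF S'(2)]) auto
    finally show "emeasure (completion (restrict_space M S)) A = emeasure (restrict_space (completion M) S) A" .
  qed
qed

text \<open>In a complete measure a change on a null set keeps preimages measurable. It is through
  this lemma that the behaviour at the poles and the choice of Euler angles there become
  irrelevant.\<close>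

lemma borel_measurable_completion_AE:
  fixes f g :: "'a \<Rightarrow> 'b :: topological_space"
  assumes f: "f \<in> borel_measurable (completion M)" and eq: "AE x in M. f x = g x"
  shows "g \<in> borel_measurable (completion M)"
proof (rule measurableI)
  fix A :: "'b set" assume A: "A \<in> sets borel"
  have 1: "f -` A \<inter> space (completion M) \<in> sets (completion M)"
    by (rule measurable_sets[OF f A])
  have 2: "AE x in completion M. (x \<in> f -` A \<inter> space (completion M)) = (x \<in> g -` A \<inter> space (completion M))"
    unfolding AE_completion_iff using eq by eventually_elim auto
  show "g -` A \<inter> space (completion M) \<in> sets (completion M)"
    by (rule completion.in_sets_AE[OF 2 1]) blast
qed auto

text \<open>Image measures under Borel maps and measurability in a parameter are treated on this
  Borel version and then carried over to its completion \<open>sphere_measure\<close>.\<close>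

definition sphere_borel :: "(real \<times> real) measure" where
  "sphere_borel = density (restrict_space lborel sphere_coords) (\<lambda>p. ennreal (sin (fst p)))"

lemma sphere_coords_borel [measurable]: "sphere_coords \<in> sets borel"
  unfolding sphere_coords_def by (intro borel_Times) auto

lemma AE_sphere_coords_fst:
  "AE p in restrict_space lborel sphere_coords. fst p \<noteq> c"
proof -
  have "negligible {x :: real \<times> real. x \<bullet> (1, 0) = c}"
    by (rule negligible_standard_hyperplane) (auto simp: Basis_prod_def)
  moreover have "{x :: real \<times> real. x \<bullet> (1, 0) = c} = {x. fst x = c}"
    by (auto simp: inner_prod_def)
  ultimately have "{x. fst x = c} \<in> null_sets (lebesgue :: (real \<times> real) measure)"
    by (simp add: negligible_iff_null_sets)
  then have "AE x in (lebesgue :: (real \<times> real) measure). fst x \<noteq> c"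
    by (rule AE_I') auto
  then have "AE x in (lborel :: (real \<times> real) measure). fst x \<noteq> c"
    by (simp add: AE_completion_iff)
  then show ?thesis
    by (subst AE_restrict_space_iff) auto
qed

lemma AE_sphere_coords_interior:
  "AE p in restrict_space lborel sphere_coords. fst p \<in> {0<..<pi}"
proof -
  have "AE p in restrict_space lborel sphere_coords. p \<in> sphere_coords"
    by (rule AE_I2) (auto simp: space_restrict_space)
  with AE_sphere_coords_fst[of 0] AE_sphere_coords_fst[of pi] show ?thesis
    by eventually_elim (auto simp: sphere_coords_def)
qed

lemma measurable_sin_fst [measurable]: "(\<lambda>p. ennreal (sin (fst p))) \<in> borel_measurable (restrict_space lborel sphere_coords)"
proof -
  have "(\<lambda>p :: real \<times> real. sin (fst p)) \<in> borel_measurable borel"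
    by (intro borel_measurable_continuous_onI continuous_intros)
  then show ?thesis
    by (intro measurable_restrict_space1) simp
qed

text \<open>A density that is positive almost everywhere creates no new null sets, so taking the
  density commutes with completion.\<close>

lemma sphere_measure_eq_completion: "sphere_measure = completion sphere_borel"
proof -
  have "completion sphere_borel = density (completion (restrict_space lborel sphere_coords)) (\<lambda>p. ennreal (sin (fst p)))"
    unfolding sphere_borel_def
  proof (rule completion_density_eq)
    show "AE p in restrict_space lborel sphere_coords. 0 < ennreal (sin (fst p))"
      using AE_sphere_coords_interior by eventually_elim (auto intro: sin_gt_zero)
  qed simp
  also have "completion (restrict_space lborel sphere_coords) = lebesgue_on sphere_coords"
    by (rule completion_restrict_space) simp
  finally show ?thesis
    unfolding sphere_measure_def by (simp add: case_prod_beta')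
qed

lemma space_sphere_borel [simp]: "space sphere_borel = sphere_coords"
  by (simp add: sphere_borel_def space_restrict_space)

lemma space_sphere_measure [simp]: "space sphere_measure = sphere_coords"
  by (simp add: sphere_measure_eq_completion)

lemma sets_sphere_borel: "sets sphere_borel = sets (restrict_space borel sphere_coords)"
  by (simp add: sphere_borel_def sets_restrict_space)

lemma measurable_sphere_borel: "f \<in> borel_measurable borel \<Longrightarrow> f \<in> borel_measurable sphere_borel"
  unfolding measurable_cong_sets[OF sets_sphere_borel refl] by (rule measurable_restrict_space1)

lemma measurable_sphere_measure: "f \<in> borel_measurable borel \<Longrightarrow> f \<in> borel_measurable sphere_measure"
  unfolding sphere_measure_eq_completion by (intro measurable_completion measurable_sphere_borel)

lemma AE_sphere_measure_iff: "(AE p in sphere_measure. P p) \<longleftrightarrow> (AE p in sphere_borel. P p)"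
  unfolding sphere_measure_eq_completion by (rule AE_completion_iff)

lemma AE_sphere_interior: "AE p in sphere_measure. fst p \<in> {0<..<pi} \<and> snd p \<in> {0..<2 * pi}"
proof -
  have "AE p in sphere_borel. fst p \<in> {0<..<pi}"
    unfolding sphere_borel_def
    by (subst AE_density[OF measurable_sin_fst]) (use AE_sphere_coords_interior in \<open>auto elim: eventually_mono\<close>)
  moreover have "AE p in sphere_borel. p \<in> sphere_coords" by (rule AE_I2) simp
  ultimately have "AE p in sphere_borel. fst p \<in> {0<..<pi} \<and> snd p \<in> {0..<2 * pi}"
    by eventually_elim (auto simp: sphere_coords_def)
  then show ?thesis by (simp add: AE_sphere_measure_iff)
qed

lemma borel_measurable_sphere_AE:
  assumes "f \<in> borel_measurable sphere_measure" "AE p in sphere_measure. f p = g p"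
  shows "g \<in> borel_measurable sphere_measure"
  using assms unfolding sphere_measure_eq_completion AE_completion_iff by (rule borel_measurable_completion_AE)

lemma sphere_integral_continuous:
  fixes f :: "real \<times> real \<Rightarrow> 'a :: euclidean_space"
  assumes f: "continuous_on UNIV f"
  shows "integrable sphere_measure f"
    and "integral\<^sup>L sphere_measure f = integral {0..pi} (\<lambda>\<theta>. integral {0..2 * pi} (\<lambda>\<phi>. sin \<theta> *\<^sub>R f (\<theta>, \<phi>)))"
proof -
  define g where "g p = sin (fst p) *\<^sub>R f p" for p
  have g: "continuous_on T g" for T
    unfolding g_def by (intro continuous_intros continuous_on_subset[OF f]) auto
  have abs: "g absolutely_integrable_on cbox (0, 0) (pi, 2 * pi)"
    by (intro absolutely_integrable_continuous g)
  have sub: "sphere_coords \<subseteq> cbox (0, 0) (pi, 2 * pi)"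
    by (auto simp: sphere_coords_def cbox_Pair_eq)
  have abs': "integrable (lebesgue_on sphere_coords) g"
  proof (rule absolutely_integrable_imp_integrable)
    show "g absolutely_integrable_on sphere_coords"
      by (rule set_integrable_subset[OF abs _ sub]) simp
  qed simp
  have meas_cont: "h \<in> borel_measurable (lebesgue_on sphere_coords)" if "continuous_on UNIV h"
    for h :: "real \<times> real \<Rightarrow> 'b :: euclidean_space"
    by (intro continuous_imp_measurable_on_sets_lebesgue continuous_on_subset[OF that]) auto
  have meas: "(\<lambda>p. sin (fst p)) \<in> borel_measurable (lebesgue_on sphere_coords)"
    "f \<in> borel_measurable (lebesgue_on sphere_coords)"
    by (intro meas_cont continuous_intros f)+
  have nn: "AE p in lebesgue_on sphere_coords. 0 \<le> sin (fst p)"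
    by (rule AE_I2) (auto simp: sphere_coords_def space_restrict_space intro: sin_ge_zero)
  have sm: "sphere_measure = density (lebesgue_on sphere_coords) (\<lambda>p. ennreal (sin (fst p)))"
    unfolding sphere_measure_def by (simp add: case_prod_beta')
  show "integrable sphere_measure f"
    unfolding sm using abs' by (subst integrable_density[OF meas(2,1) nn]) (simp add: g_def[abs_def])
  have "integral\<^sup>L sphere_measure f = integral\<^sup>L (lebesgue_on sphere_coords) g"
    unfolding sm g_def by (rule integral_density[OF meas(2,1) nn])
  also have "\<dots> = integral sphere_coords g"
    by (rule lebesgue_integral_eq_integral[OF abs']) simp
  also have "\<dots> = integral (cbox (0, 0) (pi, 2 * pi)) g"
  proof (rule integral_spike_set)
    \<comment> \<open>The closed rectangle exceeds \<open>sphere_coords\<close> only by the edge phi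
      = 2 pi.\<close>
    have "negligible {x :: real \<times> real. x \<bullet> (0, 1) = 2 * pi}"
      by (rule negligible_standard_hyperplane) (auto simp: Basis_prod_def)
    then show "negligible {x \<in> cbox (0, 0) (pi, 2 * pi) - sphere_coords. g x \<noteq> 0}"
      by (rule negligible_subset) (auto simp: sphere_coords_def cbox_Pair_eq inner_prod_def)
    show "negligible {x \<in> sphere_coords - cbox (0, 0) (pi, 2 * pi). g x \<noteq> 0}"
    proof -
      have "{x \<in> sphere_coords - cbox (0, 0) (pi, 2 * pi). g x \<noteq> 0} = {}" using sub by blast
      then show ?thesis by (simp only: negligible_empty)
    qed
  qed
  also have "\<dots> = integral {0..pi} (\<lambda>\<theta>. integral {0..2 * pi} (\<lambda>\<phi>. g (\<theta>, \<phi>)))"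
    using integral_prod_continuous[OF g, of 0 0 pi "2 * pi"] by simp
  finally show "integral\<^sup>L sphere_measure f = integral {0..pi} (\<lambda>\<theta>. integral {0..2 * pi} (\<lambda>\<phi>. sin \<theta> *\<^sub>R f (\<theta>, \<phi>)))"
    by (simp add: g_def)
qed

lemma finite_measure_sphere: "finite_measure sphere_measure"
proof
  have "integrable sphere_measure (\<lambda>_. 1 :: real)"
    by (rule sphere_integral_continuous) simp
  then have "integrable sphere_measure (indicator (space sphere_measure) :: _ \<Rightarrow> real)"
    by (subst Bochner_Integration.integrable_cong[OF refl, where g = "\<lambda>_. 1"]) auto
  then show "emeasure sphere_measure (space sphere_measure) \<noteq> \<infinity>"
    unfolding integrable_indicator_iff by auto
qed

interpretation sphere: finite_measure sphere_measure
  by (rule finite_measure_sphere)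

section \<open>Orthonormality of the harmonics\<close>

definition spin_amp :: "int \<Rightarrow> nat \<Rightarrow> int \<Rightarrow> real" where
  "spin_amp s l m = (SOME c. c\<^sup>2 = (2 * real l + 1) / (4 * pi) * (fact (nat (int l - m)) * fact (nat (int l + m))) /
       (fact (nat (int l - s)) * fact (nat (int l + s))) \<and>
    separated_on_strip (spin_sph_harm s l m) (of_real c) (wig (nat (int l + s)) (nat (int l - s)) (nat (int l - m))) m)"

text \<open>
  The closed form of a spin weighted spherical harmonic.  Unlike the iterated derivatives, it is
  continuous up to the poles.
\<close>

definition spinY :: "int \<Rightarrow> nat \<Rightarrow> int \<Rightarrow> real \<times> real \<Rightarrow> complex" where
  "spinY s l m p = of_real (spin_amp s l m * wig (nat (int l + s)) (nat (int l - s)) (nat (int l - m)) (fst p))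
      * exp (\<i> * of_int m * of_real (snd p))"

lemma spin_amp:
  assumes "\<bar>m\<bar> \<le> int l" "\<bar>s\<bar> \<le> int l"
  shows "(spin_amp s l m)\<^sup>2 = (2 * real l + 1) / (4 * pi) * (fact (nat (int l - m)) * fact (nat (int l + m))) /
       (fact (nat (int l - s)) * fact (nat (int l + s)))" (is ?A)
    and "separated_on_strip (spin_sph_harm s l m) (of_real (spin_amp s l m)) (wig (nat (int l + s)) (nat (int l - s)) (nat (int l - m))) m" (is ?B)
proof -
  have "?A \<and> ?B"
    unfolding spin_amp_def by (rule someI_ex) (metis spin_sph_harm_closed_form[OF assms])
  then show ?A ?B by blast+
qed

lemma spin_sph_harm_AE:
  assumes "\<bar>m\<bar> \<le> int l" "\<bar>s\<bar> \<le> int l"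
  shows "AE p in sphere_measure. spin_sph_harm s l m p = spinY s l m p"
  using AE_sphere_interior
proof eventually_elim
  case (elim p)
  then show ?case
    using spin_amp(2)[OF assms] by (cases p) (auto simp: separated_on_strip_def spinY_def)
qed

lemma continuous_on_wig_comp [continuous_intros]:
  "continuous_on T f \<Longrightarrow> continuous_on T (\<lambda>x. wig p q k (f x))"
  using continuous_on_compose2[OF continuous_on_wig[of UNIV]] by blast

lemma continuous_on_spinY: "continuous_on T (spinY s l m)"
  unfolding spinY_def[abs_def] by (intro continuous_intros)

lemma integral_exp_int:
  "integral {0..2 * pi} (\<lambda>\<phi>. exp (\<i> * of_int n * of_real \<phi>)) = (if n = 0 then of_real (2 * pi) else (0 :: complex))"
proof (cases "n = 0")
  case False
  have "((\<lambda>\<phi>. exp (\<i> * of_int n * of_real \<phi>)) has_integral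
      (exp (\<i> * of_int n * of_real (2 * pi)) / (\<i> * of_int n) - exp (\<i> * of_int n * of_real 0) / (\<i> * of_int n))) {0..2 * pi}"
  proof (rule fundamental_theorem_of_calculus)
    fix x :: real
    have "((\<lambda>z. exp (\<i> * of_int n * z) / (\<i> * of_int n)) has_field_derivative exp (\<i> * of_int n * of_real x)) (at (of_real x))"
      using False by (auto intro!: derivative_eq_intros)
    then have "((\<lambda>u. exp (\<i> * of_int n * of_real u) / (\<i> * of_int n)) has_vector_derivative exp (\<i> * of_int n * of_real x)) (at x)"
      by (rule has_vector_derivative_real_field)
    then show "((\<lambda>u. exp (\<i> * of_int n * of_real u) / (\<i> * of_int n)) has_vector_derivative exp (\<i> * of_int n * of_real x)) (at x within {0..2 * pi})"
      by (rule has_vector_derivative_at_within)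
  qed simp
  moreover have "exp (\<i> * of_int n * of_real (2 * pi)) = 1"
    using exp_integer_2pi[of "of_int n"] by (simp add: mult_ac)
  ultimately show ?thesis using False by (simp add: integral_unique)
qed (simp add: scaleR_conv_of_real)

text \<open>The integral over phi separates different m, the one over theta different l. The square
  of the amplitude is the inverse of 2 pi times the squared norm of \<open>wig\<close>.\<close>

lemma sphere_inner_spinY:
  assumes lm: "\<bar>m\<bar> \<le> int l" "\<bar>s\<bar> \<le> int l" and lm': "\<bar>m'\<bar> \<le> int l'" "\<bar>s\<bar> \<le> int l'"
  shows "sphere_inner (spinY s l m) (spinY s l' m') = (if l = l' \<and> m = m' then 1 else 0)"
proof -
  define p q k where "p = nat (int l + s)" and "q = nat (int l - s)" and "k = nat (int l - m)"
  define p' q' k' where "p' = nat (int l' + s)" and "q' = nat (int l' - s)" and "k' = nat (int l' - m')"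
  define c where "c = spin_amp s l m * spin_amp s l' m'"
  note pq = p_def q_def k_def p'_def q'_def k'_def
  have ptw: "cnj (spinY s l m (\<theta>, \<phi>)) * spinY s l' m' (\<theta>, \<phi>) =
     of_real (c * (wig p q k \<theta> * wig p' q' k' \<theta>)) * exp (\<i> * of_int (m' - m) * of_real \<phi>)" for \<theta> \<phi>
    unfolding spinY_def fst_conv snd_conv pq[symmetric] c_def
    by (simp add: exp_cnj mult_ac left_diff_distrib right_diff_distrib exp_diff exp_minus divide_inverse)
  have "sphere_inner (spinY s l m) (spinY s l' m') =
    integral {0..pi} (\<lambda>\<theta>. integral {0..2 * pi} (\<lambda>\<phi>. sin \<theta> *\<^sub>R (cnj (spinY s l m (\<theta>, \<phi>)) * spinY s l' m' (\<theta>, \<phi>))))"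
    unfolding sphere_inner_def
    by (rule sphere_integral_continuous) (intro continuous_intros continuous_on_spinY)
  also have "\<dots> = integral {0..pi} (\<lambda>\<theta>. of_real (c * (wig p q k \<theta> * wig p' q' k' \<theta> * sin \<theta>)) * (if m' - m = 0 then of_real (2 * pi) else 0))"
    unfolding ptw integral_exp_int[symmetric] scaleR_conv_of_real mult.assoc[symmetric] of_real_mult[symmetric]
      integral_mult_right by (simp only: mult_ac)
  finally have I: "sphere_inner (spinY s l m) (spinY s l' m') =
     integral {0..pi} (\<lambda>\<theta>. of_real (c * (wig p q k \<theta> * wig p' q' k' \<theta> * sin \<theta>)) * (if m' - m = 0 then of_real (2 * pi) else 0))" .
  show ?thesis
  proof (cases "m = m'")
    case False
    then show ?thesis unfolding I by simp
  next
    case True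
    have "sphere_inner (spinY s l m) (spinY s l' m') =
       integral {0..pi} (\<lambda>\<theta>. of_real (2 * pi * c * (wig p q k \<theta> * wig p' q' k' \<theta> * sin \<theta>)))"
      unfolding I using True by (simp add: mult_ac)
    also have "\<dots> = of_real (integral {0..pi} (\<lambda>\<theta>. 2 * pi * c * (wig p q k \<theta> * wig p' q' k' \<theta> * sin \<theta>)))"
      by (intro integral_unique has_integral_of_real integrable_integral integrable_continuous_interval continuous_intros)
    also have "\<dots> = of_real (2 * pi * c * wig_inner p q k p' q' k')"
      unfolding wig_inner_def by simp
    finally have J: "sphere_inner (spinY s l m) (spinY s l' m') = of_real (2 * pi * c * wig_inner p q k p' q' k')" .
    show ?thesis
    proof (cases "l = l'")
      case False
      have "wig_inner p q k p' q' k' = 0"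
      proof (rule wig_inner_orthogonal)
        have "int p = int l + s" "int q = int l - s" "int k = int l - m" "int p' = int l' + s" "int q' = int l' - s" "int k' = int l' - m'"
          using lm lm' unfolding pq by linarith+
        then show "p + q \<noteq> p' + q'" "p + q' = p' + q" "p + q + 2 * k' = p' + q' + 2 * k"
          using True False by linarith+
      qed
      then show ?thesis unfolding J using False by simp
    next
      case eq: True
      have s1: "p + q = 2 * l" "2 * l - k = nat (int l + m)" "k \<le> 2 * l" using lm by (auto simp: pq)
      have W: "wig_inner p q k p q k = 2 / (2 * real l + 1) * (fact p * fact q / (fact k * fact (nat (int l + m))))"
        using wig_inner_norm[of k p q] s1 by simp
      have C: "c = (2 * real l + 1) / (4 * pi) * (fact k * fact (nat (int l + m))) / (fact q * fact p)"
        unfolding c_def eq[symmetric] True[symmetric] power2_eq_square[symmetric] spin_amp(1)[OF lm] pq by simp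
      have "2 * pi * c * wig_inner p q k p q k = 1"
      proof -
        have "2 * pi * (N / (4 * pi) * K / (Q * P)) * (2 / N * (P * Q / K)) = 1"
          if "N > 0" "K > 0" "P > 0" "Q > 0" for N K P Q :: real
          using that by (simp add: field_simps)
        then show ?thesis unfolding W C by simp
      qed
      moreover have "p' = p" "q' = q" "k' = k" using eq True by (auto simp: pq)
      ultimately show ?thesis unfolding J using eq True by simp
    qed
  qed
qed

section \<open>The space of square integrable functions\<close>

lemma L2_sphereD:
  assumes "f \<in> L2_sphere"
  shows "f \<in> borel_measurable sphere_measure" "integrable sphere_measure (\<lambda>p. (cmod (f p))\<^sup>2)"
  using assms by (auto simp: L2_sphere_def)

lemma borel_measurable_cnj [measurable]:
  "f \<in> borel_measurable M \<Longrightarrow> (\<lambda>x. cnj (f x)) \<in> borel_measurable M"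
  by (rule borel_measurable_continuous_on[where f = cnj]) (intro continuous_intros)

lemma L2_inner_integrable:
  assumes "f \<in> L2_sphere" "g \<in> L2_sphere"
  shows "integrable sphere_measure (\<lambda>p. cnj (f p) * g p)"
proof (rule Bochner_Integration.integrable_bound)
  show "integrable sphere_measure (\<lambda>p. (cmod (f p))\<^sup>2 + (cmod (g p))\<^sup>2)"
    using assms by (intro Bochner_Integration.integrable_add L2_sphereD)
  show "(\<lambda>p. cnj (f p) * g p) \<in> borel_measurable sphere_measure"
    using assms L2_sphereD(1) by (intro borel_measurable_times borel_measurable_cnj) auto
  have "cmod x * cmod y \<le> (cmod x)\<^sup>2 + (cmod y)\<^sup>2" for x y
    using sum_squares_bound[of "cmod x" "cmod y"] mult_nonneg_nonneg[of "cmod x" "cmod y"] norm_ge_zero[of x] norm_ge_zero[of y] by linarith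
  then show "AE p in sphere_measure. norm (cnj (f p) * g p) \<le> norm ((cmod (f p))\<^sup>2 + (cmod (g p))\<^sup>2)"
    by (simp add: norm_mult)
qed

lemma L2_sphere_add:
  assumes "f \<in> L2_sphere" "g \<in> L2_sphere"
  shows "(\<lambda>p. f p + g p) \<in> L2_sphere"
  unfolding L2_sphere_def
proof (intro CollectI conjI)
  show meas: "(\<lambda>p. f p + g p) \<in> borel_measurable sphere_measure"
    using assms L2_sphereD(1) by auto
  show "integrable sphere_measure (\<lambda>p. (cmod (f p + g p))\<^sup>2)"
  proof (rule Bochner_Integration.integrable_bound)
    show "integrable sphere_measure (\<lambda>p. 2 * (cmod (f p))\<^sup>2 + 2 * (cmod (g p))\<^sup>2)"
      using assms by (intro Bochner_Integration.integrable_add integrable_mult_right L2_sphereD) auto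
    have "(cmod (a + b))\<^sup>2 \<le> 2 * (cmod a)\<^sup>2 + 2 * (cmod b)\<^sup>2" for a b
      using power_mono[OF norm_triangle_ineq[of a b], of 2] sum_squares_bound[of "cmod a" "cmod b"]
      by (simp add: power2_sum)
    then show "AE p in sphere_measure. norm ((cmod (f p + g p))\<^sup>2) \<le> norm (2 * (cmod (f p))\<^sup>2 + 2 * (cmod (g p))\<^sup>2)"
      by simp
  qed (use meas in measurable)
qed

lemma L2_sphere_cmult:
  assumes "f \<in> L2_sphere"
  shows "(\<lambda>p. c * f p) \<in> L2_sphere"
  using L2_sphereD[OF assms] by (auto simp: L2_sphere_def norm_mult power_mult_distrib)

lemma L2_sphere_zero: "(\<lambda>_. 0) \<in> L2_sphere"
  by (simp add: L2_sphere_def)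

lemma L2_sphere_diff:
  assumes "f \<in> L2_sphere" "g \<in> L2_sphere"
  shows "(\<lambda>p. f p - g p) \<in> L2_sphere"
  using L2_sphere_add[OF assms(1) L2_sphere_cmult[OF assms(2), of "-1"]] by simp

lemma L2_sphere_sum:
  "(\<And>i. i \<in> I \<Longrightarrow> f i \<in> L2_sphere) \<Longrightarrow> (\<lambda>p. \<Sum>i\<in>I. f i p) \<in> L2_sphere"
  by (induction I rule: infinite_finite_induct) (auto intro: L2_sphere_add L2_sphere_zero)

lemma L2_sphere_AE_cong:
  assumes "f \<in> L2_sphere" "AE p in sphere_measure. f p = g p"
  shows "g \<in> L2_sphere"
proof -
  have g: "g \<in> borel_measurable sphere_measure"
    by (rule borel_measurable_sphere_AE[OF L2_sphereD(1)[OF assms(1)] assms(2)])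
  have "integrable sphere_measure (\<lambda>p. (cmod (g p))\<^sup>2)"
    by (rule integrable_cong_AE_imp[OF L2_sphereD(2)[OF assms(1)]])
      (use g assms(2) in \<open>auto elim: eventually_mono\<close>)
  with g show ?thesis by (simp add: L2_sphere_def)
qed

lemma L2_sphere_continuous:
  assumes "continuous_on UNIV f"
  shows "f \<in> L2_sphere"
  unfolding L2_sphere_def
  using sphere_integral_continuous(1)[OF continuous_on_power[OF continuous_on_norm[OF assms], of 2]]
    borel_measurable_continuous_onI[OF assms]
  by (auto intro: measurable_sphere_measure)

lemma L2_spinY: "spinY s l m \<in> L2_sphere"
  by (rule L2_sphere_continuous[OF continuous_on_spinY])

lemma sphere_inner_AE_cong:
  assumes "AE p in sphere_measure. f p = f' p" "AE p in sphere_measure. g p = g' p"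
    "f \<in> borel_measurable sphere_measure" "g \<in> borel_measurable sphere_measure"
  shows "sphere_inner f g = sphere_inner f' g'"
proof -
  have [measurable]: "f \<in> borel_measurable sphere_measure" "g \<in> borel_measurable sphere_measure"
    "f' \<in> borel_measurable sphere_measure" "g' \<in> borel_measurable sphere_measure"
    using assms borel_measurable_sphere_AE by blast+
  have eq: "AE p in sphere_measure. cnj (f p) * g p = cnj (f' p) * g' p"
    using assms(1,2) by eventually_elim simp
  show ?thesis unfolding sphere_inner_def by (rule integral_cong_AE[OF _ _ eq]; measurable)
qed

lemma spin_coeff_eq:
  assumes "\<bar>m\<bar> \<le> int l" "\<bar>s\<bar> \<le> int l" "f \<in> L2_sphere"
  shows "spin_coeff s f l m = sphere_inner (spinY s l m) f"
proof -
  have 1: "AE p in sphere_measure. spinY s l m p = spin_sph_harm s l m p"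
    using spin_sph_harm_AE[OF assms(1,2)] by eventually_elim simp
  show ?thesis unfolding spin_coeff_def
    by (rule sphere_inner_AE_cong[OF 1, symmetric]) (use L2_sphereD(1)[OF assms(3)] L2_sphereD(1)[OF L2_spinY] in auto)
qed

lemma sphere_inner_add_right:
  "f \<in> L2_sphere \<Longrightarrow> g \<in> L2_sphere \<Longrightarrow> h \<in> L2_sphere \<Longrightarrow>
    sphere_inner h (\<lambda>p. f p + g p) = sphere_inner h f + sphere_inner h g"
  unfolding sphere_inner_def by (simp add: distrib_left L2_inner_integrable)

lemma sphere_inner_diff_right:
  "f \<in> L2_sphere \<Longrightarrow> g \<in> L2_sphere \<Longrightarrow> h \<in> L2_sphere \<Longrightarrow>
    sphere_inner h (\<lambda>p. f p - g p) = sphere_inner h f - sphere_inner h g"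
  unfolding sphere_inner_def by (simp add: right_diff_distrib L2_inner_integrable)

lemma sphere_inner_cmult_right: "sphere_inner h (\<lambda>p. c * f p) = c * sphere_inner h f"
proof -
  have "sphere_inner h (\<lambda>p. c * f p) = (LINT p|sphere_measure. c * (cnj (h p) * f p))"
    unfolding sphere_inner_def by (simp add: mult_ac)
  then show ?thesis unfolding sphere_inner_def by simp
qed

lemma sphere_inner_commute: "sphere_inner g f = cnj (sphere_inner f g)"
proof -
  have "(\<lambda>p. cnj (g p) * f p) = (\<lambda>p. cnj (cnj (f p) * g p))"
    by (simp add: mult.commute)
  then show ?thesis
    unfolding sphere_inner_def
    by (simp only: Bochner_Integration.integral_cnj)
qed

lemma sphere_inner_sum_right:
  assumes "h \<in> L2_sphere" "\<And>i. i \<in> I \<Longrightarrow> f i \<in> L2_sphere"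
  shows "sphere_inner h (\<lambda>p. \<Sum>i\<in>I. f i p) = (\<Sum>i\<in>I. sphere_inner h (f i))"
  unfolding sphere_inner_def sum_distrib_left
  by (rule Bochner_Integration.integral_sum) (use assms L2_inner_integrable in auto)

definition sphere_norm2 :: "(real \<times> real \<Rightarrow> complex) \<Rightarrow> real" where
  "sphere_norm2 f = (LINT p|sphere_measure. (cmod (f p))\<^sup>2)"

lemma sphere_norm2_nonneg: "sphere_norm2 f \<ge> 0"
  unfolding sphere_norm2_def by simp

lemma sphere_inner_self: "sphere_inner f f = of_real (sphere_norm2 f)"
proof -
  have "sphere_inner f f = (LINT p|sphere_measure. of_real ((cmod (f p))\<^sup>2))"
    unfolding sphere_inner_def complex_norm_square by (simp add: mult.commute)
  then show ?thesis unfolding sphere_norm2_def by (simp only: integral_complex_of_real)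
qed

text \<open>The pointwise inequality between the arithmetic and the geometric mean, weighted by a
  free parameter t over which \<open>sphere_Cauchy_Schwarz\<close> optimizes.\<close>

lemma sphere_inner_bound:
  assumes "f \<in> L2_sphere" "g \<in> L2_sphere" "t > 0"
  shows "2 * cmod (sphere_inner f g) \<le> t * sphere_norm2 f + sphere_norm2 g / t"
proof -
  have "cmod (sphere_inner f g) \<le> (LINT p|sphere_measure. cmod (cnj (f p) * g p))"
    unfolding sphere_inner_def by (rule integral_norm_bound)
  also have "\<dots> \<le> (LINT p|sphere_measure. (t / 2) * (cmod (f p))\<^sup>2 + (1 / (2 * t)) * (cmod (g p))\<^sup>2)"
  proof (rule integral_mono)
    fix p
    have "0 \<le> (t * cmod (f p) - cmod (g p))\<^sup>2 / (2 * t)" using assms by simp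
    also have "\<dots> = (t / 2) * (cmod (f p))\<^sup>2 + (1 / (2 * t)) * (cmod (g p))\<^sup>2 - cmod (f p) * cmod (g p)"
      using assms(3) by (simp add: field_simps power2_eq_square)
    finally show "cmod (cnj (f p) * g p) \<le> (t / 2) * (cmod (f p))\<^sup>2 + (1 / (2 * t)) * (cmod (g p))\<^sup>2"
      by (simp add: norm_mult)
  qed (use assms L2_inner_integrable L2_sphereD(2) in auto)
  also have "\<dots> = (t / 2) * sphere_norm2 f + (1 / (2 * t)) * sphere_norm2 g"
    unfolding sphere_norm2_def using assms L2_sphereD(2) by (subst Bochner_Integration.integral_add) auto
  finally show ?thesis by (simp add: field_simps)
qed

lemma sphere_Cauchy_Schwarz:
  assumes "f \<in> L2_sphere" "g \<in> L2_sphere"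
  shows "cmod (sphere_inner f g) \<le> sqrt (sphere_norm2 f) * sqrt (sphere_norm2 g)"
proof -
  define a b where "a = sphere_norm2 f" and "b = sphere_norm2 g"
  have ab: "a \<ge> 0" "b \<ge> 0" unfolding a_def b_def by (rule sphere_norm2_nonneg)+
  define z where "z = cmod (sphere_inner f g)"
  have z: "2 * z \<le> t * a + b / t" if "t > 0" for t
    using sphere_inner_bound[OF assms that] by (simp add: a_def b_def z_def)
  consider "a > 0" "b > 0" | "a = 0" | "b = 0" using ab by linarith
  then have "z \<le> sqrt a * sqrt b"
  proof cases
    case 1
    then have "sqrt b / sqrt a * a = sqrt a * sqrt b" "b / (sqrt b / sqrt a) = sqrt a * sqrt b"
      using real_div_sqrt[of a] real_div_sqrt[of b] by (simp_all add: divide_simps)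
    then show ?thesis using z[of "sqrt b / sqrt a"] 1 by simp
  next
    case 2
    show ?thesis
    proof (rule ccontr)
      assume "\<not> ?thesis"
      then have pos: "z > 0" using 2 by simp
      have "b / ((b + 1) / z) \<le> z" using pos ab by (simp add: field_simps)
      then show False using z[of "(b + 1) / z"] 2 ab pos by (simp add: add_nonneg_pos)
    qed
  next
    case 3
    show ?thesis
    proof (rule ccontr)
      assume "\<not> ?thesis"
      then have pos: "z > 0" using 3 by simp
      have "z / (a + 1) * a \<le> z" using pos ab by (simp add: field_simps)
      then show False using z[of "z / (a + 1)"] 3 ab pos by (simp add: add_nonneg_pos)
    qed
  qed
  then show ?thesis by (simp add: z_def a_def b_def)
qed

section \<open>Euler angles and the action of rotations\<close>

lemma vec3_eq_iff: "x = y \<longleftrightarrow> x $ 1 = y $ 1 \<and> x $ 2 = y $ 2 \<and> x $ 3 = y $ 3" for x y :: "'a ^ 3"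
  by (simp add: vec_eq_iff forall_3)

lemma norm_vec3_1_iff: "norm x = 1 \<longleftrightarrow> (x $ 1)\<^sup>2 + (x $ 2)\<^sup>2 + (x $ 3)\<^sup>2 = 1" for x :: "real ^ 3"
proof -
  have "norm x = 1 \<longleftrightarrow> (norm x)\<^sup>2 = 1"
    using norm_ge_zero[of x] by (simp only: power2_eq_1_iff) linarith
  moreover have "(norm x)\<^sup>2 = (x $ 1)\<^sup>2 + (x $ 2)\<^sup>2 + (x $ 3)\<^sup>2"
    unfolding power2_norm_eq_inner by (simp add: inner_vec_def sum_3 power2_eq_square)
  ultimately show ?thesis by simp
qed

lemma sphere_point_nth [simp]:
  "sphere_point p $ 1 = sin (fst p) * cos (snd p)"
  "sphere_point p $ 2 = sin (fst p) * sin (snd p)"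
  "sphere_point p $ 3 = cos (fst p)"
  by (simp_all add: sphere_point_def case_prod_beta')

lemma norm_sphere_point [simp]: "norm (sphere_point p) = 1"
proof -
  have "(sin (fst p) * cos (snd p))\<^sup>2 + (sin (fst p) * sin (snd p))\<^sup>2 + (cos (fst p))\<^sup>2 =
    (sin (fst p))\<^sup>2 * ((sin (snd p))\<^sup>2 + (cos (snd p))\<^sup>2) + (cos (fst p))\<^sup>2"
    by (simp only: power_mult_distrib) algebra
  then show ?thesis by (simp add: norm_vec3_1_iff)
qed

text \<open>As \<open>Arg2pi 0 = 0\<close>, this explicit formula makes the same choice phi = 0 at
  the poles as \<open>coords_of_point\<close>.\<close>

definition polar_coords :: "real ^ 3 \<Rightarrow> real \<times> real" where
  "polar_coords x = (arccos (x $ 3), Arg2pi (Complex (x $ 1) (x $ 2)))"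

lemma polar_coords_sphere_point:
  assumes p: "p \<in> sphere_coords" "sin (fst p) = 0 \<longrightarrow> snd p = 0"
  shows "polar_coords (sphere_point p) = p"
proof -
  obtain \<theta> \<phi> where [simp]: "p = (\<theta>, \<phi>)" by (cases p)
  have range: "0 \<le> \<theta>" "\<theta> \<le> pi" "0 \<le> \<phi>" "\<phi> < 2 * pi" using p by (auto simp: sphere_coords_def)
  have "Arg2pi (Complex (sin \<theta> * cos \<phi>) (sin \<theta> * sin \<phi>)) = \<phi>"
  proof (cases "sin \<theta> = 0")
    case True
    then show ?thesis using p by (simp flip: zero_complex.code)
  next
    case False
    then have "sin \<theta> > 0" using sin_ge_zero[OF range(1,2)] by simp
    moreover have "of_real (sin \<theta>) * exp (\<i> * of_real \<phi>) = Complex (sin \<theta> * cos \<phi>) (sin \<theta> * sin \<phi>)"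
      by (simp add: complex_eq_iff flip: cis_conv_exp)
    ultimately show ?thesis using range by (intro Arg2pi_unique) auto
  qed
  then show ?thesis using range by (simp add: polar_coords_def arccos_cos)
qed

lemma polar_coords:
  assumes "norm x = 1"
  shows "polar_coords x \<in> sphere_coords"
    and "sin (fst (polar_coords x)) = 0 \<longrightarrow> snd (polar_coords x) = 0"
    and "sphere_point (polar_coords x) = x"
proof -
  define z where "z = Complex (x $ 1) (x $ 2)"
  have sq: "(x $ 1)\<^sup>2 + (x $ 2)\<^sup>2 + (x $ 3)\<^sup>2 = 1" using assms by (simp add: norm_vec3_1_iff)
  then have x3: "\<bar>x $ 3\<bar> \<le> 1" by (simp add: abs_square_le_1[symmetric]) (smt (verit) zero_le_power2)
  then have c: "cos (arccos (x $ 3)) = x $ 3" by (simp add: cos_arccos_abs)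
  have "(x $ 3)\<^sup>2 \<le> 1" using x3 by (simp add: abs_square_le_1)
  have "sin (arccos (x $ 3)) = sqrt (1 - (x $ 3)\<^sup>2)" using x3 by (simp add: sin_arccos_abs)
  also have "1 - (x $ 3)\<^sup>2 = (x $ 1)\<^sup>2 + (x $ 2)\<^sup>2" using sq by simp
  finally have s: "sin (arccos (x $ 3)) = cmod z" by (simp add: z_def cmod_def)
  have z: "z = of_real (cmod z) * cis (Arg2pi z)"
    using Arg2pi[of z] by (simp add: cis_conv_exp is_Arg_def)
  have "x $ 1 = cmod z * cos (Arg2pi z)" "x $ 2 = cmod z * sin (Arg2pi z)"
    using arg_cong[OF z, of Re] arg_cong[OF z, of Im] by (simp_all add: z_def)
  moreover have "polar_coords x = (arccos (x $ 3), Arg2pi z)" by (simp add: polar_coords_def z_def)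
  ultimately show "sphere_point (polar_coords x) = x"
    by (simp only: vec3_eq_iff sphere_point_nth fst_conv snd_conv s c)
  show "polar_coords x \<in> sphere_coords"
    using x3 Arg2pi[of z] arccos_lbound[of "x $ 3"] arccos_ubound[of "x $ 3"]
    by (auto simp: sphere_coords_def polar_coords_def z_def abs_le_iff)
  show "sin (fst (polar_coords x)) = 0 \<longrightarrow> snd (polar_coords x) = 0"
    by (simp add: polar_coords_def s flip: z_def)
qed

lemma coords_of_point_eq:
  assumes "norm x = 1"
  shows "coords_of_point x = polar_coords x"
  unfolding coords_of_point_def
proof (rule the_equality)
  show "case polar_coords x of (\<theta>, \<phi>) \<Rightarrow> (\<theta>, \<phi>) \<in> sphere_coords \<and> (sin \<theta> = 0 \<longrightarrow> \<phi> = 0) \<and> sphere_point (\<theta>, \<phi>) = x"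
    using polar_coords[OF assms] by (simp add: case_prod_beta')
  show "p = polar_coords x" if "case p of (\<theta>, \<phi>) \<Rightarrow> (\<theta>, \<phi>) \<in> sphere_coords \<and> (sin \<theta> = 0 \<longrightarrow> \<phi> = 0) \<and> sphere_point (\<theta>, \<phi>) = x" for p
    using that polar_coords_sphere_point[of p] by auto
qed

lemma matrix3_eq_iff: "A = B \<longleftrightarrow> (A $ 1 $ 1 = B $ 1 $ 1 \<and> A $ 1 $ 2 = B $ 1 $ 2 \<and> A $ 1 $ 3 = B $ 1 $ 3) \<and>
    (A $ 2 $ 1 = B $ 2 $ 1 \<and> A $ 2 $ 2 = B $ 2 $ 2 \<and> A $ 2 $ 3 = B $ 2 $ 3) \<and>
    (A $ 3 $ 1 = B $ 3 $ 1 \<and> A $ 3 $ 2 = B $ 3 $ 2 \<and> A $ 3 $ 3 = B $ 3 $ 3)" for A B :: "real ^ 3 ^ 3"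
  by (simp add: vec3_eq_iff)

lemma rot_y_nth [simp]:
  "rot_y t $ 1 $ 1 = cos t" "rot_y t $ 1 $ 2 = 0" "rot_y t $ 1 $ 3 = sin t"
  "rot_y t $ 2 $ 1 = 0" "rot_y t $ 2 $ 2 = 1" "rot_y t $ 2 $ 3 = 0"
  "rot_y t $ 3 $ 1 = - sin t" "rot_y t $ 3 $ 2 = 0" "rot_y t $ 3 $ 3 = cos t"
  by (simp_all add: rot_y_def)

lemma rot_z_nth [simp]:
  "rot_z t $ 1 $ 1 = cos t" "rot_z t $ 1 $ 2 = - sin t" "rot_z t $ 1 $ 3 = 0"
  "rot_z t $ 2 $ 1 = sin t" "rot_z t $ 2 $ 2 = cos t" "rot_z t $ 2 $ 3 = 0"
  "rot_z t $ 3 $ 1 = 0" "rot_z t $ 3 $ 2 = 0" "rot_z t $ 3 $ 3 = 1"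
  by (simp_all add: rot_z_def)

lemma matrix_mult3_nth: "(A ** B) $ i $ j = A $ i $ 1 * B $ 1 $ j + A $ i $ 2 * B $ 2 $ j + A $ i $ 3 * B $ 3 $ j"
  for A B :: "real ^ 3 ^ 3"
  by (simp add: matrix_matrix_mult_def sum_3)

lemma matrix_vector_mult3_nth: "(A *v x) $ i = A $ i $ 1 * x $ 1 + A $ i $ 2 * x $ 2 + A $ i $ 3 * x $ 3"
  for A :: "real ^ 3 ^ 3"
  by (simp add: matrix_vector_mult_def sum_3)

lemma SO3_iff: "R \<in> SO3 \<longleftrightarrow> transpose R ** R = mat 1 \<and> R ** transpose R = mat 1 \<and> det R = 1"
  by (simp add: SO3_def rotation_matrix_def orthogonal_matrix_def)

lemma rot_y_SO3: "rot_y t \<in> SO3"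
  unfolding SO3_iff
  by (simp add: matrix3_eq_iff matrix_mult3_nth transpose_def mat_def det_3 flip: power2_eq_square)

lemma rot_z_SO3: "rot_z t \<in> SO3"
  unfolding SO3_iff
  by (simp add: matrix3_eq_iff matrix_mult3_nth transpose_def mat_def det_3 flip: power2_eq_square)

lemma SO3_mult: "A \<in> SO3 \<Longrightarrow> B \<in> SO3 \<Longrightarrow> A ** B \<in> SO3"
  unfolding SO3_def rotation_matrix_def by (simp add: orthogonal_matrix_mul det_mul)

lemma SO3_transpose: "A \<in> SO3 \<Longrightarrow> transpose A \<in> SO3"
  unfolding SO3_def rotation_matrix_def by (simp add: orthogonal_matrix_transpose)

lemma SO3_matrix_inv:
  assumes "A \<in> SO3"
  shows "matrix_inv A = transpose A"
proof -
  have A: "transpose A ** A = mat 1" "A ** transpose A = mat 1"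
    using assms by (auto simp: SO3_iff)
  then have "A ** matrix_inv A = mat 1 \<and> matrix_inv A ** A = mat 1"
    unfolding matrix_inv_def by (rule someI[where x = "transpose A", OF conjI, rotated])
  then have inv: "A ** matrix_inv A = mat 1" ..
  have "matrix_inv A = (transpose A ** A) ** matrix_inv A" by (simp add: A)
  also have "\<dots> = transpose A" by (simp only: inv matrix_mul_rid flip: matrix_mul_assoc)
  finally show ?thesis .
qed

lemma SO3_norm: "A \<in> SO3 \<Longrightarrow> norm (A *v x) = norm x"
  using orthogonal_transformation_norm[of "(*v) A" x]
  by (simp add: SO3_def rotation_matrix_def orthogonal_transformation_matrix)

section \<open>Frames, Euler angles and the spin phase\<close>

text \<open>The rotation over the point p whose third Euler angle is 0. A spin weighted function is
  a function on the rotation group, evaluated at these rotations only.\<close>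

definition frame :: "real \<times> real \<Rightarrow> real ^ 3 ^ 3" where
  "frame p = rot_z (snd p) ** rot_y (fst p)"

abbreviation north :: "real ^ 3" where
  "north \<equiv> axis 3 1"

lemma frame_SO3: "frame p \<in> SO3"
  unfolding frame_def by (intro SO3_mult rot_y_SO3 rot_z_SO3)

lemma rot_z_0: "rot_z 0 = mat 1"
  by (simp add: matrix3_eq_iff mat_def)

lemma euler_rot_eq: "euler_rot (\<alpha>, \<beta>, \<gamma>) = frame (\<beta>, \<alpha>) ** rot_z \<gamma>"
  by (simp add: euler_rot_def frame_def)

lemma mult_north_nth: "(A *v north) $ i = A $ i $ 3" for A :: "real ^ 3 ^ 3"
  by (simp add: matrix_vector_mult3_nth axis_def)

lemma frame_north: "frame p *v north = sphere_point p"
  by (simp add: vec3_eq_iff mult_north_nth frame_def matrix_mult3_nth mult.commute)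

lemma frame_rot_z_north: "(frame p ** rot_z \<gamma>) *v north = sphere_point p"
proof -
  have "rot_z \<gamma> *v north = north"
    by (simp add: vec3_eq_iff mult_north_nth) (simp add: axis_def)
  then show ?thesis by (simp add: frame_north flip: matrix_vector_mul_assoc)
qed

text \<open>Orthogonality reduces N to a 2 by 2 block with orthonormal columns, and det = 1 excludes
  the reflections.\<close>

lemma SO3_fixing_north:
  assumes N: "N \<in> SO3" "N *v north = north"
  obtains \<gamma> where "\<gamma> \<in> {0..<2 * pi}" "N = rot_z \<gamma>"
proof -
  define z where "z = Complex (N $ 1 $ 1) (N $ 2 $ 1)"
  have c3: "N $ 1 $ 3 = 0" "N $ 2 $ 3 = 0" "N $ 3 $ 3 = 1"
    using N(2) mult_north_nth[of N] by (auto simp: vec3_eq_iff axis_def)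
  have T: "transpose N ** N = mat 1" and U: "N ** transpose N = mat 1" and d: "det N = 1"
    using N(1) by (auto simp: SO3_iff)
  have "N $ 3 $ 1 * N $ 3 $ 1 + N $ 3 $ 2 * N $ 3 $ 2 + 1 = 1"
    using U c3 by (simp add: matrix3_eq_iff matrix_mult3_nth transpose_def mat_def)
  then have r3: "N $ 3 $ 1 = 0" "N $ 3 $ 2 = 0"
    by (simp_all add: sum_squares_eq_zero_iff)
  have T': "N $ 1 $ 1 * N $ 1 $ 1 + N $ 2 $ 1 * N $ 2 $ 1 = 1"
     "N $ 1 $ 1 * N $ 1 $ 2 + N $ 2 $ 1 * N $ 2 $ 2 = 0"
     "N $ 1 $ 1 * N $ 2 $ 2 - N $ 1 $ 2 * N $ 2 $ 1 = 1"
    using T d c3 r3 by (simp_all add: matrix3_eq_iff matrix_mult3_nth transpose_def mat_def det_3)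
  have e: "N $ 2 $ 2 = N $ 1 $ 1" "N $ 1 $ 2 = - N $ 2 $ 1"
    using T' by algebra+
  have "cmod z = 1" using T'(1) by (simp add: z_def cmod_def power2_eq_square)
  then have "z = cis (Arg2pi z)"
    using Arg2pi[of z] by (simp add: cis_conv_exp is_Arg_def)
  then have "N $ 1 $ 1 = cos (Arg2pi z)" "N $ 2 $ 1 = sin (Arg2pi z)"
    by (metis z_def cis.sel(1) complex.sel(1)) (metis \<open>z = cis (Arg2pi z)\<close> z_def cis.sel(2) complex.sel(2))
  then have "N = rot_z (Arg2pi z)"
    using c3 r3 e by (simp add: matrix3_eq_iff)
  then show ?thesis using that[of "Arg2pi z"] Arg2pi[of z] by auto
qed

text \<open>M and the frame over the image of the north pole agree on the north pole, so they differ
  by an element of its stabilizer.\<close>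

lemma SO3_euler:
  assumes M: "M \<in> SO3"
  obtains \<gamma> where "\<gamma> \<in> {0..<2 * pi}" "M = frame (polar_coords (M *v north)) ** rot_z \<gamma>"
proof -
  define F where "F = frame (polar_coords (M *v north))"
  have F: "F \<in> SO3" by (simp add: F_def frame_SO3)
  have "norm (M *v north) = 1" using SO3_norm[OF M] by simp
  then have n: "F *v north = M *v north"
    by (simp add: F_def frame_north polar_coords)
  have inv: "transpose F ** F = mat 1" "F ** transpose F = mat 1" using F by (auto simp: SO3_iff)
  have "(transpose F ** M) *v north = transpose F *v (F *v north)"
    by (simp add: n matrix_vector_mul_assoc)
  also have "\<dots> = north"
    by (simp add: matrix_vector_mul_assoc inv)
  finally obtain \<gamma> where g: "\<gamma> \<in> {0..<2 * pi}" "transpose F ** M = rot_z \<gamma>"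
    using SO3_fixing_north[OF SO3_mult[OF SO3_transpose[OF F] M]] by blast
  then have "F ** rot_z \<gamma> = M"
    by (metis inv(2) matrix_mul_assoc matrix_mul_lid)
  then show ?thesis using that[of \<gamma>] g by (simp add: F_def)
qed

lemma rot_z_inj:
  assumes "rot_z \<gamma> = rot_z \<delta>" "\<gamma> \<in> {0..<2 * pi}" "\<delta> \<in> {0..<2 * pi}"
  shows "\<gamma> = \<delta>"
proof -
  have "cos \<gamma> = cos \<delta>" "sin \<gamma> = sin \<delta>" using assms(1) by (auto simp: matrix3_eq_iff)
  then have "exp (\<i> * of_real \<gamma>) = exp (\<i> * of_real \<delta>)"
    by (simp add: complex_eq_iff flip: cis_conv_exp)
  moreover have "Arg2pi (exp (\<i> * of_real x)) = x" if "x \<in> {0..<2 * pi}" for x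
    using that by (intro Arg2pi_unique[of 1]) auto
  ultimately show ?thesis using assms by metis
qed

text \<open>The conventions of \<open>euler_angles\<close> and \<open>polar_coords\<close> for the
  degenerate case coincide. So the image of the north pole determines the first two angles, and the
  remaining rotation about the z-axis the third.\<close>

lemma euler_angles_eq:
  assumes M: "M \<in> SO3" and g: "\<gamma> \<in> {0..<2 * pi}" "M = frame (polar_coords (M *v north)) ** rot_z \<gamma>"
  shows "euler_angles M = (snd (polar_coords (M *v north)), fst (polar_coords (M *v north)), \<gamma>)"
proof -
  define p where "p = polar_coords (M *v north)"
  have "norm (M *v north) = 1" using SO3_norm[OF M] by simp
  note p = polar_coords[OF this, folded p_def]
  have Mp: "M = frame p ** rot_z \<gamma>" using g by (simp add: p_def)
  have "euler_angles M = (snd p, fst p, \<gamma>)"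
    unfolding euler_angles_def
  proof (rule the_equality)
    show "case (snd p, fst p, \<gamma>) of (\<alpha>, \<beta>, \<gamma>) \<Rightarrow> \<alpha> \<in> {0..<2 * pi} \<and> \<beta> \<in> {0..pi} \<and> \<gamma> \<in> {0..<2 * pi} \<and>
        (sin \<beta> = 0 \<longrightarrow> \<alpha> = 0) \<and> euler_rot (\<alpha>, \<beta>, \<gamma>) = M"
      using p g Mp by (auto simp: euler_rot_eq sphere_coords_def)
    fix q assume q: "case q of (\<alpha>, \<beta>, \<gamma>) \<Rightarrow> \<alpha> \<in> {0..<2 * pi} \<and> \<beta> \<in> {0..pi} \<and> \<gamma> \<in> {0..<2 * pi} \<and>
        (sin \<beta> = 0 \<longrightarrow> \<alpha> = 0) \<and> euler_rot (\<alpha>, \<beta>, \<gamma>) = M"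
    obtain \<alpha> \<beta> \<delta> where [simp]: "q = (\<alpha>, \<beta>, \<delta>)" by (cases q)
    have Mq: "M = frame (\<beta>, \<alpha>) ** rot_z \<delta>" and r: "(\<beta>, \<alpha>) \<in> sphere_coords" "\<delta> \<in> {0..<2 * pi}" "sin \<beta> = 0 \<longrightarrow> \<alpha> = 0"
      using q by (auto simp: euler_rot_eq sphere_coords_def)
    have "sphere_point (\<beta>, \<alpha>) = M *v north" unfolding Mq frame_rot_z_north ..
    then have pq: "p = (\<beta>, \<alpha>)" using polar_coords_sphere_point[of "(\<beta>, \<alpha>)"] r by (simp add: p_def)
    have "transpose (frame p) ** frame p = mat 1" using frame_SO3 by (simp add: SO3_iff)
    then have "rot_z \<gamma> = rot_z \<delta>"
      using Mp Mq pq by (metis matrix_mul_assoc matrix_mul_lid)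
    then have "\<gamma> = \<delta>" using rot_z_inj g r by blast
    then show "q = (snd p, fst p, \<gamma>)" using pq by simp
  qed
  then show ?thesis by (simp add: p_def)
qed

lemma third_euler_angle:
  assumes "M \<in> SO3"
  shows "M = frame (polar_coords (M *v north)) ** rot_z (third_euler_angle M)"
proof -
  obtain \<gamma> where "\<gamma> \<in> {0..<2 * pi}" "M = frame (polar_coords (M *v north)) ** rot_z \<gamma>"
    using SO3_euler[OF assms] .
  with euler_angles_eq[OF assms this] show ?thesis by (simp add: third_euler_angle_def)
qed

definition sphere_rot :: "real ^ 3 ^ 3 \<Rightarrow> real \<times> real \<Rightarrow> real \<times> real" where
  "sphere_rot R p = polar_coords (R *v sphere_point p)"

text \<open>This is the meaning of the phase \<kappa>: R carries the frame at p to the frame at the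
  rotated point only up to a turn about the z-axis, and the angle of this turn is the third Euler
  angle.\<close>

lemma frame_sphere_rot:
  assumes "R \<in> SO3"
  shows "R ** frame p = frame (sphere_rot R p) ** rot_z (third_euler_angle (R ** frame p))"
  using third_euler_angle[OF SO3_mult[OF assms frame_SO3], of p]
  by (simp add: sphere_rot_def frame_north flip: matrix_vector_mul_assoc)

lemma spin_rotate_eq:
  assumes "R \<in> SO3"
  shows "spin_rotate s R f p =
    exp (- \<i> * of_int s * of_real (third_euler_angle (transpose R ** frame p))) * f (sphere_rot (transpose R) p)"
  using SO3_norm[OF SO3_transpose[OF assms]]
  by (simp add: spin_rotate_def case_prod_beta' SO3_matrix_inv[OF assms] euler_rot_eq rot_z_0 sphere_rot_def coords_of_point_eq)

section \<open>Rotation invariance of the surface measure\<close>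

lemma real_polynomial_function_gradient:
  fixes p :: "real ^ 3 \<Rightarrow> real"
  assumes "real_polynomial_function p"
  shows "\<exists>D. (\<forall>x. (p has_derivative (\<lambda>h. D x \<bullet> h)) (at x)) \<and> continuous_on UNIV D"
  using assms
proof (induction rule: real_polynomial_function.induct)
    case (linear f)
    have lf: "linear f" using linear by (rule bounded_linear.linear)
    have "f = (\<lambda>h. adjoint f 1 \<bullet> h)"
      by (rule ext) (simp add: adjoint_works[OF lf] inner_commute)
    then have "\<forall>x. (f has_derivative (\<lambda>h. adjoint f 1 \<bullet> h)) (at x)"
      using bounded_linear_imp_has_derivative[OF linear] by metis
    then show ?case by (intro exI[of _ "\<lambda>_. adjoint f 1"]) simp
  next
    case (const c)
    show ?case by (intro exI[of _ "\<lambda>_. 0"]) simp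
  next
    case (add f g)
    then obtain D E where DE: "\<And>x. (f has_derivative (\<lambda>h. D x \<bullet> h)) (at x)" "continuous_on UNIV D"
      "\<And>x. (g has_derivative (\<lambda>h. E x \<bullet> h)) (at x)" "continuous_on UNIV E" by blast
    have "((\<lambda>x. f x + g x) has_derivative (\<lambda>h. (D x + E x) \<bullet> h)) (at x)" for x
      using has_derivative_add[OF DE(1,3), of x] by (simp add: inner_add_left)
    then show ?case using DE by (intro exI[of _ "\<lambda>x. D x + E x"]) (auto intro!: continuous_intros)
  next
    case (mult f g)
    then obtain D E where DE: "\<And>x. (f has_derivative (\<lambda>h. D x \<bullet> h)) (at x)" "continuous_on UNIV D"
      "\<And>x. (g has_derivative (\<lambda>h. E x \<bullet> h)) (at x)" "continuous_on UNIV E" by blast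
    have "((\<lambda>x. f x * g x) has_derivative (\<lambda>h. (f x *\<^sub>R E x + g x *\<^sub>R D x) \<bullet> h)) (at x)" for x
      using has_derivative_mult[OF DE(1,3), of x] by (simp add: inner_add_left mult.commute)
    moreover have "continuous_on UNIV f" "continuous_on UNIV g"
      using has_derivative_continuous[OF DE(1)] has_derivative_continuous[OF DE(3)]
      by (auto intro: continuous_at_imp_continuous_on)
    ultimately show ?case using DE by (intro exI[of _ "\<lambda>x. f x *\<^sub>R E x + g x *\<^sub>R D x"]) (auto intro!: continuous_intros)
qed

text \<open>U is transported by the field (a, b) / w, and (a, b) has divergence 0. The t-derivative
  of the integral is thus the integral of the divergence of (a U, b U). It vanishes because a is 0
  on the edges in x and the contributions of the edges in y agree, in the applications by
  periodicity in phi. No coordinate change of the sphere enters.\<close>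

lemma integral_divergence_free_flow:
  fixes U Ut Ux Uy :: "real \<Rightarrow> real \<Rightarrow> real \<Rightarrow> real" and w :: "real \<Rightarrow> real"
  assumes U: "\<And>t x y. ((\<lambda>t. U t x y) has_real_derivative Ut t x y) (at t)"
    and Ux: "\<And>t x y. ((\<lambda>x. U t x y) has_real_derivative Ux t x y) (at x)"
    and Uy: "\<And>t x y. ((\<lambda>y. U t x y) has_real_derivative Uy t x y) (at y)"
    and ax: "\<And>x y. ((\<lambda>x. a x y) has_real_derivative a' x y) (at x)"
    and bd_y: "\<And>x y. ((\<lambda>y. b x y) has_real_derivative - a' x y) (at y)"
    and flow: "\<And>t x y. w x * Ut t x y = a x y * Ux t x y + b x y * Uy t x y"
    and bd: "\<And>y. a x0 y = 0" "\<And>y. a x1 y = 0" "\<And>t x. b x y0 * U t x y0 = b x y1 * U t x y1"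
    and cont: "continuous_on UNIV (\<lambda>(t, x, y). U t x y)" "continuous_on UNIV (\<lambda>(t, x, y). Ut t x y)" "continuous_on UNIV w"
      "continuous_on UNIV (\<lambda>(t, x, y). Ux t x y)" "continuous_on UNIV (\<lambda>(t, x, y). Uy t x y)"
      "continuous_on UNIV (\<lambda>(x, y). a x y)" "continuous_on UNIV (\<lambda>(x, y). a' x y)" "continuous_on UNIV (\<lambda>(x, y). b x y)"
    and le: "x0 \<le> x1" "y0 \<le> y1"
  shows "integral (cbox (x0, y0) (x1, y1)) (\<lambda>(x, y). w x * U t x y) = integral (cbox (x0, y0) (x1, y1)) (\<lambda>(x, y). w x * U 0 x y)"
proof -
  have c1: "continuous_on T (\<lambda>z. U (f z) (g z) (h z))" "continuous_on T (\<lambda>z. Ut (f z) (g z) (h z))" 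
    "continuous_on T (\<lambda>z. Ux (f z) (g z) (h z))" "continuous_on T (\<lambda>z. Uy (f z) (g z) (h z))" 
    if "continuous_on T f" "continuous_on T g" "continuous_on T h" for T :: "'z :: t2_space set" and f g h
    using cont(1,2,4,5)[THEN continuous_on_compose2, OF continuous_on_Pair[OF that(1) continuous_on_Pair[OF that(2,3)]]]
    by auto
  have c2: "continuous_on T (\<lambda>z. a (g z) (h z))" "continuous_on T (\<lambda>z. a' (g z) (h z))" "continuous_on T (\<lambda>z. b (g z) (h z))"
    if "continuous_on T g" "continuous_on T h" for T :: "'z :: t2_space set" and g h
    using cont(6-8)[THEN continuous_on_compose2, OF continuous_on_Pair[OF that]]
    by auto
  have c3: "continuous_on T (\<lambda>z. w (g z))" if "continuous_on T g" for T :: "'z :: t2_space set" and g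
    using cont(3)[THEN continuous_on_compose2, of T g] that by auto
  note c = c1 c2 c3 continuous_intros
  \<comment> \<open>\<open>F\<close> and \<open>G\<close> are the x-derivative of a U and the
    y-derivative of b U. The terms with a' cancel in their sum, which is w Ut.\<close>
  define F where "F t x y = a' x y * U t x y + a x y * Ux t x y" for t x y
  define G where "G t x y = - a' x y * U t x y + b x y * Uy t x y" for t x y
  have F: "integral {x0..x1} (\<lambda>x. F t x y) = 0" for t y
  proof -
    have "((\<lambda>x. F t x y) has_integral a x1 y * U t x1 y - a x0 y * U t x0 y) {x0..x1}"
    proof (rule fundamental_theorem_of_calculus[OF le(1)])
      fix x
      have "((\<lambda>x. a x y * U t x y) has_real_derivative F t x y) (at x)"
        using DERIV_mult[OF ax Ux] by (simp add: F_def algebra_simps)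
      then show "((\<lambda>x. a x y * U t x y) has_vector_derivative F t x y) (at x within {x0..x1})"
        using has_field_derivative_at_within has_real_derivative_iff_has_vector_derivative by blast
    qed
    then show ?thesis using bd by (simp add: integral_unique)
  qed
  have G: "integral {y0..y1} (\<lambda>y. G t x y) = 0" for t x
  proof -
    have "((\<lambda>y. G t x y) has_integral b x y1 * U t x y1 - b x y0 * U t x y0) {y0..y1}"
    proof (rule fundamental_theorem_of_calculus[OF le(2)])
      fix y
      have "((\<lambda>y. b x y * U t x y) has_real_derivative G t x y) (at y)"
        using DERIV_mult[OF bd_y Uy] by (simp add: G_def algebra_simps)
      then show "((\<lambda>y. b x y * U t x y) has_vector_derivative G t x y) (at y within {y0..y1})"
        using has_field_derivative_at_within has_real_derivative_iff_has_vector_derivative by blast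
    qed
    then show ?thesis using bd(3)[of x t] by (simp add: integral_unique)
  qed
  have FG: "integral (cbox (x0, y0) (x1, y1)) (\<lambda>(x, y). w x * Ut t x y) = 0" for t
  proof -
    have contF: "continuous_on T (\<lambda>(x, y). F t x y)" and contG: "continuous_on T (\<lambda>(x, y). G t x y)" for T
      unfolding F_def G_def case_prod_beta' by (intro c)+
    have e: "(\<lambda>(x, y). w x * Ut t x y) = (\<lambda>z. (case z of (x, y) \<Rightarrow> F t x y) + (case z of (x, y) \<Rightarrow> G t x y))"
      by (auto simp: flow F_def G_def fun_eq_iff)
    have "integral (cbox (x0, y0) (x1, y1)) (\<lambda>(x, y). w x * Ut t x y) = integral (cbox (x0, y0) (x1, y1)) (\<lambda>(x, y). F t x y)
         + integral (cbox (x0, y0) (x1, y1)) (\<lambda>(x, y). G t x y)"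
      unfolding e by (intro Henstock_Kurzweil_Integration.integral_add integrable_continuous contF contG)
    also have "integral (cbox (x0, y0) (x1, y1)) (\<lambda>(x, y). F t x y) = integral {x0..x1} (\<lambda>x. integral {y0..y1} (\<lambda>y. F t x y))"
      using integral_prod_continuous[OF contF] by simp
    also have "\<dots> = integral {y0..y1} (\<lambda>y. integral {x0..x1} (\<lambda>x. F t x y))"
      using integral_swap_continuous[OF contF, of x0 x1 y0 y1] by simp
    also have "integral (cbox (x0, y0) (x1, y1)) (\<lambda>(x, y). G t x y) = integral {x0..x1} (\<lambda>x. integral {y0..y1} (\<lambda>y. G t x y))"
      using integral_prod_continuous[OF contG] by simp
    finally show ?thesis by (simp add: F G)
  qed
  have "((\<lambda>t. integral (cbox (x0, y0) (x1, y1)) (\<lambda>(x, y). w x * U t x y)) has_real_derivative 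
      integral (cbox (x0, y0) (x1, y1)) (\<lambda>(x, y). w x * Ut t x y)) (at t within UNIV)" for t
  proof (rule leibniz_rule_field_derivative)
    fix t :: real and z :: "real \<times> real"
    show "((\<lambda>t. case z of (x, y) \<Rightarrow> w x * U t x y) has_real_derivative (case z of (x, y) \<Rightarrow> w x * Ut t x y)) (at t within UNIV)"
      using DERIV_cmult[OF U] by (cases z) simp
    show "(\<lambda>(x, y). w x * U t x y) integrable_on cbox (x0, y0) (x1, y1)"
      unfolding case_prod_beta' by (intro integrable_continuous c)
    show "continuous_on (UNIV \<times> cbox (x0, y0) (x1, y1)) (\<lambda>(t, x, y). w x * Ut t x y)"
      unfolding case_prod_beta' by (intro c)
  qed auto
  then have "\<forall>t. ((\<lambda>t. integral (cbox (x0, y0) (x1, y1)) (\<lambda>(x, y). w x * U t x y)) has_real_derivative 0) (at t)"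
    unfolding FG by simp
  from DERIV_isconst_all[OF this] show ?thesis by blast
qed


lemma continuous_on_vec_nthI:
  fixes f :: "'z :: t2_space \<Rightarrow> real ^ 'n"
  assumes "\<And>i. continuous_on T (\<lambda>z. f z $ i)"
  shows "continuous_on T f"
  using continuous_on_vec_lambda[of T "\<lambda>i z. f z $ i", OF assms] by simp

lemma continuous_on_sphere_point [continuous_intros]:
  fixes f g :: "'z :: t2_space \<Rightarrow> real"
  assumes "continuous_on T f" "continuous_on T g"
  shows "continuous_on T (\<lambda>z. sphere_point (f z, g z))"
proof (rule continuous_on_vec_nthI)
  have "continuous_on T (\<lambda>z. sphere_point (f z, g z) $ 1)" "continuous_on T (\<lambda>z. sphere_point (f z, g z) $ 2)"
    "continuous_on T (\<lambda>z. sphere_point (f z, g z) $ 3)"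
    unfolding sphere_point_nth fst_conv snd_conv by (intro continuous_intros assms)+
  then show "continuous_on T (\<lambda>z. sphere_point (f z, g z) $ i)" for i
    using exhaust_3[of i] by metis
qed

lemma continuous_on_matrix_vector3 [continuous_intros]:
  fixes A :: "'z :: t2_space \<Rightarrow> real ^ 3 ^ 3"
  assumes "\<And>i j. continuous_on T (\<lambda>z. A z $ i $ j)" "continuous_on T x"
  shows "continuous_on T (\<lambda>z. A z *v x z)"
proof (rule continuous_on_vec_nthI)
  show "continuous_on T (\<lambda>z. (A z *v x z) $ i)" for i
    unfolding matrix_vector_mult3_nth by (intro continuous_intros assms)
qed

lemma has_vector_derivative_vec3:
  fixes f :: "real \<Rightarrow> real ^ 3"
  assumes "((\<lambda>t. f t $ 1) has_real_derivative d $ 1) (at t)" "((\<lambda>t. f t $ 2) has_real_derivative d $ 2) (at t)"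
    "((\<lambda>t. f t $ 3) has_real_derivative d $ 3) (at t)"
  shows "(f has_vector_derivative d) (at t)"
  unfolding has_vector_derivative_def has_derivative_componentwise_within[of f]
proof
  fix b :: "real ^ 3" assume "b \<in> Basis"
  then obtain i where b: "b = axis i 1" by (auto simp: Basis_vec_def)
  have "((\<lambda>t. f t $ i) has_derivative (\<lambda>x. x * d $ i)) (at t)"
  proof -
    have "(\<lambda>x. x * d $ i) = (*) (d $ i)" by (simp add: fun_eq_iff mult.commute)
    then show ?thesis using exhaust_3[of i] assms by (auto simp: has_field_derivative_def)
  qed
  then show "((\<lambda>x. f x \<bullet> b) has_derivative (\<lambda>x. (x *\<^sub>R d) \<bullet> b)) (at t)"
    by (simp add: b inner_axis)
qed

lemma gradient_chain:
  fixes p :: "real ^ 3 \<Rightarrow> real"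
  assumes "(p has_derivative (\<lambda>h. D (f t) \<bullet> h)) (at (f t))" "(f has_vector_derivative d) (at t)"
  shows "((\<lambda>t. p (f t)) has_real_derivative D (f t) \<bullet> d) (at t)"
proof -
  have "((\<lambda>t. p (f t)) has_derivative (\<lambda>x. D (f t) \<bullet> (x *\<^sub>R d))) (at t)"
    using assms(1) assms(2)[unfolded has_vector_derivative_def] has_derivative_compose by fastforce
  then show ?thesis by (simp add: has_field_derivative_def mult.commute[of _ "D (f t) \<bullet> d"])
qed

text \<open>
  The vector field \<open>(sin x cos y, - cos x sin y)\<close> is \<open>sin x\<close> times the infinitesimal rotation about the
  y-axis in spherical coordinates.
\<close>

lemma rot_y_invariant_polynomial:
  assumes p: "real_polynomial_function (p :: real ^ 3 \<Rightarrow> real)"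
  shows "integral (cbox (0, 0) (pi, 2 * pi)) (\<lambda>(x, y). sin x * p (rot_y t *v sphere_point (x, y)))
       = integral (cbox (0, 0) (pi, 2 * pi)) (\<lambda>(x, y). sin x * p (sphere_point (x, y)))"
proof -
  obtain D where D: "\<And>x. (p has_derivative (\<lambda>h. D x \<bullet> h)) (at x)" "continuous_on UNIV D"
    using real_polynomial_function_gradient[OF p] by blast
  have pc: "continuous_on UNIV p"
    using has_derivative_continuous[OF D(1)] by (auto intro: continuous_at_imp_continuous_on)
  define Q where "Q t x y = rot_y t *v sphere_point (x, y)" for t x y
  define Qt Qx Qy where "Qt t x y = (vector [- sin t * (sin x * cos y) + cos t * cos x, 0, - cos t * (sin x * cos y) - sin t * cos x] :: real ^ 3)"
    and "Qx t x y = (vector [cos t * (cos x * cos y) - sin t * sin x, cos x * sin y, - sin t * (cos x * cos y) - cos t * sin x] :: real ^ 3)"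
    and "Qy t x y = (vector [- cos t * (sin x * sin y), sin x * cos y, sin t * (sin x * sin y)] :: real ^ 3)" for t x y :: real
  note Qs = Q_def Qt_def Qx_def Qy_def
  have Qc: "continuous_on T (\<lambda>z. Q (f z) (g z) (h z))"
    if "continuous_on T f" "continuous_on T g" "continuous_on T h" for T :: "'z :: t2_space set" and f g h
  proof -
    have "continuous_on T (\<lambda>z. rot_y (f z) $ 1 $ 1)" "continuous_on T (\<lambda>z. rot_y (f z) $ 1 $ 2)" "continuous_on T (\<lambda>z. rot_y (f z) $ 1 $ 3)"
      "continuous_on T (\<lambda>z. rot_y (f z) $ 2 $ 1)" "continuous_on T (\<lambda>z. rot_y (f z) $ 2 $ 2)" "continuous_on T (\<lambda>z. rot_y (f z) $ 2 $ 3)"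
      "continuous_on T (\<lambda>z. rot_y (f z) $ 3 $ 1)" "continuous_on T (\<lambda>z. rot_y (f z) $ 3 $ 2)" "continuous_on T (\<lambda>z. rot_y (f z) $ 3 $ 3)"
      unfolding rot_y_nth by (intro continuous_intros that)+
    then have "continuous_on T (\<lambda>z. rot_y (f z) $ i $ j)" for i j
      using exhaust_3[of i] exhaust_3[of j] by metis
    then show ?thesis unfolding Q_def
      by (rule continuous_on_matrix_vector3) (intro continuous_intros that)
  qed
  have vec: "continuous_on T (\<lambda>z. vector [f z, g z, h z] :: real ^ 3)"
    if "continuous_on T f" "continuous_on T g" "continuous_on T h" for T :: "'z :: t2_space set" and f g h
  proof (rule continuous_on_vec_nthI)
    show "continuous_on T (\<lambda>z. (vector [f z, g z, h z] :: real ^ 3) $ i)" for i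
      using exhaust_3[of i] that by auto
  qed
  have DQ: "((\<lambda>t. Q t x y) has_vector_derivative Qt t x y) (at t)"
    "((\<lambda>x. Q t x y) has_vector_derivative Qx t x y) (at x)"
    "((\<lambda>y. Q t x y) has_vector_derivative Qy t x y) (at y)" for t x y
    unfolding Qs
    by (rule has_vector_derivative_vec3; simp add: matrix_vector_mult3_nth; auto intro!: derivative_eq_intros)+
  have flowQ: "sin x *\<^sub>R Qt t x y = (sin x * cos y) *\<^sub>R Qx t x y + (- (cos x * sin y)) *\<^sub>R Qy t x y" for t x y
  proof -
    have sc: "(sin y)\<^sup>2 = 1 - (cos y)\<^sup>2" "(sin x)\<^sup>2 = 1 - (cos x)\<^sup>2" by (simp_all add: sin_squared_eq)
    show ?thesis unfolding Qs vec3_eq_iff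
      by (simp, insert sc, algebra)
  qed
  have cD: "continuous_on T (\<lambda>z. D (f z))" "continuous_on T (\<lambda>z. p (f z))" if "continuous_on T f" for T :: "'z :: t2_space set" and f
    using that D(2) pc by (auto intro: continuous_on_compose2)
  have "integral (cbox (0, 0) (pi, 2 * pi)) (\<lambda>(x, y). sin x * p (Q t x y))
      = integral (cbox (0, 0) (pi, 2 * pi)) (\<lambda>(x, y). sin x * p (Q 0 x y))"
  proof (rule integral_divergence_free_flow[where w = sin and Ut = "\<lambda>t x y. D (Q t x y) \<bullet> Qt t x y" and Ux = "\<lambda>t x y. D (Q t x y) \<bullet> Qx t x y"
        and Uy = "\<lambda>t x y. D (Q t x y) \<bullet> Qy t x y" and a = "\<lambda>x y. sin x * cos y" and a' = "\<lambda>x y. cos x * cos y" and b = "\<lambda>x y. - (cos x * sin y)"])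
    fix t x y :: real
    show "((\<lambda>t. p (Q t x y)) has_real_derivative D (Q t x y) \<bullet> Qt t x y) (at t)"
      "((\<lambda>x. p (Q t x y)) has_real_derivative D (Q t x y) \<bullet> Qx t x y) (at x)"
      "((\<lambda>y. p (Q t x y)) has_real_derivative D (Q t x y) \<bullet> Qy t x y) (at y)"
      by (rule gradient_chain[OF D(1)]; rule DQ)+
    show "((\<lambda>x. sin x * cos y) has_real_derivative cos x * cos y) (at x)"
      "((\<lambda>y. - (cos x * sin y)) has_real_derivative - (cos x * cos y)) (at y)"
      by (auto intro!: derivative_eq_intros)
    show "sin x * (D (Q t x y) \<bullet> Qt t x y) = sin x * cos y * (D (Q t x y) \<bullet> Qx t x y) + - (cos x * sin y) * (D (Q t x y) \<bullet> Qy t x y)"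
      using arg_cong[OF flowQ[of x t y], of "\<lambda>v. D (Q t x y) \<bullet> v"] by (simp add: inner_add_right inner_diff_right)
  qed (auto simp: case_prod_beta' Qt_def Qx_def Qy_def intro!: continuous_intros cD Qc vec)
  moreover have "Q 0 x y = sphere_point (x, y)" for x y
    by (simp add: Q_def vec3_eq_iff matrix_vector_mult3_nth)
  ultimately show ?thesis by (simp add: Q_def)
qed

lemma continuous_on_real_polynomial:
  fixes p :: "real ^ 3 \<Rightarrow> real"
  assumes "real_polynomial_function p"
  shows "continuous_on UNIV p"
  using assms real_polynomial_function_eq continuous_on_polymonial_function by blast

text \<open>A rotation about the z-axis is a shift of phi, so the flow has a = 0 and its
  t-derivative coincides with the y-derivative.\<close>

lemma rot_z_invariant_polynomial:
  assumes p: "real_polynomial_function (p :: real ^ 3 \<Rightarrow> real)"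
  shows "integral (cbox (0, 0) (pi, 2 * pi)) (\<lambda>(x, y). sin x * p (rot_z t *v sphere_point (x, y)))
       = integral (cbox (0, 0) (pi, 2 * pi)) (\<lambda>(x, y). sin x * p (sphere_point (x, y)))"
proof -
  obtain D where D: "\<And>x. (p has_derivative (\<lambda>h. D x \<bullet> h)) (at x)" "continuous_on UNIV D"
    using real_polynomial_function_gradient[OF p] by blast
  define Q where "Q t x y = sphere_point (x, y + t)" for t x y
  define Qx Qy where "Qx t x y = (vector [cos x * cos (y + t), cos x * sin (y + t), - sin x] :: real ^ 3)"
    and "Qy t x y = (vector [- (sin x * sin (y + t)), sin x * cos (y + t), 0] :: real ^ 3)" for t x y :: real
  note Qs = Q_def Qx_def Qy_def
  have vec: "continuous_on T (\<lambda>z. vector [f z, g z, h z] :: real ^ 3)"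
    if "continuous_on T f" "continuous_on T g" "continuous_on T h" for T :: "'z :: t2_space set" and f g h
  proof (rule continuous_on_vec_nthI)
    show "continuous_on T (\<lambda>z. (vector [f z, g z, h z] :: real ^ 3) $ i)" for i
      using exhaust_3[of i] that by auto
  qed
  have DQ: "((\<lambda>t. Q t x y) has_vector_derivative Qy t x y) (at t)"
    "((\<lambda>x. Q t x y) has_vector_derivative Qx t x y) (at x)"
    "((\<lambda>y. Q t x y) has_vector_derivative Qy t x y) (at y)" for t x y
    unfolding Qs
    by (rule has_vector_derivative_vec3; simp; auto intro!: derivative_eq_intros)+
  have cD: "continuous_on T (\<lambda>z. D (f z))" "continuous_on T (\<lambda>z. p (f z))" if "continuous_on T f" for T :: "'z :: t2_space set" and f
    using that D(2) continuous_on_real_polynomial[OF p] by (auto intro: continuous_on_compose2)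
  have "integral (cbox (0, 0) (pi, 2 * pi)) (\<lambda>(x, y). sin x * p (Q t x y))
      = integral (cbox (0, 0) (pi, 2 * pi)) (\<lambda>(x, y). sin x * p (Q 0 x y))"
  proof (rule integral_divergence_free_flow[where w = sin and Ut = "\<lambda>t x y. D (Q t x y) \<bullet> Qy t x y" and Ux = "\<lambda>t x y. D (Q t x y) \<bullet> Qx t x y"
        and Uy = "\<lambda>t x y. D (Q t x y) \<bullet> Qy t x y" and a = "\<lambda>x y. 0" and a' = "\<lambda>x y. 0" and b = "\<lambda>x y. sin x"])
    fix t x y :: real
    show "((\<lambda>t. p (Q t x y)) has_real_derivative D (Q t x y) \<bullet> Qy t x y) (at t)"
      "((\<lambda>x. p (Q t x y)) has_real_derivative D (Q t x y) \<bullet> Qx t x y) (at x)"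
      "((\<lambda>y. p (Q t x y)) has_real_derivative D (Q t x y) \<bullet> Qy t x y) (at y)"
      by (rule gradient_chain[OF D(1)]; rule DQ)+
    have "Q t x 0 = Q t x (2 * pi)" by (simp add: Q_def vec3_eq_iff add.commute)
    then show "sin x * p (Q t x 0) = sin x * p (Q t x (2 * pi))" by simp
  qed (auto simp: case_prod_beta' Qs intro!: continuous_intros cD vec)
  moreover have "Q t x y = rot_z t *v sphere_point (x, y)" for t x y
    by (simp add: Q_def vec3_eq_iff matrix_vector_mult3_nth cos_add sin_add algebra_simps)
  moreover have "Q 0 x y = sphere_point (x, y)" for x y by (simp add: Q_def)
  ultimately show ?thesis by simp
qed

section \<open>Measures determined by their polynomial integrals\<close>

text \<open>Uniform approximation on K leads from polynomials to continuous functions, the functions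
  max (0, 1 - n dist (x, C)) lead from these to closed sets, and closed sets form a generator of the
  Borel sets that is stable under intersection.\<close>

lemma finite_measure_eq_polynomials:
  fixes M N :: "'a :: euclidean_space measure"
  assumes M: "finite_measure M" "sets M = sets borel" "AE x in M. x \<in> K"
    and N: "finite_measure N" "sets N = sets borel" "AE x in N. x \<in> K"
    and K: "compact K"
    and eq: "\<And>p. real_polynomial_function p \<Longrightarrow> integral\<^sup>L M p = integral\<^sup>L N p"
  shows "M = N"
proof -
  interpret M: finite_measure M by (rule M)
  interpret N: finite_measure N by (rule N)
  have meas: "h \<in> borel_measurable M" "h \<in> borel_measurable N" if "continuous_on UNIV h" for h :: "'a \<Rightarrow> real"
    using borel_measurable_continuous_onI[OF that] measurable_cong_sets[OF M(2) refl] measurable_cong_sets[OF N(2) refl] by blast+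
  have bnd: "\<exists>B. \<forall>x\<in>K. norm (h x) \<le> B" if "continuous_on UNIV h" for h :: "'a \<Rightarrow> real"
    using compact_imp_bounded[OF compact_continuous_image[OF continuous_on_subset[OF that subset_UNIV] K]]
    by (auto simp: bounded_iff)
  have int: "integrable M h" "integrable N h" if h: "continuous_on UNIV h" for h :: "'a \<Rightarrow> real"
  proof -
    obtain B where B: "\<forall>x\<in>K. norm (h x) \<le> B" using bnd[OF h] by blast
    show "integrable M h" by (rule M.integrable_const_bound[of _ B, OF _ meas(1)[OF h]]) (use M(3) B in \<open>auto elim: eventually_mono\<close>)
    show "integrable N h" by (rule N.integrable_const_bound[of _ B, OF _ meas(2)[OF h]]) (use N(3) B in \<open>auto elim: eventually_mono\<close>)
  qed
  have cont: "integral\<^sup>L M h = integral\<^sup>L N h" if h: "continuous_on UNIV h" for h :: "'a \<Rightarrow> real"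
  proof (rule ccontr)
    \<comment> \<open>The summand 1 makes m exceed the total mass of both measures, so that errors
      of at most d / m per unit of mass add up to less than d.\<close>
    define m where "m = measure M (space M) + measure N (space N) + 1"
    define d where "d = \<bar>integral\<^sup>L M h - integral\<^sup>L N h\<bar>"
    assume "\<not> ?thesis"
    then have d: "d > 0" by (simp add: d_def)
    have m: "m > 0" by (simp add: m_def add_nonneg_pos)
    obtain p where p: "real_polynomial_function p" "\<And>x. x \<in> K \<Longrightarrow> \<bar>h x - p x\<bar> < d / m"
      using Stone_Weierstrass_real_polynomial_function[OF K continuous_on_subset[OF h subset_UNIV], of "d / m"] d m by auto
    have pc: "continuous_on UNIV p"
      using p(1) real_polynomial_function_eq continuous_on_polymonial_function by blast
    have close: "\<bar>integral\<^sup>L L h - integral\<^sup>L L p\<bar> \<le> d / m * measure L (space L)"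
      if L: "finite_measure L" "integrable L h" "integrable L p" "AE x in L. x \<in> K" for L
    proof -
      interpret L: finite_measure L by (rule L)
      have "\<bar>integral\<^sup>L L h - integral\<^sup>L L p\<bar> = \<bar>LINT x|L. h x - p x\<bar>" using L by simp
      also have "\<dots> \<le> (LINT x|L. \<bar>h x - p x\<bar>)" by (rule integral_abs_bound)
      also have "\<dots> \<le> (LINT x|L. d / m)"
        by (rule integral_mono_AE) (use L p(2) in \<open>auto elim!: eventually_mono intro: less_imp_le\<close>)
      finally show ?thesis by (simp add: mult.commute)
    qed
    have "d \<le> d / m * measure M (space M) + d / m * measure N (space N)"
      using close[OF M(1) int(1)[OF h] int(1)[OF pc] M(3)] close[OF N(1) int(2)[OF h] int(2)[OF pc] N(3)] eq[OF p(1)]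
      unfolding d_def by linarith
    also have "\<dots> = d * ((measure M (space M) + measure N (space N)) / m)"
      by (simp add: add_divide_distrib distrib_left)
    also have "measure M (space M) + measure N (space N) = m - 1" by (simp add: m_def)
    also have "d * ((m - 1) / m) < d * 1" using d m by (intro mult_strict_left_mono) auto
    finally show False by simp
  qed
  have closed: "measure M C = measure N C" if C: "closed C" "C \<noteq> {}" for C
  proof -
    define h where "h n x = max 0 (1 - real n * infdist x C)" for n x
    have hc: "continuous_on UNIV (h n)" for n
      unfolding h_def by (intro continuous_intros)
    have lim: "(\<lambda>n. h n x) \<longlonglongrightarrow> indicator C x" for x
    proof (cases "x \<in> C")
      case True
      then show ?thesis by (simp add: h_def)
    next
      case False
      then have pos: "infdist x C > 0" using C by (simp add: infdist_pos_not_in_closed)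
      obtain N0 where N0: "1 < real N0 * infdist x C" using reals_Archimedean3[OF pos] by blast
      have "h n x = 0" if "n \<ge> N0" for n
      proof -
        have "real N0 * infdist x C \<le> real n * infdist x C" using that pos by (intro mult_right_mono) auto
        with N0 have "1 - real n * infdist x C \<le> 0" by linarith
        then show ?thesis by (simp add: h_def)
      qed
      then have "\<forall>\<^sub>F n in sequentially. h n x = indicator C x"
        using False by (intro eventually_sequentiallyI[of N0]) auto
      then show ?thesis by (rule tendsto_eventually)
    qed
    have conv: "(\<lambda>n. integral\<^sup>L L (h n)) \<longlonglongrightarrow> measure L C" if L: "finite_measure L" "sets L = sets borel" "\<And>n. h n \<in> borel_measurable L" for L
    proof -
      interpret L: finite_measure L by (rule L)
      have CL: "C \<in> sets L" using C L by simp
      have "(\<lambda>n. integral\<^sup>L L (h n)) \<longlonglongrightarrow> integral\<^sup>L L (indicator C :: _ \<Rightarrow> real)"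
      proof (rule integral_dominated_convergence[where w = "\<lambda>_. 1"])
        have "\<bar>h n x\<bar> \<le> 1" for n x using infdist_nonneg[of x C] by (auto simp: h_def)
        then show "AE x in L. norm (h n x) \<le> 1" for n by simp
      qed (use L lim CL in auto)
      moreover have "C \<inter> space L = C" using sets.sets_into_space[OF CL] by blast
      ultimately show ?thesis using CL by simp
    qed
    have "(\<lambda>n. integral\<^sup>L M (h n)) \<longlonglongrightarrow> measure M C" "(\<lambda>n. integral\<^sup>L N (h n)) \<longlonglongrightarrow> measure N C"
      by (intro conv M N meas hc)+
    then show ?thesis unfolding cont[OF hc] by (rule LIMSEQ_unique)
  qed
  show ?thesis
  proof (rule measure_eqI_generator_eq[where E = "{C. closed C}" and \<Omega> = UNIV and A = "\<lambda>_. UNIV"])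
    show "emeasure M X = emeasure N X" if "X \<in> {C. closed C}" for X
      using that closed[of X] by (cases "X = {}") (auto simp: M.emeasure_eq_measure N.emeasure_eq_measure)
    show "sets M = sigma_sets UNIV {C. closed C}" "sets N = sigma_sets UNIV {C. closed C}"
      unfolding M N borel_eq_closed by auto
  qed (auto simp: Int_stable_def M.emeasure_eq_measure)
qed


text \<open>The argument is continuous off the ray of nonnegative reals and vanishes on that
  ray.\<close>

lemma measurable_Arg2pi: "Arg2pi \<in> borel_measurable borel"
proof -
  have "(\<lambda>z. indicator (- \<real>\<^sub>\<ge>\<^sub>0) z *\<^sub>R Arg2pi z) \<in> borel_measurable borel"
  proof (rule borel_measurable_continuous_on_indicator)
    show "continuous_on (- \<real>\<^sub>\<ge>\<^sub>0) Arg2pi"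
      by (intro continuous_at_imp_continuous_on ballI continuous_at_Arg2pi) auto
  qed auto
  moreover have "(\<lambda>z. indicator (- \<real>\<^sub>\<ge>\<^sub>0) z *\<^sub>R Arg2pi z) = Arg2pi"
    by (auto simp: fun_eq_iff indicator_def Arg2pi_eq_0 complex_nonneg_Reals_iff complex_is_Real_iff)
  ultimately show ?thesis by simp
qed

text \<open>The value of arccos outside of [-1, 1] is irrelevant, hence the clamping.\<close>

lemma measurable_polar_coords:
  obtains h where "h \<in> borel_measurable borel" "\<And>x. norm x = 1 \<Longrightarrow> h x = polar_coords x" "\<And>x. h x \<in> sphere_coords"
proof
  define h where "h x = (arccos (max (-1) (min 1 (x $ 3))), Arg2pi (Complex (x $ 1) (x $ 2)))" for x :: "real ^ 3"
  have "(\<lambda>x :: real ^ 3. arccos (max (-1) (min 1 (x $ 3)))) \<in> borel_measurable borel"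
    by (intro borel_measurable_continuous_onI continuous_intros) auto
  moreover have "(\<lambda>x :: real ^ 3. Complex (x $ 1) (x $ 2)) \<in> borel_measurable borel"
    unfolding Complex_eq by (intro borel_measurable_continuous_onI continuous_intros)
  then have "(\<lambda>x :: real ^ 3. Arg2pi (Complex (x $ 1) (x $ 2))) \<in> borel_measurable borel"
    using measurable_Arg2pi by (rule measurable_compose)
  ultimately show "h \<in> borel_measurable borel"
    unfolding h_def[abs_def] by (rule borel_measurable_Pair)
  show "h x = polar_coords x" if "norm x = 1" for x
  proof -
    have "\<bar>x $ 3\<bar> \<le> 1" using component_le_norm_cart[of x 3] that by simp
    then show ?thesis by (auto simp: h_def polar_coords_def max_def min_def)
  qed
  show "h x \<in> sphere_coords" for x
    using Arg2pi[of "Complex (x $ 1) (x $ 2)"]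
    by (auto simp: h_def sphere_coords_def intro!: arccos_lbound arccos_ubound)
qed

lemma measurable_sphere_point: "sphere_point \<in> borel_measurable borel"
  using continuous_on_sphere_point[of UNIV fst snd]
  by (intro borel_measurable_continuous_onI) (simp add: continuous_on_fst continuous_on_snd)

lemma measurable_matrix_vector: "(\<lambda>x. R *v x) \<in> borel_measurable borel" for R :: "real ^ 3 ^ 3"
  by (intro borel_measurable_continuous_onI matrix_vector_mult_linear_continuous_on)

section \<open>Invariance of the image measure and of the measure in coordinates\<close>

definition sphere_image :: "(real ^ 3) measure" where
  "sphere_image = distr sphere_borel borel sphere_point"

lemma finite_measure_sphere_borel: "finite_measure sphere_borel"
proof
  have "emeasure sphere_borel (space sphere_borel) = emeasure sphere_measure (space sphere_measure)"
    unfolding sphere_measure_eq_completion space_completion 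
    using emeasure_completion[OF sets_completionI_sets[OF sets.top[of sphere_borel]]] main_part[OF sets.top[of sphere_borel]]
    by argo
  then show "emeasure sphere_borel (space sphere_borel) \<noteq> \<infinity>"
    using sphere.emeasure_finite by simp
qed

lemma integral_sphere_borel:
  fixes f :: "real \<times> real \<Rightarrow> 'a :: {banach, second_countable_topology}"
  assumes "f \<in> borel_measurable sphere_borel"
  shows "integral\<^sup>L sphere_measure f = integral\<^sup>L sphere_borel f"
  unfolding sphere_measure_eq_completion by (rule integral_completion[OF assms])

lemma integral_sphere_image_rot:
  assumes p: "real_polynomial_function p" and R: "R \<in> SO3"
  shows "integral\<^sup>L sphere_image (\<lambda>x. p (R *v x)) =
    integral (cbox (0, 0) (pi, 2 * pi)) (\<lambda>(x, y). sin x * p (R *v sphere_point (x, y)))"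
proof -
  have pc: "continuous_on UNIV (\<lambda>x. p (R *v x))"
    by (rule continuous_on_compose2[OF continuous_on_real_polynomial[OF p] matrix_vector_mult_linear_continuous_on]) auto
  have c: "continuous_on T (\<lambda>z. p (R *v sphere_point z))" for T
    using continuous_on_compose2[OF pc continuous_on_sphere_point[of T fst snd]] by (simp add: continuous_on_fst continuous_on_snd)
  have m: "(\<lambda>z. p (R *v sphere_point z)) \<in> borel_measurable sphere_borel"
    by (intro measurable_sphere_borel borel_measurable_continuous_onI c)
  have "integral\<^sup>L sphere_image (\<lambda>x. p (R *v x)) = (LINT z|sphere_borel. p (R *v sphere_point z))"
    unfolding sphere_image_def
    by (rule integral_distr[OF measurable_sphere_borel[OF measurable_sphere_point] borel_measurable_continuous_onI[OF pc]])
  also have "\<dots> = (LINT z|sphere_measure. p (R *v sphere_point z))"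
    by (rule integral_sphere_borel[OF m, symmetric])
  also have "\<dots> = integral {0..pi} (\<lambda>\<theta>. integral {0..2 * pi} (\<lambda>\<phi>. sin \<theta> *\<^sub>R p (R *v sphere_point (\<theta>, \<phi>))))"
    by (rule sphere_integral_continuous[OF c])
  also have "\<dots> = integral (cbox (0, 0) (pi, 2 * pi)) (\<lambda>z. sin (fst z) * p (R *v sphere_point z))"
    by (subst integral_prod_continuous) (auto intro!: continuous_intros c)
  finally show ?thesis by (simp add: case_prod_beta')
qed

text \<open>Rotations act linearly on the image measure in space, so that polynomials serve as test
  functions. By the Euler decomposition the rotations about the z- and the y-axis generate SO(3),
  and invariance passes to products.\<close>

lemma sphere_image_rotation_invariant:
  assumes "R \<in> SO3"
  shows "distr sphere_image borel ((*v) R) = sphere_image"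
proof -
  have norm1: "AE x in sphere_image. x \<in> sphere 0 1"
    unfolding sphere_image_def
    by (subst AE_distr_iff[OF measurable_sphere_borel[OF measurable_sphere_point]]) auto
  have fin: "finite_measure sphere_image"
    unfolding sphere_image_def
    by (rule finite_measure.finite_measure_distr[OF finite_measure_sphere_borel measurable_sphere_borel[OF measurable_sphere_point]])
  have sets: "sets sphere_image = sets borel" by (simp add: sphere_image_def)
  have mR: "(*v) Q \<in> measurable sphere_image borel" for Q :: "real ^ 3 ^ 3"
    using measurable_matrix_vector[of Q] measurable_cong_sets[OF sets refl] by blast
  have gen: "distr sphere_image borel ((*v) Q) = sphere_image"
    if Q: "Q \<in> SO3" and inv: "\<And>p. real_polynomial_function p \<Longrightarrow>
       integral (cbox (0, 0) (pi, 2 * pi)) (\<lambda>(x, y). sin x * p (Q *v sphere_point (x, y)))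
       = integral (cbox (0, 0) (pi, 2 * pi)) (\<lambda>(x, y). sin x * p (sphere_point (x, y)))" for Q :: "real ^ 3 ^ 3"
  proof (rule finite_measure_eq_polynomials)
    show "AE x in distr sphere_image borel ((*v) Q). x \<in> sphere 0 1"
      by (subst AE_distr_iff[OF mR]) (use norm1 SO3_norm[OF Q] in auto)
    show "integral\<^sup>L (distr sphere_image borel ((*v) Q)) p = integral\<^sup>L sphere_image p"
      if p: "real_polynomial_function p" for p
    proof -
      have "integral\<^sup>L (distr sphere_image borel ((*v) Q)) p = integral\<^sup>L sphere_image (\<lambda>x. p (Q *v x))"
        by (rule integral_distr[OF mR borel_measurable_continuous_onI[OF continuous_on_real_polynomial[OF p]]])
      \<comment> \<open>The identity is written as a rotation so that
        \<open>integral_sphere_image_rot\<close> evaluates both sides.\<close>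
      also have "\<dots> = integral\<^sup>L sphere_image (\<lambda>x. p (rot_z 0 *v x))"
        unfolding integral_sphere_image_rot[OF p Q] integral_sphere_image_rot[OF p rot_z_SO3] inv[OF p]
        by (simp add: rot_z_0)
      finally show ?thesis by (simp add: rot_z_0)
    qed
  qed (use fin sets norm1 finite_measure.finite_measure_distr[OF fin mR] in auto)
  have comp: "distr sphere_image borel ((*v) (A ** B)) = sphere_image"
    if "distr sphere_image borel ((*v) A) = sphere_image" "distr sphere_image borel ((*v) B) = sphere_image" for A B :: "real ^ 3 ^ 3"
  proof -
    have "distr sphere_image borel ((*v) (A ** B)) = distr (distr sphere_image borel ((*v) B)) borel ((*v) A)"
      by (subst distr_distr[OF measurable_matrix_vector mR]) (simp add: comp_def matrix_vector_mul_assoc)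
    then show ?thesis using that by simp
  qed
  obtain \<gamma> where "R = frame (polar_coords (R *v north)) ** rot_z \<gamma>" using SO3_euler[OF assms] .
  then show ?thesis
    unfolding frame_def
    using comp[OF comp[OF gen[OF rot_z_SO3 rot_z_invariant_polynomial] gen[OF rot_y_SO3 rot_y_invariant_polynomial]] gen[OF rot_z_SO3 rot_z_invariant_polynomial]]
    by metis
qed


lemma measurable_sphere_rot_aux:
  assumes R: "R \<in> SO3"
  shows "sphere_rot R \<in> measurable sphere_borel sphere_borel"
    and "distr sphere_borel sphere_borel (sphere_rot R) = sphere_borel"
proof -
  obtain h where h: "h \<in> borel_measurable borel" "\<And>x. norm x = 1 \<Longrightarrow> h x = polar_coords x" "\<And>x. h x \<in> sphere_coords"
    using measurable_polar_coords by blast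
  have hm: "h \<in> measurable borel sphere_borel"
    unfolding measurable_cong_sets[OF refl sets_sphere_borel]
    by (rule measurable_restrict_space2) (use h in auto)
  have pm: "sphere_point \<in> measurable sphere_borel borel"
    by (rule measurable_sphere_borel[OF measurable_sphere_point])
  have eq: "sphere_rot R p = h (R *v sphere_point p)" for p
    using SO3_norm[OF R] by (simp add: sphere_rot_def h(2))
  have eq': "sphere_rot R = (h \<circ> (*v) R) \<circ> sphere_point" by (simp add: fun_eq_iff eq)
  show mT: "sphere_rot R \<in> measurable sphere_borel sphere_borel"
    unfolding eq' by (intro measurable_comp[OF pm] measurable_comp[OF measurable_matrix_vector] hm)
  have "distr sphere_borel sphere_borel (sphere_rot R) = distr (distr sphere_image borel ((*v) R)) sphere_borel h"
    unfolding sphere_image_def eq'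
    using hm pm by (simp add: distr_distr[OF _ pm] distr_distr[OF hm] measurable_comp[OF pm measurable_matrix_vector] distr_distr[OF hm measurable_comp[OF pm measurable_matrix_vector]] measurable_matrix_vector comp_assoc)
  also have "\<dots> = distr sphere_image sphere_borel h"
    by (simp add: sphere_image_rotation_invariant[OF R])
  also have "\<dots> = distr sphere_borel sphere_borel (h \<circ> sphere_point)"
    unfolding sphere_image_def by (rule distr_distr[OF hm pm])
  \<comment> \<open>\<open>h\<close> inverts \<open>sphere_point\<close> off the poles, hence almost
    everywhere.\<close>
  also have "\<dots> = distr sphere_borel sphere_borel (\<lambda>p. p)"
  proof (rule distr_cong_AE)
    have "AE p in sphere_borel. fst p \<in> {0<..<pi} \<and> snd p \<in> {0..<2 * pi}"
      using AE_sphere_interior by (simp add: AE_sphere_measure_iff)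
    then show "AE p in sphere_borel. (h \<circ> sphere_point) p = p"
    proof eventually_elim
      case (elim p)
      then have "p \<in> sphere_coords" "sin (fst p) \<noteq> 0"
        using sin_gt_zero[of "fst p"] by (auto simp: sphere_coords_def mem_Times_iff)
      then show ?case using polar_coords_sphere_point[of p] h(2)[of "sphere_point p"] by simp
    qed
    show "(h \<circ> sphere_point) \<in> measurable sphere_borel sphere_borel" by (rule measurable_comp[OF pm hm])
  qed auto
  finally show "distr sphere_borel sphere_borel (sphere_rot R) = sphere_borel" by (simp add: distr_id)
qed

text \<open>Measurability with respect to the completed target requires preimages of null sets to be
  null, and this is part of the invariance.\<close>

lemma measurable_sphere_rot:
  assumes R: "R \<in> SO3"
  shows "sphere_rot R \<in> measurable sphere_measure sphere_measure"
  unfolding sphere_measure_eq_completion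
proof (rule completion.measurable_completion2)
  show m: "sphere_rot R \<in> measurable (completion sphere_borel) sphere_borel"
    by (rule measurable_completion[OF measurable_sphere_rot_aux(1)[OF R]])
  show "null_sets sphere_borel \<subseteq> null_sets (distr (completion sphere_borel) sphere_borel (sphere_rot R))"
    by (simp add: distr_completion[OF measurable_sphere_rot_aux(1)[OF R]] measurable_sphere_rot_aux(2)[OF R])
qed

lemma distr_sphere_rot:
  assumes R: "R \<in> SO3"
  shows "distr sphere_measure sphere_measure (sphere_rot R) = sphere_measure"
proof (rule measure_eqI)
  fix A assume "A \<in> sets (distr sphere_measure sphere_measure (sphere_rot R))"
  then have A: "A \<in> sets (completion sphere_borel)" by (simp add: sphere_measure_eq_completion)
  then obtain B N N' where BN: "A = B \<union> N'" "B \<in> sets sphere_borel" "N' \<subseteq> N" "N \<in> null_sets sphere_borel"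
    by (auto elim: sets_completionE)
  note mT = measurable_sphere_rot_aux[OF R]
  have vim: "emeasure sphere_borel (sphere_rot R -` X \<inter> sphere_coords) = emeasure sphere_borel X" if "X \<in> sets sphere_borel" for X
    using emeasure_distr[OF mT(1) that] mT(2) by simp
  have e: "emeasure sphere_measure X = emeasure sphere_borel X" if "X \<in> sets sphere_borel" for X
    using that by (simp add: sphere_measure_eq_completion)
  have msets: "sphere_rot R -` X \<inter> sphere_coords \<in> sets sphere_borel" if "X \<in> sets sphere_borel" for X
    using measurable_sets[OF mT(1) that] by simp
  have null: "Z \<in> null_sets sphere_measure" if "Z \<subseteq> Y" "Y \<in> null_sets sphere_borel" for Z Y
    unfolding sphere_measure_eq_completion by (rule null_sets_completion_subset[OF that(1) null_sets_completionI[OF that(2)]])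
  have "emeasure (distr sphere_measure sphere_measure (sphere_rot R)) A = emeasure sphere_measure (sphere_rot R -` A \<inter> sphere_coords)"
    using A by (subst emeasure_distr[OF measurable_sphere_rot[OF R]]) (auto simp: sphere_measure_eq_completion)
  also have "sphere_rot R -` A \<inter> sphere_coords = (sphere_rot R -` B \<inter> sphere_coords) \<union> (sphere_rot R -` N' \<inter> sphere_coords)"
    using BN by auto
  also have "emeasure sphere_measure \<dots> = emeasure sphere_measure (sphere_rot R -` B \<inter> sphere_coords)"
  proof (rule emeasure_Un_null_set)
    show "sphere_rot R -` B \<inter> sphere_coords \<in> sets sphere_measure"
      unfolding sphere_measure_eq_completion by (intro sets_completionI_sets msets BN)
    show "sphere_rot R -` N' \<inter> sphere_coords \<in> null_sets sphere_measure"
    proof (rule null[of _ "sphere_rot R -` N \<inter> sphere_coords"])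
      have "N \<in> sets sphere_borel" "emeasure sphere_borel N = 0" using BN(4) by auto
      then show "sphere_rot R -` N \<inter> sphere_coords \<in> null_sets sphere_borel"
        using vim[of N] msets[of N] by (intro null_setsI) simp_all
    qed (use BN in auto)
  qed
  also have "\<dots> = emeasure sphere_measure B" using BN by (simp add: e msets vim)
  also have "\<dots> = emeasure sphere_measure (B \<union> N')"
    using BN by (intro emeasure_Un_null_set[symmetric] null[OF BN(3,4)]) (auto simp: sphere_measure_eq_completion)
  finally show "emeasure (distr sphere_measure sphere_measure (sphere_rot R)) A = emeasure sphere_measure A"
    by (simp add: BN)
qed simp

lemma AE_sphere_rot:
  assumes "R \<in> SO3" "AE p in sphere_measure. P p"
  shows "AE p in sphere_measure. P (sphere_rot R p)"
proof -
  have "AE p in distr sphere_measure sphere_measure (sphere_rot R). P p"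
    unfolding distr_sphere_rot[OF assms(1)] by (rule assms(2))
  then show ?thesis by (rule AE_distrD[OF measurable_sphere_rot[OF assms(1)]])
qed

lemma integral_sphere_rot:
  fixes f :: "real \<times> real \<Rightarrow> 'a :: {banach, second_countable_topology}"
  assumes "R \<in> SO3" "f \<in> borel_measurable sphere_measure"
  shows "(LINT p|sphere_measure. f (sphere_rot R p)) = integral\<^sup>L sphere_measure f"
  using integral_distr[OF measurable_sphere_rot[OF assms(1)] assms(2)] by (simp add: distr_sphere_rot[OF assms(1)])

lemma integrable_sphere_rot:
  fixes f :: "real \<times> real \<Rightarrow> 'a :: {banach, second_countable_topology}"
  assumes "R \<in> SO3" "integrable sphere_measure f"
  shows "integrable sphere_measure (\<lambda>p. f (sphere_rot R p))"
  by (rule integrable_distr[OF measurable_sphere_rot[OF assms(1)]]) (simp add: distr_sphere_rot[OF assms(1)] assms(2))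

section \<open>Lifting the harmonics to the rotation group\<close>

text \<open>
  A complex vector v is encoded by the quadratic polynomial \<open>c(X) \<bullet> v / 2\<close> where
  \<open>c(X) = (1 - X^2, i (1 + X^2), 2 X)\<close> runs through the null vectors.  Rotations of v become Moebius
  substitutions of X.
\<close>

definition null_poly :: "complex \<Rightarrow> complex \<Rightarrow> complex \<Rightarrow> complex poly" where
  "null_poly a b c = [:(a + \<i> * b) / 2, c, - ((a - \<i> * b) / 2):]"

text \<open>The code of the vector M (u, v, w): multiplying M from the right changes the
  coefficients u, v, w, multiplying it from the left rotates the encoded vector.\<close>

definition col_poly :: "complex \<Rightarrow> complex \<Rightarrow> complex \<Rightarrow> real ^ 3 ^ 3 \<Rightarrow> complex poly" where
  "col_poly u v w M = null_poly
     (of_real (M $ 1 $ 1) * u + of_real (M $ 1 $ 2) * v + of_real (M $ 1 $ 3) * w)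
     (of_real (M $ 2 $ 1) * u + of_real (M $ 2 $ 2) * v + of_real (M $ 2 $ 3) * w)
     (of_real (M $ 3 $ 1) * u + of_real (M $ 3 $ 2) * v + of_real (M $ 3 $ 3) * w)"

text \<open>A right turn about the z-axis fixes the third column and multiplies the two null
  combinations of the first two columns by conjugate characters. Hence |s| such factors among l
  produce the weight s. Over a frame the three codes are A B, A^2 and B^2 up to the phase in phi, so
  that the product becomes A^(l+s) B^(l-s).\<close>

definition spin_poly :: "int \<Rightarrow> nat \<Rightarrow> real ^ 3 ^ 3 \<Rightarrow> complex poly" where
  "spin_poly s l M = col_poly 0 0 1 M ^ (l - nat \<bar>s\<bar>) *
     (if s \<ge> 0 then col_poly (-1) (- \<i>) 0 M else col_poly 1 (- \<i>) 0 M) ^ nat \<bar>s\<bar>"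

text \<open>
  The lift of \<open>spinY s l m\<close> to the rotation group: right translations about the z-axis multiply it by a
  character depending on s, and left translations mix the indices m only.
\<close>

definition spinF :: "int \<Rightarrow> nat \<Rightarrow> int \<Rightarrow> real ^ 3 ^ 3 \<Rightarrow> complex" where
  "spinF s l m M = of_real (spin_amp s l m) * coeff (spin_poly s l M) (nat (int l - m))"

lemma col_poly_rot_z_right:
  "col_poly 0 0 1 (M ** rot_z \<kappa>) = col_poly 0 0 1 M"
  "col_poly (-1) (- \<i>) 0 (M ** rot_z \<kappa>) = smult (cis (- \<kappa>)) (col_poly (-1) (- \<i>) 0 M)"
  "col_poly 1 (- \<i>) 0 (M ** rot_z \<kappa>) = smult (cis \<kappa>) (col_poly 1 (- \<i>) 0 M)"
  by (simp_all add: col_poly_def null_poly_def matrix_mult3_nth complex_eq_iff algebra_simps diff_divide_distrib add_divide_distrib)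

lemma exp_eq_cis: "exp (- \<i> * of_int s * of_real x) = cis (- (of_int s * x))" "exp (\<i> * of_int s * of_real x) = cis (of_int s * x)"
  by (simp_all add: cis_conv_exp mult_ac)

lemma spin_poly_rot_z_right:
  "spin_poly s l (M ** rot_z \<kappa>) = smult (exp (- \<i> * of_int s * of_real \<kappa>)) (spin_poly s l M)"
proof (cases "s \<ge> 0")
  case True
  then have n: "real (nat \<bar>s\<bar>) * - \<kappa> = - (of_int s * \<kappa>)" by simp
  have "cis (- \<kappa>) ^ nat \<bar>s\<bar> = exp (- \<i> * of_int s * of_real \<kappa>)"
    by (simp only: Complex.DeMoivre exp_eq_cis n)
  then show ?thesis
    using True by (simp add: spin_poly_def col_poly_rot_z_right smult_power)
next
  case False
  then have n: "real (nat \<bar>s\<bar>) * \<kappa> = - (of_int s * \<kappa>)" by simp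
  have "cis \<kappa> ^ nat \<bar>s\<bar> = exp (- \<i> * of_int s * of_real \<kappa>)"
    by (simp only: Complex.DeMoivre exp_eq_cis n)
  then show ?thesis
    using False by (simp add: spin_poly_def col_poly_rot_z_right smult_power)
qed

lemma coeff_of_real_power_mult:
  fixes P P' :: "real poly"
  assumes "\<And>k. coeff Q k = of_real (coeff P k)" "\<And>k. coeff Q' k = of_real (coeff P' k)"
  shows "coeff (Q * Q') k = (of_real (coeff (P * P') k) :: complex)"
    and "coeff (Q ^ n) k = (of_real (coeff (P ^ n) k) :: complex)"
proof -
  show "coeff (Q * Q') k = (of_real (coeff (P * P') k) :: complex)"
    by (simp add: coeff_mult assms)
  show "coeff (Q ^ n) k = (of_real (coeff (P ^ n) k) :: complex)"
    by (induction n arbitrary: k) (simp_all add: coeff_mult assms)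
qed

definition chalfA :: "real \<Rightarrow> complex poly" where
  "chalfA t = [:of_real (sin (t / 2)), of_real (cos (t / 2)):]"

definition chalfB :: "real \<Rightarrow> complex poly" where
  "chalfB t = [:of_real (cos (t / 2)), - of_real (sin (t / 2)):]"

lemma coeff_chalf: "coeff (chalfA t ^ p * chalfB t ^ q) k = of_real (wig p q k t)"
proof -
  have "coeff (chalfA t) k = of_real (coeff (halfA t) k)" "coeff (chalfB t) k = of_real (coeff (halfB t) k)" for k
    by (simp_all add: chalfA_def halfA_def chalfB_def halfB_def coeff_pCons split: nat.split)
  then show ?thesis
    unfolding wig_def by (intro coeff_of_real_power_mult)
qed

text \<open>The link between the two descriptions. The position vector has the code A B, the null
  tangent vectors have squares as codes, and phi enters as a scaling of X together with a
  phase.\<close>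

lemma col_poly_frame:
  "col_poly 0 0 1 (frame p) = smult (cis (snd p)) ((chalfA (fst p) * chalfB (fst p)) \<circ>\<^sub>p [:0, cis (- snd p):])"
  "col_poly (-1) (- \<i>) 0 (frame p) = smult (cis (snd p)) ((chalfA (fst p) * chalfA (fst p)) \<circ>\<^sub>p [:0, cis (- snd p):])"
  "col_poly 1 (- \<i>) 0 (frame p) = smult (cis (snd p)) ((chalfB (fst p) * chalfB (fst p)) \<circ>\<^sub>p [:0, cis (- snd p):])"
proof -
  define x y where "x = snd p" and "y = fst p"
  have q: "smult (cis x) ([:of_real a, of_real b, of_real c:] \<circ>\<^sub>p [:0, cis (- x):]) = [:cis x * of_real a, of_real b, cis (- x) * of_real c:]" for a b c
    by (simp add: pcompose_pCons cis_mult mult.assoc[symmetric])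
  have half: "chalfA y * chalfB y = [:of_real (sin y / 2), of_real (cos y), of_real (- sin y / 2):]"
    "chalfA y * chalfA y = [:of_real ((1 - cos y) / 2), of_real (sin y), of_real ((1 + cos y) / 2):]"
    "chalfB y * chalfB y = [:of_real ((1 + cos y) / 2), of_real (- sin y), of_real ((1 - cos y) / 2):]"
    unfolding chalfA_def chalfB_def sin_half_squared[symmetric] cos_half_squared[symmetric]
    by (simp_all add: power2_eq_square mult_ac sin_double_half[of y] cos_double_half[of y])
  show "col_poly 0 0 1 (frame p) = smult (cis (snd p)) ((chalfA (fst p) * chalfB (fst p)) \<circ>\<^sub>p [:0, cis (- snd p):])"
    "col_poly (-1) (- \<i>) 0 (frame p) = smult (cis (snd p)) ((chalfA (fst p) * chalfA (fst p)) \<circ>\<^sub>p [:0, cis (- snd p):])"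
    "col_poly 1 (- \<i>) 0 (frame p) = smult (cis (snd p)) ((chalfB (fst p) * chalfB (fst p)) \<circ>\<^sub>p [:0, cis (- snd p):])"
    unfolding x_def[symmetric] y_def[symmetric] half q
    unfolding col_poly_def null_poly_def frame_def matrix_mult3_nth x_def[symmetric] y_def[symmetric]
    by (simp_all add: complex_eq_iff field_simps)
qed

lemma spin_poly_frame:
  assumes "\<bar>s\<bar> \<le> int l"
  shows "coeff (spin_poly s l (frame p)) k =
     of_real (wig (nat (int l + s)) (nat (int l - s)) k (fst p)) * cis (snd p) ^ l * cis (- snd p) ^ k"
proof -
  define n where "n = nat \<bar>s\<bar>"
  have n: "n \<le> l" using assms by (simp add: n_def)
  define A B r where "A = chalfA (fst p)" and "B = chalfB (fst p)" and "r = [:0, cis (- snd p):]"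
  have pow: "(smult c (P \<circ>\<^sub>p r)) ^ i * (smult c (Q \<circ>\<^sub>p r)) ^ j = smult (c ^ (i + j)) ((P ^ i * Q ^ j) \<circ>\<^sub>p r)" for c P Q i j
    by (simp add: smult_power pcompose_mult pcompose_power power_add mult_ac)
  have "spin_poly s l (frame p) = smult (cis (snd p) ^ l) ((A ^ nat (int l + s) * B ^ nat (int l - s)) \<circ>\<^sub>p r)"
  proof (cases "s \<ge> 0")
    case True
    then have ln: "nat (int l + s) = (l - n) + n + n" "nat (int l - s) = l - n" using n by (auto simp: n_def)
    have "(A * B) ^ (l - n) * (A * A) ^ n = A ^ nat (int l + s) * B ^ nat (int l - s)"
      unfolding ln by (simp add: power_mult_distrib power_add mult_ac)
    then show ?thesis
      using True n unfolding spin_poly_def col_poly_frame n_def[symmetric] A_def[symmetric] B_def[symmetric] r_def[symmetric] 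
      by (simp add: pow)
  next
    case False
    then have ln: "nat (int l - s) = (l - n) + n + n" "nat (int l + s) = l - n" using n by (auto simp: n_def)
    have "(A * B) ^ (l - n) * (B * B) ^ n = A ^ nat (int l + s) * B ^ nat (int l - s)"
      unfolding ln by (simp add: power_mult_distrib power_add mult_ac)
    then show ?thesis
      using False n unfolding spin_poly_def col_poly_frame n_def[symmetric] A_def[symmetric] B_def[symmetric] r_def[symmetric] 
      by (simp add: pow)
  qed
  then show ?thesis
    unfolding A_def B_def r_def by (simp add: coeff_pcompose_linear coeff_chalf mult_ac)
qed

lemma spinF_frame:
  assumes "\<bar>m\<bar> \<le> int l" "\<bar>s\<bar> \<le> int l"
  shows "spinF s l m (frame p) = spinY s l m p"
proof -
  have "real (nat (int l - m)) = real l - of_int m" using assms by simp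
  then have n: "real l * snd p + real (nat (int l - m)) * - snd p = of_int m * snd p"
    by (simp add: algebra_simps)
  have "cis (snd p) ^ l * cis (- snd p) ^ nat (int l - m) = exp (\<i> * of_int m * of_real (snd p))"
    by (simp only: Complex.DeMoivre cis_mult n exp_eq_cis)
  then show ?thesis
    unfolding spinF_def spinY_def spin_poly_frame[OF assms(2)] by (simp add: mult.assoc)
qed

lemma spinF_frame_rot_z:
  assumes "\<bar>m\<bar> \<le> int l" "\<bar>s\<bar> \<le> int l"
  shows "spinF s l m (M ** rot_z \<kappa>) = exp (- \<i> * of_int s * of_real \<kappa>) * spinF s l m M"
  unfolding spinF_def spin_poly_rot_z_right by simp

section \<open>Left translations as Moebius substitutions\<close>

text \<open>P' arises from P, regarded as a form of degree n, by the substitution X \<mapsto> b / a.\<close>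

definition moebius_subst :: "complex poly \<Rightarrow> complex poly \<Rightarrow> nat \<Rightarrow> complex poly \<Rightarrow> complex poly \<Rightarrow> bool" where
  "moebius_subst a b n P P' \<longleftrightarrow> degree P \<le> n \<and>
     (\<forall>z. poly a z \<noteq> 0 \<longrightarrow> poly P' z = poly a z ^ n * poly P (poly b z / poly a z))"

lemma moebius_subst_mult:
  assumes "moebius_subst a b n P P'" "moebius_subst a b m Q Q'"
  shows "moebius_subst a b (n + m) (P * Q) (P' * Q')"
  using assms degree_mult_le[of P Q] by (auto simp: moebius_subst_def power_add)

lemma moebius_subst_power:
  assumes "moebius_subst a b n P P'"
  shows "moebius_subst a b (n * i) (P ^ i) (P' ^ i)"
proof (induction i)
  case (Suc i)
  show ?case using moebius_subst_mult[OF assms Suc.IH] by simp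
qed (simp add: moebius_subst_def)

lemma poly_eq_sum_atMost:
  fixes p :: "'a :: comm_ring_1 poly"
  assumes "degree p \<le> n"
  shows "poly p x = (\<Sum>j\<le>n. coeff p j * x ^ j)"
  unfolding poly_altdef
  by (rule sum.mono_neutral_left) (use assms in \<open>auto simp: coeff_eq_0\<close>)

lemma moebius_subst_coeff:
  assumes "moebius_subst a b n P P'" "a \<noteq> 0"
  shows "coeff P' k = (\<Sum>j\<le>n. coeff (a ^ (n - j) * b ^ j) k * coeff P j)"
proof -
  define H where "H = (\<Sum>j\<le>n. smult (coeff P j) (a ^ (n - j) * b ^ j))"
  \<comment> \<open>The substitution rule says nothing at the zeros of a. The factor a fills this
    gap and is cancelled afterwards.\<close>
  have "(P' - H) * a = 0"
  proof (rule poly_eq_fun)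
    fix z
    show "poly ((P' - H) * a) z = poly 0 z"
    proof (cases "poly a z = 0")
      case False
      have "poly P' z = poly a z ^ n * (\<Sum>j\<le>n. coeff P j * (poly b z / poly a z) ^ j)"
        using assms False by (auto simp: moebius_subst_def poly_eq_sum_atMost)
      also have "\<dots> = poly H z"
        unfolding H_def poly_sum sum_distrib_left
        using False by (intro sum.cong) (auto simp: power_diff power_divide)
      finally show ?thesis by simp
    qed simp
  qed
  then have "P' = H" using assms by simp
  then show ?thesis by (simp add: H_def coeff_sum mult.commute)
qed

text \<open>The Moebius map X to (sin (t/2) + X cos (t/2)) / (cos (t/2) - X sin (t/2)) of the
  element of SU(2) over \<open>rot_y t\<close>. It parametrizes the rotated null vectors up to a
  factor, which is the square of the denominator.\<close>

lemma moebius_subst_rot_y: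
  "moebius_subst [:of_real (cos (t / 2)), - of_real (sin (t / 2)):] [:of_real (sin (t / 2)), of_real (cos (t / 2)):] 2
     (col_poly u v w M) (col_poly u v w (rot_y t ** M))"
proof -
  define c s where "c = complex_of_real (cos (t / 2))" and "s = complex_of_real (sin (t / 2))"
  have cs: "of_real (cos t) = c * c - s * s" "of_real (sin t) = 2 * s * c"
    unfolding c_def s_def by (simp_all add: cos_double_half[of t] sin_double_half[of t] power2_eq_square)
  have "c * c + s * s = of_real ((sin (t / 2))\<^sup>2 + (cos (t / 2))\<^sup>2)"
    by (simp only: c_def s_def power2_eq_square of_real_add of_real_mult add.commute)
  then have one: "c * c + s * s = 1" by simp
  \<comment> \<open>With \<open>cos_t\<close> and \<open>sin_t\<close> as variables, c^2 + s^2 = 1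
    is the only further relation that the algebra needs.\<close>
  have key: "(cos_t * x + sin_t * z + \<i> * y) / 2 + (- sin_t * x + cos_t * z) * \<zeta> - (cos_t * x + sin_t * z - \<i> * y) / 2 * \<zeta>\<^sup>2
     = (c - s * \<zeta>)\<^sup>2 * ((x + \<i> * y) / 2 + z * ((s + c * \<zeta>) / (c - s * \<zeta>)) - (x - \<i> * y) / 2 * ((s + c * \<zeta>) / (c - s * \<zeta>))\<^sup>2)"
    if "cos_t = c * c - s * s" "sin_t = 2 * s * c" "c - s * \<zeta> \<noteq> 0" for x y z \<zeta> cos_t sin_t
  proof -
    have "(c - s * \<zeta>)\<^sup>2 * ((x + \<i> * y) / 2 + z * ((s + c * \<zeta>) / (c - s * \<zeta>)) - (x - \<i> * y) / 2 * ((s + c * \<zeta>) / (c - s * \<zeta>))\<^sup>2)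
      = (x + \<i> * y) / 2 * (c - s * \<zeta>)\<^sup>2 + z * ((s + c * \<zeta>) * (c - s * \<zeta>)) - (x - \<i> * y) / 2 * (s + c * \<zeta>)\<^sup>2"
    proof -
      have "D\<^sup>2 * (A + z * (N / D) - B * (N / D)\<^sup>2) = A * D\<^sup>2 + z * (N * D) - B * N\<^sup>2" if "D \<noteq> 0" for A B N D :: complex
        using that by (simp add: power2_eq_square field_simps)
      then show ?thesis using that(3) by blast
    qed
    also have "\<dots> = (cos_t * x + sin_t * z + \<i> * y) / 2 + (- sin_t * x + cos_t * z) * \<zeta> - (cos_t * x + sin_t * z - \<i> * y) / 2 * \<zeta>\<^sup>2"
      unfolding that(1,2) power2_eq_square using one by algebra
    finally show ?thesis ..
  qed
  show ?thesis
    unfolding moebius_subst_def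
  proof (intro conjI allI impI)
    fix z assume z: "poly [:of_real (cos (t / 2)), - of_real (sin (t / 2)):] z \<noteq> (0 :: complex)"
    define x y x' where "x = of_real (M $ 1 $ 1) * u + of_real (M $ 1 $ 2) * v + of_real (M $ 1 $ 3) * w"
      and "y = of_real (M $ 2 $ 1) * u + of_real (M $ 2 $ 2) * v + of_real (M $ 2 $ 3) * w"
      and "x' = of_real (M $ 3 $ 1) * u + of_real (M $ 3 $ 2) * v + of_real (M $ 3 $ 3) * w"
    have M: "col_poly u v w M = null_poly x y x'"
      by (simp add: col_poly_def x_def y_def x'_def)
    have "col_poly u v w (rot_y t ** M) = null_poly (of_real (cos t) * x + of_real (sin t) * x') y (- of_real (sin t) * x + of_real (cos t) * x')"
      by (simp add: col_poly_def matrix_mult3_nth x_def y_def x'_def distrib_left distrib_right mult.assoc algebra_simps)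
    then have "poly (col_poly u v w (rot_y t ** M)) z = (of_real (cos t) * x + of_real (sin t) * x' + \<i> * y) / 2
        + (- of_real (sin t) * x + of_real (cos t) * x') * z - (of_real (cos t) * x + of_real (sin t) * x' - \<i> * y) / 2 * z\<^sup>2"
      by (simp add: null_poly_def power2_eq_square algebra_simps)
    also have "\<dots> = (c - s * z)\<^sup>2 * ((x + \<i> * y) / 2 + x' * ((s + c * z) / (c - s * z)) - (x - \<i> * y) / 2 * ((s + c * z) / (c - s * z))\<^sup>2)"
      by (rule key[OF cs]) (use z in \<open>simp add: c_def s_def mult.commute\<close>)
    also have "(x + \<i> * y) / 2 + x' * ((s + c * z) / (c - s * z)) - (x - \<i> * y) / 2 * ((s + c * z) / (c - s * z))\<^sup>2
        = poly (null_poly x y x') ((s + c * z) / (c - s * z))"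
    proof -
      have "(x + \<i> * y) / 2 + x' * q - (x - \<i> * y) / 2 * q\<^sup>2 = poly (null_poly x y x') q" for q
        by (simp add: null_poly_def power2_eq_square algebra_simps)
      then show ?thesis .
    qed
    finally show "poly (col_poly u v w (rot_y t ** M)) z = poly [:of_real (cos (t / 2)), - of_real (sin (t / 2)):] z ^ 2 *
        poly (col_poly u v w M) (poly [:of_real (sin (t / 2)), of_real (cos (t / 2)):] z / poly [:of_real (cos (t / 2)), - of_real (sin (t / 2)):] z)"
      by (simp add: M c_def s_def mult.commute)
  qed (simp add: col_poly_def null_poly_def)
qed

lemma moebius_subst_spin_poly:
  assumes "\<And>u v w. moebius_subst a b 2 (col_poly u v w M) (col_poly u v w (Q ** M))" "\<bar>s\<bar> \<le> int l"
  shows "moebius_subst a b (2 * l) (spin_poly s l M) (spin_poly s l (Q ** M))"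
proof -
  have e: "2 * (l - nat \<bar>s\<bar>) + 2 * nat \<bar>s\<bar> = 2 * l" using assms(2) by auto
  have "moebius_subst a b (2 * (l - nat \<bar>s\<bar>) + 2 * nat \<bar>s\<bar>) (spin_poly s l M) (spin_poly s l (Q ** M))"
    unfolding spin_poly_def by (intro moebius_subst_mult moebius_subst_power) (use assms(1) in auto)
  then show ?thesis unfolding e .
qed

text \<open>Here the Moebius map is the dilation X to X exp (- i t). It does not mix powers of X, so
  the matrix of a rotation about the z-axis is diagonal.\<close>

lemma moebius_subst_rot_z:
  "moebius_subst [:cis (t / 2):] [:0, cis (- (t / 2)):] 2 (col_poly u v w M) (col_poly u v w (rot_z t ** M))"
  unfolding moebius_subst_def
proof (intro conjI allI impI)
  fix z
  define x y x' where "x = of_real (M $ 1 $ 1) * u + of_real (M $ 1 $ 2) * v + of_real (M $ 1 $ 3) * w"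
    and "y = of_real (M $ 2 $ 1) * u + of_real (M $ 2 $ 2) * v + of_real (M $ 2 $ 3) * w"
    and "x' = of_real (M $ 3 $ 1) * u + of_real (M $ 3 $ 2) * v + of_real (M $ 3 $ 3) * w"
  define e where "e = cis (t / 2)"
  have e0: "e \<noteq> 0" by (simp add: e_def)
  have e1: "cis (- (t / 2)) = 1 / e" unfolding e_def cis_inverse[symmetric] by (rule inverse_eq_divide)
  have e2: "e\<^sup>2 = cis t" by (simp add: e_def power2_eq_square cis_mult)
  have e3: "1 / e\<^sup>2 = cis (- t)" unfolding e2 cis_inverse[symmetric] by (rule inverse_eq_divide[symmetric])
  have cs: "of_real (cos t) + \<i> * of_real (sin t) = e\<^sup>2" "of_real (cos t) - \<i> * of_real (sin t) = 1 / e\<^sup>2"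
    unfolding e3 unfolding e2 by (simp_all add: complex_eq_iff)
  have M: "col_poly u v w M = null_poly x y x'"
    by (simp add: col_poly_def x_def y_def x'_def)
  have R: "col_poly u v w (rot_z t ** M) = null_poly (of_real (cos t) * x - of_real (sin t) * y) (of_real (sin t) * x + of_real (cos t) * y) x'"
    by (simp add: col_poly_def matrix_mult3_nth x_def y_def x'_def algebra_simps)
  have a1: "(of_real (cos t) * x - of_real (sin t) * y) + \<i> * (of_real (sin t) * x + of_real (cos t) * y) = e\<^sup>2 * (x + \<i> * y)"
    unfolding cs(1)[symmetric] by (simp add: algebra_simps)
  have a2: "(of_real (cos t) * x - of_real (sin t) * y) - \<i> * (of_real (sin t) * x + of_real (cos t) * y) = (1 / e\<^sup>2) * (x - \<i> * y)"
    unfolding cs(2)[symmetric] by (simp add: algebra_simps)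
  have "poly (col_poly u v w (rot_z t ** M)) z = e\<^sup>2 * (x + \<i> * y) / 2 + x' * z - (1 / e\<^sup>2) * (x - \<i> * y) / 2 * z\<^sup>2"
    unfolding R null_poly_def a1 a2 by (simp add: power2_eq_square algebra_simps)
  also have "\<dots> = e\<^sup>2 * ((x + \<i> * y) / 2 + x' * (z / e\<^sup>2) - (x - \<i> * y) / 2 * (z / e\<^sup>2)\<^sup>2)"
  proof -
    have "d * p / 2 + x' * z - (1 / d) * q / 2 * z\<^sup>2 = d * (p / 2 + x' * (z / d) - q / 2 * (z / d)\<^sup>2)" if "d \<noteq> 0" for d p q :: complex
      using that by (simp add: field_simps power2_eq_square)
    then show ?thesis using e0 by simp
  qed
  also have "\<dots> = e\<^sup>2 * poly (null_poly x y x') (z / e\<^sup>2)"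
  proof -
    have "(x + \<i> * y) / 2 + x' * q - (x - \<i> * y) / 2 * q\<^sup>2 = poly (null_poly x y x') q" for q
      by (simp add: null_poly_def power2_eq_square algebra_simps)
    then show ?thesis by (simp only:)
  qed
  finally show "poly (col_poly u v w (rot_z t ** M)) z = poly [:cis (t / 2):] z ^ 2 *
      poly (col_poly u v w M) (poly [:0, cis (- (t / 2)):] z / poly [:cis (t / 2):] z)"
    unfolding M e1 e_def[symmetric] by (simp add: power2_eq_square)
qed (simp add: col_poly_def null_poly_def)

lemma spinF_rot_z:
  assumes "\<bar>s\<bar> \<le> int l" "\<bar>m\<bar> \<le> int l"
  shows "spinF s l m (rot_z t ** M) = exp (\<i> * of_int m * of_real t) * spinF s l m M"
proof -
  define k where "k = nat (int l - m)"
  have k: "k \<le> 2 * l" using assms by (auto simp: k_def)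
  have co: "coeff ([:c:] ^ i * [:0, d:] ^ j) k = (if j = k then c ^ i * d ^ j else 0)" for c d :: complex and i j
  proof -
    have "[:0, d:] = monom d 1" by (simp add: monom_altdef)
    then have "[:c:] ^ i * [:0, d:] ^ j = monom (c ^ i * d ^ j) j"
      by (simp add: monom_power poly_const_pow smult_monom)
    then show ?thesis by simp
  qed
  have "coeff (spin_poly s l (rot_z t ** M)) k =
    (\<Sum>j\<le>2 * l. coeff ([:cis (t / 2):] ^ (2 * l - j) * [:0, cis (- (t / 2)):] ^ j) k * coeff (spin_poly s l M) j)"
    by (rule moebius_subst_coeff[OF moebius_subst_spin_poly[OF moebius_subst_rot_z assms(1)]]) simp
  also have "\<dots> = (\<Sum>j\<le>2 * l. if j = k then cis (t / 2) ^ (2 * l - k) * cis (- (t / 2)) ^ k * coeff (spin_poly s l M) k else 0)"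
    unfolding co by (intro sum.cong) auto
  also have "\<dots> = cis (t / 2) ^ (2 * l - k) * cis (- (t / 2)) ^ k * coeff (spin_poly s l M) k"
    using k by (simp add: sum.delta)
  also have "cis (t / 2) ^ (2 * l - k) * cis (- (t / 2)) ^ k = exp (\<i> * of_int m * of_real t)"
  proof -
    have "real (2 * l - k) * (t / 2) + real k * - (t / 2) = of_int m * t"
    proof -
      have "real (2 * l - k) = real l + of_int m" "real k = real l - of_int m" using assms by (auto simp: k_def of_nat_diff)
      then show ?thesis by (simp only:) (simp add: algebra_simps add_divide_distrib diff_divide_distrib)
    qed
    then show ?thesis by (simp only: Complex.DeMoivre cis_mult exp_eq_cis)
  qed
  finally show ?thesis unfolding spinF_def k_def by simp
qed

lemma spin_amp_nonzero: "\<bar>s\<bar> \<le> int l \<Longrightarrow> \<bar>m\<bar> \<le> int l \<Longrightarrow> spin_amp s l m \<noteq> 0"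
  using spin_amp(1)[of m l s] by (auto simp: divide_eq_0_iff)

lemma spinF_moebius:
  assumes hyp: "\<And>u v w. moebius_subst a b 2 (col_poly u v w M) (col_poly u v w (Q ** M))" "a \<noteq> 0"
    and "\<bar>s\<bar> \<le> int l"
  shows "spinF s l m (Q ** M) = (\<Sum>n=-int l..int l. of_real (spin_amp s l m) * coeff (a ^ nat (int l + n) * b ^ nat (int l - n)) (nat (int l - m))
      / of_real (spin_amp s l n) * spinF s l n M)"
proof -
  have "spinF s l m (Q ** M) = of_real (spin_amp s l m) * (\<Sum>j\<le>2 * l. coeff (a ^ (2 * l - j) * b ^ j) (nat (int l - m)) * coeff (spin_poly s l M) j)"
    unfolding spinF_def
    by (subst moebius_subst_coeff[OF moebius_subst_spin_poly[OF hyp(1) assms(3)] hyp(2)]) simp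
  also have "(\<Sum>j\<le>2 * l. coeff (a ^ (2 * l - j) * b ^ j) (nat (int l - m)) * coeff (spin_poly s l M) j)
    = (\<Sum>n=-int l..int l. coeff (a ^ nat (int l + n) * b ^ nat (int l - n)) (nat (int l - m)) * coeff (spin_poly s l M) (nat (int l - n)))"
  proof (rule sum.reindex_bij_witness[where i = "\<lambda>n. nat (int l - n)" and j = "\<lambda>j. int l - int j"])
    fix j assume "j \<in> {..2 * l}"
    then have "nat (int l + (int l - int j)) = 2 * l - j" by auto
    then show "coeff (a ^ nat (int l + (int l - int j)) * b ^ nat (int l - (int l - int j))) (nat (int l - m)) *
         coeff (spin_poly s l M) (nat (int l - (int l - int j))) =
         coeff (a ^ (2 * l - j) * b ^ j) (nat (int l - m)) * coeff (spin_poly s l M) j" by simp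
  qed auto
  finally show ?thesis
    using spin_amp_nonzero[OF assms(3)] unfolding spinF_def sum_distrib_left
    by (auto intro!: sum.cong simp: abs_le_iff)
qed

text \<open>M ranges over all matrices, since the substitution rules are identities in the entries
  of M. Composition then requires no membership in SO(3).\<close>

definition spin_linear :: "int \<Rightarrow> nat \<Rightarrow> real ^ 3 ^ 3 \<Rightarrow> (int \<Rightarrow> int \<Rightarrow> complex) \<Rightarrow> bool" where
  "spin_linear s l Q E \<longleftrightarrow> (\<forall>M. \<forall>m\<in>{-int l..int l}. spinF s l m (Q ** M) = (\<Sum>n=-int l..int l. E m n * spinF s l n M))"

lemma spin_linear_compose:
  assumes "spin_linear s l P D" "spin_linear s l Q E"
  shows "spin_linear s l (P ** Q) (\<lambda>m n. \<Sum>k=-int l..int l. D m k * E k n)"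
  unfolding spin_linear_def
proof (intro allI ballI)
  fix M m assume m: "m \<in> {-int l..int l}"
  have "spinF s l m (P ** Q ** M) = (\<Sum>k=-int l..int l. D m k * spinF s l k (Q ** M))"
    using assms(1) m by (simp add: spin_linear_def flip: matrix_mul_assoc)
  also have "\<dots> = (\<Sum>k=-int l..int l. D m k * (\<Sum>n=-int l..int l. E k n * spinF s l n M))"
    using assms(2) by (intro sum.cong) (auto simp: spin_linear_def)
  also have "\<dots> = (\<Sum>k=-int l..int l. \<Sum>n=-int l..int l. D m k * E k n * spinF s l n M)"
    by (simp add: sum_distrib_left mult.assoc)
  also have "\<dots> = (\<Sum>n=-int l..int l. (\<Sum>k=-int l..int l. D m k * E k n) * spinF s l n M)"
    by (subst sum.swap) (simp add: sum_distrib_right)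
  finally show "spinF s l m (P ** Q ** M) = (\<Sum>n=-int l..int l. (\<Sum>k=-int l..int l. D m k * E k n) * spinF s l n M)" .
qed

lemma spin_linear_rot_z:
  assumes "\<bar>s\<bar> \<le> int l"
  shows "spin_linear s l (rot_z t) (\<lambda>m n. if m = n then exp (\<i> * of_int m * of_real t) else 0)"
  unfolding spin_linear_def
proof (intro allI ballI)
  fix M m assume m: "m \<in> {-int l..int l}"
  have "(\<Sum>n=-int l..int l. (if m = n then exp (\<i> * of_int m * of_real t) else 0) * spinF s l n M)
     = (\<Sum>n=-int l..int l. if m = n then exp (\<i> * of_int m * of_real t) * spinF s l m M else 0)"
    by (intro sum.cong) auto
  also have "\<dots> = exp (\<i> * of_int m * of_real t) * spinF s l m M"
    using m by (simp add: sum.delta')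
  finally show "spinF s l m (rot_z t ** M) = (\<Sum>n=-int l..int l. (if m = n then exp (\<i> * of_int m * of_real t) else 0) * spinF s l n M)"
    using spinF_rot_z[OF assms, of m] m by auto
qed

lemma spin_linear_rot_y:
  assumes "\<bar>s\<bar> \<le> int l" "cos (t / 2) \<noteq> 0"
  obtains E where "spin_linear s l (rot_y t) E"
    "\<And>n. sin (t / 2) \<noteq> 0 \<Longrightarrow> n \<in> {-int l..int l} \<Longrightarrow> E (int l) n \<noteq> 0"
proof
  define a b where "a = [:complex_of_real (cos (t / 2)), - of_real (sin (t / 2)):]" and "b = [:complex_of_real (sin (t / 2)), of_real (cos (t / 2)):]"
  define E where "E m n = of_real (spin_amp s l m) * coeff (a ^ nat (int l + n) * b ^ nat (int l - n)) (nat (int l - m))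
      / of_real (spin_amp s l n)" for m n
  show "spin_linear s l (rot_y t) E"
    unfolding spin_linear_def E_def
    by (intro allI ballI spinF_moebius) (use moebius_subst_rot_y assms in \<open>auto simp: a_def b_def\<close>)
  \<comment> \<open>For m = l the coefficient is the constant term of a^(l+n) b^(l-n), that is
    cos^(l+n) (t/2) sin^(l-n) (t/2).\<close>
  show "E (int l) n \<noteq> 0" if "sin (t / 2) \<noteq> 0" "n \<in> {-int l..int l}" for n
    using that assms(2) spin_amp_nonzero[OF assms(1)]
    by (auto simp: E_def a_def b_def coeff_mult_0 coeff_0_power abs_le_iff)
qed


lemma spinF_frame_mult:
  assumes "\<bar>m\<bar> \<le> int l" "\<bar>s\<bar> \<le> int l" "Q \<in> SO3"
  shows "spinF s l m (Q ** frame p) =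
    exp (- \<i> * of_int s * of_real (third_euler_angle (Q ** frame p))) * spinY s l m (sphere_rot Q p)"
  using arg_cong[OF frame_sphere_rot[OF assms(3), of p], of "spinF s l m"]
  unfolding spinF_frame_rot_z[OF assms(1,2)] spinF_frame[OF assms(1,2)] .

text \<open>\<open>frame_sphere_rot\<close> read backwards. It expresses a harmonic at p through its
  lift over the rotated point, so that a rotation can be moved from one factor of a scalar product
  to the other.\<close>

lemma spinY_sphere_rot:
  assumes "\<bar>m\<bar> \<le> int l" "\<bar>s\<bar> \<le> int l" "Q \<in> SO3"
  shows "exp (- \<i> * of_int s * of_real (third_euler_angle (Q ** frame p))) * spinF s l m (transpose Q ** frame (sphere_rot Q p)) = spinY s l m p"
proof -
  have "transpose Q ** frame (sphere_rot Q p) ** rot_z (third_euler_angle (Q ** frame p)) = transpose Q ** (Q ** frame p)"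
    by (simp only: frame_sphere_rot[OF assms(3), of p, symmetric] flip: matrix_mul_assoc)
  also have "\<dots> = frame p"
    using assms(3) by (simp add: matrix_mul_assoc SO3_iff)
  finally have "spinF s l m (frame p) = exp (- \<i> * of_int s * of_real (third_euler_angle (Q ** frame p))) * spinF s l m (transpose Q ** frame (sphere_rot Q p))"
    by (metis spinF_frame_rot_z[OF assms(1,2)])
  then show ?thesis by (simp add: spinF_frame[OF assms(1,2)])
qed

lemma cnj_phase: "cnj (exp (- \<i> * of_int s * of_real x)) * exp (- \<i> * of_int s * of_real x) = 1"
  by (simp add: exp_cnj flip: exp_add)

lemma spin_linear_ex:
  assumes "\<bar>s\<bar> \<le> int l" "Q \<in> SO3"
  shows "\<exists>E. spin_linear s l Q E"
proof -
  obtain \<gamma> where Q: "Q = frame (polar_coords (Q *v north)) ** rot_z \<gamma>" using SO3_euler[OF assms(2)] .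
  define t where "t = fst (polar_coords (Q *v north))"
  have y: "\<exists>E. spin_linear s l (rot_y t) E" if "cos (t / 2) \<noteq> 0" for t
    using spin_linear_rot_y[OF assms(1) that] by blast
  have "\<exists>E. spin_linear s l (rot_y t) E"
  proof (cases "cos (t / 2) = 0")
    \<comment> \<open>Here t is an odd multiple of pi, which \<open>spin_linear_rot_y\<close>
      excludes. Two rotations by t / 2 are composed instead.\<close>
    case True
    then have "cos t = -1" using cos_double_half[of t] sin_cos_squared_add[of "t / 2"] by simp
    then have "cos (t / 2 / 2) \<noteq> 0"
      using True cos_double_half[of "t / 2"] sin_cos_squared_add[of "t / 2 / 2"] by auto
    then obtain E where E: "spin_linear s l (rot_y (t / 2)) E" using y by blast
    have "rot_y t = rot_y (t / 2) ** rot_y (t / 2)"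
      using cos_add[of "t / 2" "t / 2"] sin_add[of "t / 2" "t / 2"]
      by (simp add: matrix3_eq_iff matrix_mult3_nth)
    then show ?thesis using spin_linear_compose[OF E E] by auto
  qed (use y in blast)
  then obtain E where E: "spin_linear s l (rot_y t) E" by blast
  note z = spin_linear_rot_z[OF assms(1)]
  define a where "a = snd (polar_coords (Q *v north))"
  have Qa: "Q = rot_z a ** rot_y t ** rot_z \<gamma>"
    using Q by (simp add: frame_def t_def a_def)
  have "\<exists>E. spin_linear s l (rot_z a ** rot_y t ** rot_z \<gamma>) E"
    using spin_linear_compose[OF spin_linear_compose[OF z E] z] by blast
  then show ?thesis by (simp only: Qa)
qed

section \<open>The representation matrices and their unitarity\<close>

text \<open>By orthonormality this integral reads off the only possible matrix entry, which makes
  \<open>wigD\<close> multiplicative. As an integral with the parameter Q it is also measurable in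
  Q.\<close>

definition wigD :: "int \<Rightarrow> nat \<Rightarrow> real ^ 3 ^ 3 \<Rightarrow> int \<Rightarrow> int \<Rightarrow> complex" where
  "wigD s l Q m n = sphere_inner (spinY s l n) (\<lambda>p. spinF s l m (Q ** frame p))"

lemma wigD_unique:
  assumes s: "\<bar>s\<bar> \<le> int l" and E: "spin_linear s l Q E" and mn: "m \<in> {-int l..int l}" "n \<in> {-int l..int l}"
  shows "wigD s l Q m n = E m n"
proof -
  have "(\<lambda>p. spinF s l m (Q ** frame p)) = (\<lambda>p. \<Sum>k=-int l..int l. E m k * spinY s l k p)"
    using E mn spinF_frame[OF _ s] by (auto simp: spin_linear_def fun_eq_iff abs_le_iff intro!: sum.cong)
  then have "wigD s l Q m n = (\<Sum>k=-int l..int l. sphere_inner (spinY s l n) (\<lambda>p. E m k * spinY s l k p))"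
    unfolding wigD_def by (simp only:) (intro sphere_inner_sum_right L2_spinY L2_sphere_cmult)
  also have "\<dots> = (\<Sum>k=-int l..int l. if k = n then E m n else 0)"
    unfolding sphere_inner_cmult_right
    using mn s by (intro sum.cong refl) (subst sphere_inner_spinY; auto simp: abs_le_iff)
  finally show ?thesis using mn by (simp add: sum.delta)
qed

lemma spin_linear_wigD:
  assumes "\<bar>s\<bar> \<le> int l" "Q \<in> SO3"
  shows "spin_linear s l Q (wigD s l Q)"
proof -
  obtain E where E: "spin_linear s l Q E" using spin_linear_ex[OF assms] by blast
  then show ?thesis
    using wigD_unique[OF assms(1) E] by (simp add: spin_linear_def)
qed

lemma wigD_mult:
  assumes "\<bar>s\<bar> \<le> int l" "P \<in> SO3" "Q \<in> SO3" "m \<in> {-int l..int l}" "n \<in> {-int l..int l}"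
  shows "wigD s l (P ** Q) m n = (\<Sum>k=-int l..int l. wigD s l P m k * wigD s l Q k n)"
  by (rule wigD_unique[OF assms(1) spin_linear_compose[OF spin_linear_wigD spin_linear_wigD]]) (use assms in auto)

lemma continuous_on_coeff_mult:
  fixes P Q :: "'z :: topological_space \<Rightarrow> complex poly"
  assumes "\<And>k. continuous_on T (\<lambda>z. coeff (P z) k)" "\<And>k. continuous_on T (\<lambda>z. coeff (Q z) k)"
  shows "continuous_on T (\<lambda>z. coeff (P z * Q z) k)"
  unfolding coeff_mult by (intro continuous_intros assms)

lemma continuous_on_coeff_power:
  fixes P :: "'z :: topological_space \<Rightarrow> complex poly"
  assumes "\<And>k. continuous_on T (\<lambda>z. coeff (P z) k)"
  shows "continuous_on T (\<lambda>z. coeff (P z ^ n) k)"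
  by (induction n arbitrary: k) (auto intro: continuous_on_coeff_mult assms)

lemma continuous_on_spinF:
  fixes M :: "'z :: topological_space \<Rightarrow> real ^ 3 ^ 3"
  assumes "continuous_on T M"
  shows "continuous_on T (\<lambda>z. spinF s l m (M z))"
proof -
  have col: "continuous_on T (\<lambda>z. coeff (col_poly u v w (M z)) k)" for u v w k
  proof -
    consider "k = 0" | "k = 1" | "k = 2" | "k > 2" by linarith
    then show ?thesis
      unfolding col_poly_def null_poly_def
      by cases (auto simp: numeral_2_eq_2 coeff_eq_0 intro!: continuous_intros assms)
  qed
  show ?thesis
    unfolding spinF_def spin_poly_def
    by (cases "s \<ge> 0"; simp; intro continuous_intros continuous_on_coeff_mult continuous_on_coeff_power col)
qed

lemma continuous_on_matrixI:
  fixes M :: "'z :: topological_space \<Rightarrow> real ^ 3 ^ 3"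
  assumes "\<And>i j. continuous_on T (\<lambda>z. M z $ i $ j)"
  shows "continuous_on T M"
proof -
  have "continuous_on T (\<lambda>z. M z $ i)" for i
    using continuous_on_vec_lambda[of T "\<lambda>j z. M z $ i $ j"] assms by simp
  then show ?thesis
    using continuous_on_vec_lambda[of T "\<lambda>i z. M z $ i"] by simp
qed

lemma continuous_on_frame:
  fixes p :: "'z :: t2_space \<Rightarrow> real \<times> real"
  assumes "continuous_on T p"
  shows "continuous_on T (\<lambda>z. frame (p z))"
proof -
  have "continuous_on T (\<lambda>z. frame (p z) $ 1 $ 1)" "continuous_on T (\<lambda>z. frame (p z) $ 1 $ 2)" "continuous_on T (\<lambda>z. frame (p z) $ 1 $ 3)"
    "continuous_on T (\<lambda>z. frame (p z) $ 2 $ 1)" "continuous_on T (\<lambda>z. frame (p z) $ 2 $ 2)" "continuous_on T (\<lambda>z. frame (p z) $ 2 $ 3)"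
    "continuous_on T (\<lambda>z. frame (p z) $ 3 $ 1)" "continuous_on T (\<lambda>z. frame (p z) $ 3 $ 2)" "continuous_on T (\<lambda>z. frame (p z) $ 3 $ 3)"
    unfolding frame_def matrix_mult3_nth rot_y_nth rot_z_nth by (intro continuous_intros assms)+
  then have "continuous_on T (\<lambda>z. frame (p z) $ i $ j)" for i j
    using exhaust_3[of i] exhaust_3[of j] by metis
  then show ?thesis by (rule continuous_on_matrixI)
qed

lemma continuous_on_spinF_mult:
  fixes Q :: "'z :: t2_space \<Rightarrow> real ^ 3 ^ 3"
  assumes "continuous_on T Q" "continuous_on T p"
  shows "continuous_on T (\<lambda>z. spinF s l m (Q z ** frame (p z)))"
proof (intro continuous_on_spinF continuous_on_matrixI)
  show "continuous_on T (\<lambda>z. (Q z ** frame (p z)) $ i $ j)" for i j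
    unfolding matrix_mult3_nth by (intro continuous_intros continuous_on_frame assms)
qed

lemma continuous_on_spinF_frame: "continuous_on T (\<lambda>p. spinF s l m (Q ** frame p))"
  by (intro continuous_on_spinF_mult continuous_intros)

lemma L2_spinF_frame: "(\<lambda>p. spinF s l m (Q ** frame p)) \<in> L2_sphere"
  by (rule L2_sphere_continuous[OF continuous_on_spinF_frame])

text \<open>Q is moved to the other factor by the invariance of the surface measure; the phases that
  arise in the two factors are conjugate and of modulus 1. Together with multiplicativity this is
  the unitarity of D.\<close>

lemma wigD_transpose:
  assumes s: "\<bar>s\<bar> \<le> int l" and Q: "Q \<in> SO3" and mn: "\<bar>m\<bar> \<le> int l" "\<bar>n\<bar> \<le> int l"
  shows "wigD s l Q m n = cnj (wigD s l (transpose Q) n m)"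
proof -
  define h where "h p = cnj (spinF s l n (transpose Q ** frame p)) * spinY s l m p" for p
  have hT: "h (sphere_rot Q p) = cnj (spinY s l n p) * spinF s l m (Q ** frame p)" for p
  proof -
    define e where "e = exp (- \<i> * of_int s * of_real (third_euler_angle (Q ** frame p)))"
    have "cnj (spinY s l n p) * spinF s l m (Q ** frame p) = (cnj e * e) * h (sphere_rot Q p)"
      unfolding spinF_frame_mult[OF mn(1) s Q] spinY_sphere_rot[OF mn(2) s Q, of p, symmetric] e_def[symmetric] h_def
      by simp
    then show ?thesis unfolding e_def cnj_phase by simp
  qed
  have "wigD s l Q m n = (LINT p|sphere_measure. h (sphere_rot Q p))"
    unfolding wigD_def sphere_inner_def hT ..
  also have "\<dots> = integral\<^sup>L sphere_measure h"
    unfolding h_def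
    by (intro integral_sphere_rot[OF Q] borel_measurable_integrable L2_inner_integrable L2_spinF_frame L2_spinY)
  also have "\<dots> = sphere_inner (\<lambda>p. spinF s l n (transpose Q ** frame p)) (spinY s l m)"
    unfolding h_def sphere_inner_def ..
  finally show ?thesis
    unfolding wigD_def by (subst (asm) sphere_inner_commute)
qed

lemma wigD_orthogonal:
  assumes s: "\<bar>s\<bar> \<le> int l" and Q: "Q \<in> SO3" and n: "n \<in> {-int l..int l}" "n' \<in> {-int l..int l}"
  shows "(\<Sum>m=-int l..int l. cnj (wigD s l Q m n) * wigD s l Q m n') = (if n = n' then 1 else 0)"
proof -
  have QT: "transpose Q ** Q = mat 1" using Q by (simp add: SO3_iff)
  have "(\<Sum>m=-int l..int l. cnj (wigD s l Q m n) * wigD s l Q m n') = (\<Sum>m=-int l..int l. wigD s l (transpose Q) n m * wigD s l Q m n')"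
    using wigD_transpose[OF s Q] n by (intro sum.cong) (auto simp: abs_le_iff)
  also have "\<dots> = wigD s l (transpose Q ** Q) n n'"
    by (rule wigD_mult[OF s SO3_transpose[OF Q] Q n, symmetric])
  also have "\<dots> = wigD s l (rot_z 0) n n'" by (simp add: QT rot_z_0)
  also have "\<dots> = (if n = n' then 1 else 0)"
    using wigD_unique[OF s spin_linear_rot_z[OF s] n, of 0] by simp
  finally show ?thesis .
qed

text \<open>The integrand is jointly continuous in all matrices Q and all coordinates p, and the
  integral is taken over the finite Borel version of the surface measure.\<close>

lemma measurable_wigD: "(\<lambda>Q. wigD s l Q m n) \<in> borel_measurable borel"
proof -
  interpret sb: finite_measure sphere_borel by (rule finite_measure_sphere_borel)
  define f where "f Q p = cnj (spinY s l n p) * spinF s l m (Q ** frame p)" for Q p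
  have "continuous_on UNIV (\<lambda>z. f (fst z) (snd z))"
    unfolding f_def
    by (intro continuous_intros continuous_on_spinF_mult continuous_on_compose2[OF continuous_on_spinY[of UNIV]] subset_UNIV)
  then have 1: "(\<lambda>z. f (fst z) (snd z)) \<in> borel_measurable (borel \<Otimes>\<^sub>M borel)"
    unfolding borel_prod by (rule borel_measurable_continuous_onI)
  have 2: "(\<lambda>z. (fst z, snd z)) \<in> measurable (borel \<Otimes>\<^sub>M sphere_borel) (borel \<Otimes>\<^sub>M borel)"
    by (intro measurable_Pair measurable_fst measurable_compose[OF measurable_snd] measurable_sphere_borel) auto
  have "(\<lambda>z. f (fst z) (snd z)) \<in> borel_measurable (borel \<Otimes>\<^sub>M sphere_borel)"
    using measurable_compose[OF 2 1] by simp
  then have "(\<lambda>Q. LINT p|sphere_borel. f Q p) \<in> borel_measurable borel"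
    by (intro sb.borel_measurable_lebesgue_integral) (simp add: case_prod_beta')
  moreover have "(LINT p|sphere_borel. f Q p) = wigD s l Q m n" for Q
    unfolding wigD_def sphere_inner_def f_def
    by (intro integral_sphere_borel[symmetric] measurable_sphere_borel borel_measurable_continuous_onI continuous_intros
        continuous_on_spinY continuous_on_spinF_frame)
  ultimately show ?thesis by simp
qed

section \<open>Completeness of the harmonics\<close>

lemma coeff_halfA_power: "coeff (halfA t ^ p) i = of_nat (p choose i) * cos (t / 2) ^ i * sin (t / 2) ^ (p - i)"
  using wig_q0[of p i t] unfolding wig_def power_0 mult_1_right .

lemma coeff_halfB_power: "coeff (halfB t ^ q) j = of_nat (q choose j) * (- sin (t / 2)) ^ j * cos (t / 2) ^ (q - j)"
proof (cases "j \<le> q")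
  case True
  then show ?thesis unfolding halfB_def by (simp add: coeff_linear_poly_power)
next
  case False
  have "degree (halfB t ^ q) \<le> q"
    using degree_power_le[of "halfB t" q] by (auto simp: halfB_def intro: le_trans split: if_splits)
  with False show ?thesis by (simp add: coeff_eq_0 binomial_eq_0)
qed

text \<open>In the binomial expansion the exponents of sin (t/2) have the same parity in all
  summands, and likewise those of cos (t/2). After the lowest powers are split off, only squares
  remain, which are linear in cos t. J is a Jacobi polynomial up to a constant.\<close>

lemma wig_jacobi:
  obtains J :: "real poly" where "degree J \<le> min p k - (k - q)"
    "\<And>t. wig p q k t = sin (t / 2) ^ (max p k - min p k) * cos (t / 2) ^ (max q k - min q k) * poly J (cos t)"
proof
  \<comment> \<open>The indices for which both binomial coefficients are nonzero; the lower end is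
    truncated at 0.\<close>
  define I where "I = {k - q..min p k}"
  define c where "c i = real (p choose i) * real (q choose (k - i)) * (-1) ^ (k - i)" for i
  define J where "J = (\<Sum>i\<in>I. smult (c i) ([:1/2, -1/2:] ^ (min p k - i) * [:1/2, 1/2:] ^ (i - (k - q))))"
  show "degree J \<le> min p k - (k - q)"
    unfolding J_def
  proof (rule degree_sum_le)
    fix i assume i: "i \<in> I"
    have "degree ([:1/2, -1/2 :: real:] ^ u) \<le> u" "degree ([:1/2, 1/2 :: real:] ^ u) \<le> u" for u
      using degree_power_le[of "[:1/2, -1/2 :: real:]" u] degree_power_le[of "[:1/2, 1/2 :: real:]" u] by simp_all
    then have "degree ([:1/2, -1/2 :: real:] ^ (min p k - i) * [:1/2, 1/2:] ^ (i - (k - q))) \<le> (min p k - i) + (i - (k - q))"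
      by (intro order_trans[OF degree_mult_le] add_mono)
    also have "\<dots> = min p k - (k - q)" using i by (auto simp: I_def)
    finally show "degree (smult (c i) ([:1/2, -1/2:] ^ (min p k - i) * [:1/2, 1/2:] ^ (i - (k - q)))) \<le> min p k - (k - q)"
      using degree_smult_le order_trans by blast
  qed (simp add: I_def)
  fix t :: real
  define S C where "S = sin (t / 2)" and "C = cos (t / 2)"
  have sq: "poly [:1/2, -1/2:] (cos t) = S\<^sup>2" "poly [:1/2, 1/2:] (cos t) = C\<^sup>2"
    by (simp_all add: S_def C_def sin_half_squared cos_half_squared)
  have "wig p q k t = (\<Sum>i\<le>k. c i * (C ^ i * S ^ (p - i)) * (S ^ (k - i) * C ^ (q - (k - i))))"
    unfolding wig_def coeff_mult coeff_halfA_power coeff_halfB_power c_def S_def C_def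
    by (intro sum.cong) (auto simp: power_minus[of "sin (t / 2)"])
  also have "\<dots> = (\<Sum>i\<in>I. c i * (C ^ i * S ^ (p - i)) * (S ^ (k - i) * C ^ (q - (k - i))))"
    by (rule sum.mono_neutral_right) (auto simp: I_def c_def not_le binomial_eq_0)
  also have "\<dots> = (\<Sum>i\<in>I. S ^ (max p k - min p k) * C ^ (max q k - min q k) * (c i * (S\<^sup>2 ^ (min p k - i) * C\<^sup>2 ^ (i - (k - q)))))"
  proof (rule sum.cong[OF refl])
    fix i assume "i \<in> I"
    then have i: "i \<le> p" "i \<le> k" "k \<le> q + i" by (auto simp: I_def)
    have "(p - i) + (k - i) = (max p k - min p k) + 2 * (min p k - i)" using i by (auto simp: max_def min_def)
    then have 1: "S ^ (p - i) * S ^ (k - i) = S ^ (max p k - min p k) * (S\<^sup>2) ^ (min p k - i)"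
      by (simp only: power_add[symmetric] power_mult[symmetric])
    have "i + (q - (k - i)) = (max q k - min q k) + 2 * (i - (k - q))" using i by (auto simp: max_def min_def)
    then have 2: "C ^ i * C ^ (q - (k - i)) = C ^ (max q k - min q k) * (C\<^sup>2) ^ (i - (k - q))"
      by (simp only: power_add[symmetric] power_mult[symmetric])
    have "c i * (C ^ i * S ^ (p - i)) * (S ^ (k - i) * C ^ (q - (k - i))) = c i * (S ^ (p - i) * S ^ (k - i)) * (C ^ i * C ^ (q - (k - i)))"
      by (simp add: mult_ac)
    also have "\<dots> = S ^ (max p k - min p k) * C ^ (max q k - min q k) * (c i * ((S\<^sup>2) ^ (min p k - i) * (C\<^sup>2) ^ (i - (k - q))))"
      unfolding 1 2 by (simp add: mult_ac)
    finally show "c i * (C ^ i * S ^ (p - i)) * (S ^ (k - i) * C ^ (q - (k - i))) = S ^ (max p k - min p k) * C ^ (max q k - min q k) * (c i * ((S\<^sup>2) ^ (min p k - i) * (C\<^sup>2) ^ (i - (k - q))))" .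
  qed
  also have "\<dots> = S ^ (max p k - min p k) * C ^ (max q k - min q k) * poly J (cos t)"
    unfolding J_def poly_sum sum_distrib_left poly_smult poly_mult poly_power sq ..
  finally show "wig p q k t = sin (t / 2) ^ (max p k - min p k) * cos (t / 2) ^ (max q k - min q k) * poly J (cos t)"
    by (simp add: S_def C_def)
qed

definition spin_wig :: "int \<Rightarrow> int \<Rightarrow> nat \<Rightarrow> real \<Rightarrow> real" where
  "spin_wig s m l = wig (nat (int l + s)) (nat (int l - s)) (nat (int l - m))"

text \<open>The vanishing orders at the two poles, which all degrees l share. The function has no
  zero strictly between the poles.\<close>

definition spin_weight :: "int \<Rightarrow> int \<Rightarrow> real \<Rightarrow> real" where
  "spin_weight s m t = sin (t / 2) ^ nat \<bar>s + m\<bar> * cos (t / 2) ^ nat \<bar>m - s\<bar>"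

lemma spin_wig_jacobi:
  assumes "\<bar>m\<bar> \<le> int l" "\<bar>s\<bar> \<le> int l"
  obtains J :: "real poly" where "degree J \<le> l - nat (max \<bar>m\<bar> \<bar>s\<bar>)"
    "\<And>t. spin_wig s m l t = spin_weight s m t * poly J (cos t)"
proof -
  define p q k where "p = nat (int l + s)" and "q = nat (int l - s)" and "k = nat (int l - m)"
  have i: "int p = int l + s" "int q = int l - s" "int k = int l - m" using assms by (auto simp: p_def q_def k_def)
  obtain J where J: "degree J \<le> min p k - (k - q)"
    "\<And>t. wig p q k t = sin (t / 2) ^ (max p k - min p k) * cos (t / 2) ^ (max q k - min q k) * poly J (cos t)"
    using wig_jacobi[of p k q] by blast
  have mm: "int (max x y - min x y) = \<bar>int x - int y\<bar>" for x y by (auto simp: max_def min_def)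
  have "int (max p k - min p k) = \<bar>s + m\<bar>" "int (max q k - min q k) = \<bar>m - s\<bar>"
    unfolding mm i by simp_all
  then have "max p k - min p k = nat \<bar>s + m\<bar>" "max q k - min q k = nat \<bar>m - s\<bar>"
    by (metis nat_int)+
  moreover have "min p k - (k - q) = l - nat (max \<bar>m\<bar> \<bar>s\<bar>)"
  proof -
    define M where "M = nat (max \<bar>m\<bar> \<bar>s\<bar>)"
    have M: "int M = max \<bar>m\<bar> \<bar>s\<bar>" by (simp add: M_def)
    consider "m \<le> - s" "s \<le> m" | "m \<le> - s" "m < s" | "- s < m" "s \<le> m" | "- s < m" "m < s" by linarith
    then have "min p k - (k - q) = l - M"
    proof cases
      case 1
      then have *: "int M = - s" "p \<le> k" "k \<le> q" using M i by (auto simp: max_def)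
      then have "p = l - M" using i(1) by linarith
      then show ?thesis using *(2,3) by (simp only: min_absorb1 diff_is_0_eq' diff_zero)
    next
      case 2
      then have *: "int M = - m" "p \<le> k" "q < k" using M i by (auto simp: max_def)
      then have "p - (k - q) = l - M" using i by linarith
      then show ?thesis using *(2) by (simp only: min_absorb1)
    next
      case 3
      then have *: "int M = m" "k \<le> p" "k \<le> q" using M i by (auto simp: max_def)
      then have "k = l - M" using i(3) by linarith
      then show ?thesis using *(2,3) by (simp only: min_absorb2 diff_is_0_eq' diff_zero)
    next
      case 4
      then have *: "int M = s" "k \<le> p" "q < k" using M i by (auto simp: max_def)
      then have "k - (k - q) = l - M" using i by linarith
      then show ?thesis using *(2) by (simp only: min_absorb2)
    qed
    then show ?thesis by (simp add: M_def)
  qed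
  ultimately have e: "max p k - min p k = nat \<bar>s + m\<bar>" "max q k - min q k = nat \<bar>m - s\<bar>" "min p k - (k - q) = l - nat (max \<bar>m\<bar> \<bar>s\<bar>)"
    by blast+
  show ?thesis
  proof (rule that)
    show "degree J \<le> l - nat (max \<bar>m\<bar> \<bar>s\<bar>)" using J(1) unfolding e(3) .
    show "spin_wig s m l t = spin_weight s m t * poly J (cos t)" for t
      using J(2)[of t, unfolded e] unfolding spin_wig_def spin_weight_def p_def q_def k_def .
  qed
qed

lemma spin_wig_inner:
  assumes "\<bar>m\<bar> \<le> int l" "\<bar>s\<bar> \<le> int l" "\<bar>m\<bar> \<le> int l'" "\<bar>s\<bar> \<le> int l'"
  shows "l \<noteq> l' \<Longrightarrow> integral {0..pi} (\<lambda>t. spin_wig s m l t * spin_wig s m l' t * sin t) = 0"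
    and "integral {0..pi} (\<lambda>t. spin_wig s m l t * spin_wig s m l t * sin t) \<noteq> 0"
proof -
  define p q k p' q' k' where "p = nat (int l + s)" and "q = nat (int l - s)" and "k = nat (int l - m)"
    and "p' = nat (int l' + s)" and "q' = nat (int l' - s)" and "k' = nat (int l' - m)"
  note pq = p_def q_def k_def p'_def q'_def k'_def
  have i: "int p = int l + s" "int q = int l - s" "int k = int l - m" "int p' = int l' + s" "int q' = int l' - s" "int k' = int l' - m"
    using assms by (auto simp: pq)
  show "integral {0..pi} (\<lambda>t. spin_wig s m l t * spin_wig s m l' t * sin t) = 0" if "l \<noteq> l'"
  proof -
    have "wig_inner p q k p' q' k' = 0"
      by (rule wig_inner_orthogonal) (use that i in linarith)+
    then show ?thesis by (simp add: wig_inner_def spin_wig_def pq)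
  qed
  have "k \<le> p + q" using i assms by linarith
  from wig_inner_norm[OF this] have "wig_inner p q k p q k \<noteq> 0" by simp
  then show "integral {0..pi} (\<lambda>t. spin_wig s m l t * spin_wig s m l t * sin t) \<noteq> 0"
    by (simp add: wig_inner_def spin_wig_def pq)
qed

text \<open>
  Orthogonality forces the polynomial factors to have exact degree, so that they span all polynomials.
\<close>

lemma spin_wig_span:
  fixes m s :: int
  defines "l0 \<equiv> nat (max \<bar>m\<bar> \<bar>s\<bar>)"
  assumes "\<And>i. i \<ge> d \<Longrightarrow> coeff P i = 0"
  shows "\<exists>a. \<forall>t. spin_weight s m t * poly P (cos t) = (\<Sum>j<d. a j * spin_wig s m (l0 + j) t)"
  using assms(2)
proof (induction d arbitrary: P)
  case 0
  then have "P = 0" by (simp add: poly_eq_iff)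
  then show ?case by simp
next
  case (Suc d)
  have l0: "\<bar>m\<bar> \<le> int (l0 + j)" "\<bar>s\<bar> \<le> int (l0 + j)" for j by (auto simp: l0_def)
  obtain J where J: "degree J \<le> l0 + d - nat (max \<bar>m\<bar> \<bar>s\<bar>)"
    "\<And>t. spin_wig s m (l0 + d) t = spin_weight s m t * poly J (cos t)"
    using spin_wig_jacobi[OF l0, of d] by blast
  have dJ: "degree J \<le> d" using J(1) by (simp add: l0_def)
  have "coeff J d \<noteq> 0"
  proof
    \<comment> \<open>If the degree dropped, the new function would be a combination of those of
      smaller l. Being orthogonal to all of them, it would be orthogonal to itself.\<close>
    assume 0: "coeff J d = 0"
    have "coeff J i = 0" if "i \<ge> d" for i
      using 0 dJ that by (cases "i = d") (auto simp: coeff_eq_0)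
    then obtain a where a: "\<And>t. spin_weight s m t * poly J (cos t) = (\<Sum>j<d. a j * spin_wig s m (l0 + j) t)"
      using Suc.IH by blast
    have eq: "(\<lambda>t. spin_wig s m (l0 + d) t * spin_wig s m (l0 + d) t * sin t) = 
        (\<lambda>t. \<Sum>j<d. a j * (spin_wig s m (l0 + j) t * spin_wig s m (l0 + d) t * sin t))"
    proof
      fix t
      have e: "spin_wig s m (l0 + d) t = (\<Sum>j<d. a j * spin_wig s m (l0 + j) t)" using a J(2) by simp
      show "spin_wig s m (l0 + d) t * spin_wig s m (l0 + d) t * sin t = 
        (\<Sum>j<d. a j * (spin_wig s m (l0 + j) t * spin_wig s m (l0 + d) t * sin t))"
      proof -
        have "spin_wig s m (l0 + d) t * spin_wig s m (l0 + d) t * sin t =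
          (\<Sum>j<d. a j * spin_wig s m (l0 + j) t) * (spin_wig s m (l0 + d) t * sin t)"
          by (simp only: e[symmetric] mult.assoc)
        then show ?thesis by (simp add: sum_distrib_right mult.assoc)
      qed
    qed
    have "integral {0..pi} (\<lambda>t. spin_wig s m (l0 + d) t * spin_wig s m (l0 + d) t * sin t) = (\<Sum>j<d. integral {0..pi} (\<lambda>t. a j * (spin_wig s m (l0 + j) t * spin_wig s m (l0 + d) t * sin t)))"
      unfolding eq unfolding spin_wig_def
      by (rule Henstock_Kurzweil_Integration.integral_sum) (auto intro!: integrable_continuous_interval continuous_intros)
    also have "\<dots> = 0"
      using spin_wig_inner(1)[OF l0 l0] by simp
    finally show False using spin_wig_inner(2)[OF l0 l0] by simp
  qed
  define r where "r = coeff P d / coeff J d"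
  have "coeff (P - smult r J) i = 0" if "i \<ge> d" for i
    using \<open>coeff J d \<noteq> 0\<close> dJ that Suc.prems[of i]
    by (cases "i = d") (auto simp: coeff_eq_0 r_def)
  then obtain a where a: "\<And>t. spin_weight s m t * poly (P - smult r J) (cos t) = (\<Sum>j<d. a j * spin_wig s m (l0 + j) t)"
    using Suc.IH by blast
  have "spin_weight s m t * poly P (cos t) = (\<Sum>j<Suc d. (a(d := r)) j * spin_wig s m (l0 + j) t)" for t
    using a[of t] J(2)[of t] by (simp add: algebra_simps)
  then show ?case by blast
qed

section \<open>The closure of the span of the harmonics\<close>

lemma sphere_norm2_add_le:
  assumes "f \<in> L2_sphere" "g \<in> L2_sphere"
  shows "sphere_norm2 (\<lambda>p. f p + g p) \<le> 2 * sphere_norm2 f + 2 * sphere_norm2 g"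
proof -
  have "(cmod (a + b))\<^sup>2 \<le> 2 * (cmod a)\<^sup>2 + 2 * (cmod b)\<^sup>2" for a b
    using power_mono[OF norm_triangle_ineq[of a b], of 2] sum_squares_bound[of "cmod a" "cmod b"]
    by (simp add: power2_sum)
  then have "sphere_norm2 (\<lambda>p. f p + g p) \<le> (LINT p|sphere_measure. 2 * (cmod (f p))\<^sup>2 + 2 * (cmod (g p))\<^sup>2)"
    unfolding sphere_norm2_def
    using assms by (intro integral_mono L2_sphereD(2) L2_sphere_add Bochner_Integration.integrable_add integrable_mult_right)
  also have "\<dots> = 2 * sphere_norm2 f + 2 * sphere_norm2 g"
    unfolding sphere_norm2_def using L2_sphereD(2)[OF assms(1)] L2_sphereD(2)[OF assms(2)] by simp
  finally show ?thesis .
qed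

lemma sphere_norm2_cmult: "sphere_norm2 (\<lambda>p. c * f p) = (cmod c)\<^sup>2 * sphere_norm2 f"
  unfolding sphere_norm2_def by (simp add: norm_mult power_mult_distrib)

inductive_set spin_span :: "int \<Rightarrow> (real \<times> real \<Rightarrow> complex) set" for s where
  spin_span_zero: "(\<lambda>_. 0) \<in> spin_span s"
| spin_span_add: "h \<in> spin_span s \<Longrightarrow> \<bar>m\<bar> \<le> int l \<Longrightarrow> \<bar>s\<bar> \<le> int l \<Longrightarrow> (\<lambda>p. h p + c * spinY s l m p) \<in> spin_span s"

lemma spin_span_L2: "h \<in> spin_span s \<Longrightarrow> h \<in> L2_sphere"
  by (induction rule: spin_span.induct) (auto intro: L2_sphere_zero L2_sphere_add[OF _ L2_sphere_cmult[OF L2_spinY]])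

lemma spin_span_plus: "h \<in> spin_span s \<Longrightarrow> g \<in> spin_span s \<Longrightarrow> (\<lambda>p. g p + h p) \<in> spin_span s"
  by (induction rule: spin_span.induct) (auto simp: add.assoc[symmetric] intro: spin_span_add)

lemma spin_span_cmult: "h \<in> spin_span s \<Longrightarrow> (\<lambda>p. a * h p) \<in> spin_span s"
proof (induction rule: spin_span.induct)
  case (spin_span_add h m l c)
  then show ?case using spin_span.spin_span_add[of "\<lambda>p. a * h p" s m l "a * c"] by (simp add: distrib_left mult.assoc)
qed (simp add: spin_span_zero)

definition spin_dense :: "int \<Rightarrow> (real \<times> real \<Rightarrow> complex) \<Rightarrow> bool" where
  "spin_dense s f \<longleftrightarrow> f \<in> L2_sphere \<and> (\<forall>e>0. \<exists>h\<in>spin_span s. sphere_norm2 (\<lambda>p. f p - h p) < e)"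

lemma spin_dense_span: "h \<in> spin_span s \<Longrightarrow> spin_dense s h"
  unfolding spin_dense_def by (auto intro!: bexI[of _ h] spin_span_L2 simp: sphere_norm2_def)

lemma spin_dense_limit:
  assumes f: "f \<in> L2_sphere" and ex: "\<And>e. e > 0 \<Longrightarrow> \<exists>g. spin_dense s g \<and> sphere_norm2 (\<lambda>p. f p - g p) < e"
  shows "spin_dense s f"
  unfolding spin_dense_def
proof (intro conjI allI impI f)
  fix e :: real assume "e > 0"
  then obtain g where g: "spin_dense s g" "sphere_norm2 (\<lambda>p. f p - g p) < e / 4" using ex[of "e / 4"] by auto
  then obtain h where h: "h \<in> spin_span s" "sphere_norm2 (\<lambda>p. g p - h p) < e / 4"
    using \<open>e > 0\<close> unfolding spin_dense_def by (meson zero_less_divide_iff zero_less_numeral)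
  have gL: "g \<in> L2_sphere" using g by (simp add: spin_dense_def)
  have "sphere_norm2 (\<lambda>p. (f p - g p) + (g p - h p)) \<le> 2 * sphere_norm2 (\<lambda>p. f p - g p) + 2 * sphere_norm2 (\<lambda>p. g p - h p)"
    by (intro sphere_norm2_add_le L2_sphere_diff f gL spin_span_L2[OF h(1)])
  then show "\<exists>h\<in>spin_span s. sphere_norm2 (\<lambda>p. f p - h p) < e"
    using g h by (intro bexI[OF _ h(1)]) simp
qed

lemma spin_dense_add:
  assumes "spin_dense s f" "spin_dense s g"
  shows "spin_dense s (\<lambda>p. f p + g p)"
  unfolding spin_dense_def
proof (intro conjI allI impI)
  have fg: "f \<in> L2_sphere" "g \<in> L2_sphere" using assms by (auto simp: spin_dense_def)
  then show "(\<lambda>p. f p + g p) \<in> L2_sphere" by (rule L2_sphere_add)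
  fix e :: real assume "e > 0"
  then have "e / 4 > 0" by simp
  then obtain h k where hk: "h \<in> spin_span s" "sphere_norm2 (\<lambda>p. f p - h p) < e / 4" "k \<in> spin_span s" "sphere_norm2 (\<lambda>p. g p - k p) < e / 4"
    using assms unfolding spin_dense_def by meson
  have "sphere_norm2 (\<lambda>p. (f p - h p) + (g p - k p)) \<le> 2 * sphere_norm2 (\<lambda>p. f p - h p) + 2 * sphere_norm2 (\<lambda>p. g p - k p)"
    by (intro sphere_norm2_add_le L2_sphere_diff fg spin_span_L2[OF hk(1)] spin_span_L2[OF hk(3)])
  then have "sphere_norm2 (\<lambda>p. (f p + g p) - (h p + k p)) < e"
    using hk by (simp add: algebra_simps)
  then show "\<exists>h\<in>spin_span s. sphere_norm2 (\<lambda>p. (f p + g p) - h p) < e"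
    by (rule bexI[OF _ spin_span_plus[OF hk(3,1)]])
qed

lemma spin_dense_cmult:
  assumes "spin_dense s f"
  shows "spin_dense s (\<lambda>p. c * f p)"
proof (cases "c = 0")
  case True
  then show ?thesis by (simp add: spin_dense_span spin_span_zero)
next
  case False
  show ?thesis
    unfolding spin_dense_def
  proof (intro conjI allI impI)
    show "(\<lambda>p. c * f p) \<in> L2_sphere" using assms by (auto simp: spin_dense_def intro: L2_sphere_cmult)
    fix e :: real assume "e > 0"
    then have "e / (cmod c)\<^sup>2 > 0" using False by simp
    then obtain h where h: "h \<in> spin_span s" "sphere_norm2 (\<lambda>p. f p - h p) < e / (cmod c)\<^sup>2"
      using assms unfolding spin_dense_def by meson
    then have "sphere_norm2 (\<lambda>p. c * (f p - h p)) < e"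
      using False unfolding sphere_norm2_cmult by (simp add: field_simps)
    then show "\<exists>h\<in>spin_span s. sphere_norm2 (\<lambda>p. c * f p - h p) < e"
      using spin_span_cmult[OF h(1), of c] by (auto simp: right_diff_distrib)
  qed
qed

lemma spin_dense_dominated:
  assumes g: "\<And>n. spin_dense s (g n)" and f: "f \<in> L2_sphere"
    and w: "integrable sphere_measure (\<lambda>p. (w p)\<^sup>2)" "\<And>n. AE p in sphere_measure. cmod (g n p) \<le> w p" "AE p in sphere_measure. cmod (f p) \<le> w p"
    and lim: "AE p in sphere_measure. (\<lambda>n. g n p) \<longlonglongrightarrow> f p"
  shows "spin_dense s f"
proof (rule spin_dense_limit[OF f])
  have gL: "g n \<in> L2_sphere" for n using g[of n] by (simp add: spin_dense_def)
  have dL: "(\<lambda>p. f p - g n p) \<in> L2_sphere" for n by (intro L2_sphere_diff f gL)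
  have "(\<lambda>n. LINT p|sphere_measure. (cmod (f p - g n p))\<^sup>2) \<longlonglongrightarrow> (LINT p|sphere_measure. (0 :: real))"
  proof (rule integral_dominated_convergence[where w = "\<lambda>p. 4 * (w p)\<^sup>2"])
    show "(\<lambda>p. (cmod (f p - g n p))\<^sup>2) \<in> borel_measurable sphere_measure" for n
      using L2_sphereD(2)[OF dL] by (rule borel_measurable_integrable)
    show "AE p in sphere_measure. (\<lambda>n. (cmod (f p - g n p))\<^sup>2) \<longlonglongrightarrow> 0"
      using lim
    proof eventually_elim
      case (elim p)
      then have "(\<lambda>n. (cmod (f p - g n p))\<^sup>2) \<longlonglongrightarrow> (cmod (f p - f p))\<^sup>2" by (intro tendsto_intros)
      then show ?case by simp
    qed
    show "AE p in sphere_measure. norm ((cmod (f p - g n p))\<^sup>2) \<le> 4 * (w p)\<^sup>2" for n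
      using w(2)[of n] w(3)
    proof eventually_elim
      case (elim p)
      then have "cmod (f p - g n p) \<le> 2 * w p" using norm_triangle_ineq4[of "f p" "g n p"] by linarith
      from power_mono[OF this, of 2] show ?case by (simp add: power_mult_distrib)
    qed
  qed (use w(1) in auto)
  then have "(\<lambda>n. sphere_norm2 (\<lambda>p. f p - g n p)) \<longlonglongrightarrow> 0" by (simp add: sphere_norm2_def)
  then show "\<exists>h. spin_dense s h \<and> sphere_norm2 (\<lambda>p. f p - h p) < e" if "e > 0" for e
    using eventually_happens'[OF sequentially_bot order_tendstoD(2)[OF _ that]] g by blast
qed

lemma spin_dense_uniform:
  assumes f: "f \<in> L2_sphere" and ex: "\<And>d. d > 0 \<Longrightarrow> \<exists>g. spin_dense s g \<and> (AE p in sphere_measure. cmod (f p - g p) \<le> d)"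
  shows "spin_dense s f"
proof (rule spin_dense_limit[OF f])
  fix e :: real assume e: "e > 0"
  define S where "S = measure sphere_measure (space sphere_measure) + 1"
  have S: "S > 0" by (simp add: S_def add_nonneg_pos)
  define d where "d = sqrt (e / S)"
  have d: "d > 0" "d\<^sup>2 = e / S" using e S by (auto simp: d_def)
  obtain g where g: "spin_dense s g" "AE p in sphere_measure. cmod (f p - g p) \<le> d" using ex[OF d(1)] by blast
  have gL: "g \<in> L2_sphere" using g by (simp add: spin_dense_def)
  have "sphere_norm2 (\<lambda>p. f p - g p) \<le> (LINT p|sphere_measure. d\<^sup>2)"
    unfolding sphere_norm2_def
  proof (rule integral_mono_AE)
    show "integrable sphere_measure (\<lambda>p. (cmod (f p - g p))\<^sup>2)" by (intro L2_sphereD(2) L2_sphere_diff f gL)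
    show "AE p in sphere_measure. (cmod (f p - g p))\<^sup>2 \<le> d\<^sup>2"
      using g(2) by eventually_elim (auto intro: power_mono)
  qed simp
  also have "\<dots> = (S - 1) * (e / S)" by (simp add: S_def d)
  also have "\<dots> < S * (e / S)" using e S by (intro mult_strict_right_mono) auto
  finally show "\<exists>g. spin_dense s g \<and> sphere_norm2 (\<lambda>p. f p - g p) < e" using g S by auto
qed

lemma spin_dense_sum: "(\<And>i. i \<in> I \<Longrightarrow> spin_dense s (f i)) \<Longrightarrow> spin_dense s (\<lambda>p. \<Sum>i\<in>I. f i p)"
  by (induction I rule: infinite_finite_induct) (auto intro: spin_dense_add spin_dense_span spin_span_zero)

lemma spin_dense_spinY: "\<bar>m\<bar> \<le> int l \<Longrightarrow> \<bar>s\<bar> \<le> int l \<Longrightarrow> spin_dense s (spinY s l m)"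
  using spin_span_add[OF spin_span_zero, of m l s 1] by (auto intro: spin_dense_span)

lemma spin_dense_weight:
  "spin_dense s (\<lambda>p. of_real (spin_weight s m (fst p) * poly P (cos (fst p))) * exp (\<i> * of_int m * of_real (snd p)))"
proof -
  define l0 where "l0 = nat (max \<bar>m\<bar> \<bar>s\<bar>)"
  have l0: "\<bar>m\<bar> \<le> int (l0 + j)" "\<bar>s\<bar> \<le> int (l0 + j)" for j by (auto simp: l0_def)
  obtain a where a: "\<And>t. spin_weight s m t * poly P (cos t) = (\<Sum>j<Suc (degree P). a j * spin_wig s m (l0 + j) t)"
    using spin_wig_span[of "Suc (degree P)" P s m] unfolding l0_def by (auto simp: coeff_eq_0)
  have "spin_dense s (\<lambda>p. \<Sum>j<Suc (degree P). of_real (a j / spin_amp s (l0 + j) m) * spinY s (l0 + j) m p)"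
    by (intro spin_dense_sum spin_dense_cmult spin_dense_spinY l0)
  moreover have "of_real (a j / spin_amp s (l0 + j) m) * spinY s (l0 + j) m p = of_real (a j * spin_wig s m (l0 + j) (fst p)) * exp (\<i> * of_int m * of_real (snd p))" for j p
    using spin_amp_nonzero[OF l0(2,1), of j] by (simp add: spinY_def spin_wig_def)
  ultimately show ?thesis unfolding a of_real_sum sum_distrib_right by (simp only:)
qed

lemma spin_weight_bounds: "\<bar>spin_weight s m t\<bar> \<le> 1"
  unfolding spin_weight_def abs_mult power_abs by (intro mult_le_one power_le_one) auto

lemma continuous_on_spin_weight [continuous_intros]:
  fixes f :: "'z :: t2_space \<Rightarrow> real"
  assumes "continuous_on T f"
  shows "continuous_on T (\<lambda>x. spin_weight s m (f x))"
  unfolding spin_weight_def by (intro continuous_intros assms) auto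

lemma continuous_imp_poly_approx:
  assumes "continuous_on {-1..1} h" "e > 0"
  obtains P :: "real poly" where "\<And>x. x \<in> {-1..1} \<Longrightarrow> \<bar>h x - poly P x\<bar> < e"
proof -
  obtain g where g: "real_polynomial_function g" "\<And>x. x \<in> {-1..1} \<Longrightarrow> \<bar>h x - g x\<bar> < e"
    using Stone_Weierstrass_real_polynomial_function[OF _ assms] by auto
  obtain a n where "g = (\<lambda>x. \<Sum>i\<le>n. a i * x ^ i)" using g(1) real_polynomial_function_iff_sum by blast
  then have "g x = poly (\<Sum>i\<le>n. monom (a i) i) x" for x by (simp add: poly_sum poly_monom)
  with g(2) have "\<And>x. x \<in> {-1..1} \<Longrightarrow> \<bar>h x - poly (\<Sum>i\<le>n. monom (a i) i) x\<bar> < e" by (simp only:)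
  then show ?thesis by (rule that)
qed

text \<open>
  The weight may vanish at the poles, hence t is approximated by \<open>t w^2 / (w^2 + e)\<close>, where the second
  factor w is replaced by a polynomial in the cosine.
\<close>

lemma spin_dense_mode:
  assumes t: "continuous_on UNIV t"
  shows "spin_dense s (\<lambda>p. of_real (t (fst p)) * exp (\<i> * of_int m * of_real (snd p)))"
proof -
  define w where "w = spin_weight s m"
  \<comment> \<open>The positive summand keeps \<open>v n\<close> continuous at the poles, so that
    it is a uniform limit of polynomials in the cosine. The other factor w is left in place, as
    \<open>spin_dense_weight\<close> requires it.\<close>
  define v where "v n x = t x * w x / ((w x)\<^sup>2 + 1 / (real n + 1))" for n x
  have pos: "(w x)\<^sup>2 + 1 / (real n + 1) > 0" for n x by (intro add_nonneg_pos) auto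
  have vc: "continuous_on T (v n)" for T n
    unfolding v_def w_def
    by (intro continuous_intros continuous_on_subset[OF t]) (use pos in \<open>auto simp: w_def less_imp_neq[symmetric]\<close>)
  have L2: "(\<lambda>p. of_real (f (fst p)) * exp (\<i> * of_int m * of_real (snd p))) \<in> L2_sphere" if "continuous_on UNIV f" for f
    by (intro L2_sphere_continuous continuous_intros continuous_on_compose2[OF that] subset_UNIV)
  have wc: "continuous_on T w" for T unfolding w_def by (intro continuous_intros)
  have norm_e: "cmod (of_real x * exp (\<i> * of_int m * of_real y)) = \<bar>x\<bar>" for x y
    by (simp add: norm_mult norm_exp_eq_Re)
  have dense: "spin_dense s (\<lambda>p. of_real (w (fst p) * v n (fst p)) * exp (\<i> * of_int m * of_real (snd p)))" for n
  proof (rule spin_dense_uniform)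
    show "(\<lambda>p. of_real (w (fst p) * v n (fst p)) * exp (\<i> * of_int m * of_real (snd p))) \<in> L2_sphere"
      by (rule L2[of "\<lambda>x. w x * v n x"]) (intro continuous_intros wc vc)
    fix d :: real assume d: "d > 0"
    have "continuous_on {-1..1} (\<lambda>x. v n (arccos x))"
      by (intro continuous_on_compose2[OF vc[of UNIV]] continuous_on_arccos' subset_UNIV)
    from continuous_imp_poly_approx[OF this d] obtain P where P: "\<And>x. x \<in> {-1..1} \<Longrightarrow> \<bar>v n (arccos x) - poly P x\<bar> < d" by blast
    have "AE p in sphere_measure. cmod (of_real (w (fst p) * v n (fst p)) * exp (\<i> * of_int m * of_real (snd p))
        - of_real (spin_weight s m (fst p) * poly P (cos (fst p))) * exp (\<i> * of_int m * of_real (snd p))) \<le> d"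
      using AE_sphere_interior
    proof eventually_elim
      case (elim p)
      then have "\<bar>v n (fst p) - poly P (cos (fst p))\<bar> \<le> d" using P[of "cos (fst p)"] by (simp add: arccos_cos less_imp_le)
      then have "\<bar>w (fst p)\<bar> * \<bar>v n (fst p) - poly P (cos (fst p))\<bar> \<le> 1 * d"
        unfolding w_def by (intro mult_mono spin_weight_bounds) auto
      moreover have "of_real (w (fst p) * v n (fst p)) * exp (\<i> * of_int m * of_real (snd p))
        - of_real (spin_weight s m (fst p) * poly P (cos (fst p))) * exp (\<i> * of_int m * of_real (snd p)) =
         of_real (w (fst p) * (v n (fst p) - poly P (cos (fst p)))) * exp (\<i> * of_int m * of_real (snd p))"
        by (simp add: w_def algebra_simps)
      ultimately show ?case by (simp only: norm_e abs_mult)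
    qed
    then show "\<exists>g. spin_dense s g \<and> (AE p in sphere_measure. cmod (of_real (w (fst p) * v n (fst p)) * exp (\<i> * of_int m * of_real (snd p)) - g p) \<le> d)"
      using spin_dense_weight by blast
  qed
  show ?thesis
  proof (rule spin_dense_dominated[OF dense L2[OF t], where w = "\<lambda>p. \<bar>t (fst p)\<bar>"])
    have "continuous_on UNIV (\<lambda>p :: real \<times> real. (\<bar>t (fst p)\<bar>)\<^sup>2)"
      by (intro continuous_intros continuous_on_compose2[OF t] subset_UNIV)
    then show "integrable sphere_measure (\<lambda>p. (\<bar>t (fst p)\<bar>)\<^sup>2)" by (rule sphere_integral_continuous(1))
    have "\<bar>w x * v n x\<bar> \<le> \<bar>t x\<bar>" for n x
    proof -
      have "w x * v n x = t x * ((w x)\<^sup>2 / ((w x)\<^sup>2 + 1 / (real n + 1)))" by (simp add: v_def power2_eq_square)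
      moreover have "\<bar>(w x)\<^sup>2 / ((w x)\<^sup>2 + 1 / (real n + 1))\<bar> \<le> 1" using pos[of x n] by simp
      ultimately show ?thesis
        using mult_left_mono[of "\<bar>(w x)\<^sup>2 / ((w x)\<^sup>2 + 1 / (real n + 1))\<bar>" 1 "\<bar>t x\<bar>"] by (simp only: abs_mult mult_1_right abs_ge_zero)
    qed
    then show "AE p in sphere_measure. cmod (of_real (w (fst p) * v n (fst p)) * exp (\<i> * of_int m * of_real (snd p))) \<le> \<bar>t (fst p)\<bar>" for n
      by (simp only: norm_e) simp
    show "AE p in sphere_measure. cmod (of_real (t (fst p)) * exp (\<i> * of_int m * of_real (snd p))) \<le> \<bar>t (fst p)\<bar>"
      by (simp only: norm_e) simp
    show "AE p in sphere_measure. (\<lambda>n. of_real (w (fst p) * v n (fst p)) * exp (\<i> * of_int m * of_real (snd p)))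
        \<longlonglongrightarrow> of_real (t (fst p)) * exp (\<i> * of_int m * of_real (snd p))"
      using AE_sphere_interior
    proof eventually_elim
      case (elim p)
      define x where "x = fst p"
      have "sin (x / 2) > 0" "cos (x / 2) > 0" using elim by (auto simp: x_def intro!: sin_gt_zero cos_gt_zero_pi)
      then have w0: "w x \<noteq> 0" by (simp add: w_def spin_weight_def)
      have "(\<lambda>n. 1 / (real n + 1)) \<longlonglongrightarrow> 0" using LIMSEQ_inverse_real_of_nat by (simp add: inverse_eq_divide add.commute)
      then have "(\<lambda>n. w x * (t x * w x / ((w x)\<^sup>2 + 1 / (real n + 1)))) \<longlonglongrightarrow> w x * (t x * w x / ((w x)\<^sup>2 + 0))"
        using w0 by (intro tendsto_intros) auto
      moreover have "w x * (t x * w x / ((w x)\<^sup>2 + 0)) = t x" using w0 by (simp add: power2_eq_square)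
      ultimately have "(\<lambda>n. w x * v n x) \<longlonglongrightarrow> t x" by (simp add: v_def)
      then show ?case unfolding x_def by (intro tendsto_mult tendsto_of_real tendsto_const)
    qed
  qed
qed


section \<open>From trigonometric modes to all square integrable functions\<close>

text \<open>This space is closed under products, which the span of the harmonics of a fixed weight s
  in general is not. It contains the coordinates of the point, hence all polynomials in
  them.\<close>

inductive_set trig_fun :: "(real \<times> real \<Rightarrow> complex) set" where
  trig_fun_zero: "(\<lambda>_. 0) \<in> trig_fun"
| trig_fun_add: "h \<in> trig_fun \<Longrightarrow> continuous_on UNIV t \<Longrightarrow>
    (\<lambda>p. h p + c * (of_real (t (fst p)) * exp (\<i> * of_int m * of_real (snd p)))) \<in> trig_fun"

lemma trig_fun_plus: "h \<in> trig_fun \<Longrightarrow> g \<in> trig_fun \<Longrightarrow> (\<lambda>p. g p + h p) \<in> trig_fun"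
  by (induction rule: trig_fun.induct) (auto simp: add.assoc[symmetric] intro: trig_fun_add)

lemma trig_fun_basic: "continuous_on UNIV t \<Longrightarrow> (\<lambda>p. c * (of_real (t (fst p)) * exp (\<i> * of_int m * of_real (snd p)))) \<in> trig_fun"
  using trig_fun_add[OF trig_fun_zero, of t c m] by simp

lemma trig_fun_mult_basic:
  "h \<in> trig_fun \<Longrightarrow> continuous_on UNIV t \<Longrightarrow> (\<lambda>p. h p * (c * (of_real (t (fst p)) * exp (\<i> * of_int m * of_real (snd p))))) \<in> trig_fun"
proof (induction rule: trig_fun.induct)
  case (trig_fun_add h t' c' m')
  have "(\<lambda>p. h p * (c * (of_real (t (fst p)) * exp (\<i> * of_int m * of_real (snd p))))
     + (c' * c) * (of_real (t' (fst p) * t (fst p)) * exp (\<i> * of_int (m' + m) * of_real (snd p)))) \<in> trig_fun"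
    using trig_fun_add by (intro trig_fun.trig_fun_add[where t = "\<lambda>x. t' x * t x"] continuous_intros) auto
  moreover have "exp (\<i> * of_int (m' + m) * of_real y) = exp (\<i> * of_int m' * of_real y) * exp (\<i> * of_int m * of_real y)" for y
    by (simp add: distrib_left distrib_right exp_add)
  moreover have "(\<lambda>p. h p * (c * (of_real (t (fst p)) * exp (\<i> * of_int m * of_real (snd p))))
     + (c' * c) * (of_real (t' (fst p) * t (fst p)) * (exp (\<i> * of_int m' * of_real (snd p)) * exp (\<i> * of_int m * of_real (snd p)))))
     = (\<lambda>p. (h p + c' * (of_real (t' (fst p)) * exp (\<i> * of_int m' * of_real (snd p)))) * (c * (of_real (t (fst p)) * exp (\<i> * of_int m * of_real (snd p)))))"
    by (rule ext) (simp add: algebra_simps)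
  ultimately show ?case by (simp only:)
qed (simp add: trig_fun_zero)

lemma trig_fun_mult: "h \<in> trig_fun \<Longrightarrow> g \<in> trig_fun \<Longrightarrow> (\<lambda>p. g p * h p) \<in> trig_fun"
proof (induction rule: trig_fun.induct)
  case (trig_fun_add h t c m)
  then show ?case
    using trig_fun_plus[OF trig_fun_mult_basic[of g t c m] trig_fun_add.IH] by (simp add: distrib_left)
qed (simp add: trig_fun_zero)

lemma trig_fun_sphere_point:
  "(\<lambda>p. of_real (sphere_point p $ 1)) \<in> trig_fun" "(\<lambda>p. of_real (sphere_point p $ 2)) \<in> trig_fun" "(\<lambda>p. of_real (sphere_point p $ 3)) \<in> trig_fun"
proof -
  have e: "exp (\<i> * of_int m * of_real x) = of_real (cos (of_int m * x)) + \<i> * of_real (sin (of_int m * x))" for m x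
    by (simp only: exp_eq_cis) (simp add: complex_eq_iff)
  have "(\<lambda>p. (- \<i> / 2) * (of_real (sin (fst p)) * exp (\<i> * of_int 1 * of_real (snd p)))
      + (\<i> / 2) * (of_real (sin (fst p)) * exp (\<i> * of_int (- 1) * of_real (snd p)))) \<in> trig_fun"
    by (intro trig_fun_plus trig_fun_basic continuous_intros)
  moreover have "(- \<i> / 2) * (of_real (sin (fst p)) * exp (\<i> * of_int 1 * of_real (snd p)))
      + (\<i> / 2) * (of_real (sin (fst p)) * exp (\<i> * of_int (- 1) * of_real (snd p))) = of_real (sphere_point p $ 2)" for p
    unfolding e by (simp add: complex_eq_iff)
  ultimately show "(\<lambda>p. of_real (sphere_point p $ 2)) \<in> trig_fun" by (simp only:)
  have "(\<lambda>p. (1 / 2) * (of_real (sin (fst p)) * exp (\<i> * of_int 1 * of_real (snd p)))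
      + (1 / 2) * (of_real (sin (fst p)) * exp (\<i> * of_int (- 1) * of_real (snd p)))) \<in> trig_fun"
    by (intro trig_fun_plus trig_fun_basic continuous_intros)
  moreover have "(1 / 2) * (of_real (sin (fst p)) * exp (\<i> * of_int 1 * of_real (snd p)))
      + (1 / 2) * (of_real (sin (fst p)) * exp (\<i> * of_int (- 1) * of_real (snd p))) = of_real (sphere_point p $ 1)" for p
    unfolding e by (simp add: complex_eq_iff)
  ultimately show "(\<lambda>p. of_real (sphere_point p $ 1)) \<in> trig_fun" by (simp only:)
  have "(\<lambda>p. 1 * (of_real (cos (fst p)) * exp (\<i> * of_int 0 * of_real (snd p)))) \<in> trig_fun"
    by (intro trig_fun_basic continuous_intros)
  then show "(\<lambda>p. of_real (sphere_point p $ 3)) \<in> trig_fun" by simp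
qed

lemma trig_fun_const: "(\<lambda>_. c) \<in> trig_fun"
  using trig_fun_basic[of "\<lambda>_. 1" c 0] by simp

lemma trig_fun_polynomial:
  assumes "real_polynomial_function (p :: real ^ 3 \<Rightarrow> real)"
  shows "(\<lambda>z. of_real (p (sphere_point z))) \<in> trig_fun"
  using assms
proof (induction rule: real_polynomial_function.induct)
  case (linear f)
  have lf: "linear f" using linear by (rule bounded_linear.linear)
  define a where "a = adjoint f 1"
  have "f x = x $ 1 * a $ 1 + x $ 2 * a $ 2 + x $ 3 * a $ 3" for x
    using adjoint_works[OF lf, of x 1] by (simp add: a_def inner_vec_def sum_3 mult.commute)
  then have "(\<lambda>z. complex_of_real (f (sphere_point z))) = (\<lambda>z. of_real (sphere_point z $ 1) * of_real (a $ 1)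
     + of_real (sphere_point z $ 2) * of_real (a $ 2) + of_real (sphere_point z $ 3) * of_real (a $ 3))"
    by (simp only: of_real_add of_real_mult)
  then show ?case
    by (simp only:) (intro trig_fun_plus trig_fun_mult trig_fun_sphere_point trig_fun_const)
qed (simp_all add: trig_fun_const trig_fun_plus trig_fun_mult)

lemma spin_dense_trig_fun: "h \<in> trig_fun \<Longrightarrow> spin_dense s h"
proof (induction rule: trig_fun.induct)
  case trig_fun_zero
  show ?case by (intro spin_dense_span spin_span_zero)
next
  case (trig_fun_add h t c m)
  then show ?case by (intro spin_dense_add spin_dense_cmult spin_dense_mode)
qed

lemma continuous_on_sphere_point_comp: "continuous_on UNIV h \<Longrightarrow> continuous_on UNIV (\<lambda>z. h (sphere_point z))"
  using continuous_on_compose2[of UNIV h UNIV sphere_point] continuous_on_sphere_point[of UNIV fst snd]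
  by (simp add: continuous_on_fst continuous_on_snd)

text \<open>Continuous functions of the point are reached for every s, although for s \<noteq> 0 the
  harmonics behave differently at the poles: the mean square norm does not see the poles.\<close>

lemma spin_dense_continuous:
  assumes h: "continuous_on UNIV (h :: real ^ 3 \<Rightarrow> real)"
  shows "spin_dense s (\<lambda>z. of_real (h (sphere_point z)))"
proof (rule spin_dense_uniform)
  show "(\<lambda>z. of_real (h (sphere_point z))) \<in> L2_sphere"
    by (intro L2_sphere_continuous continuous_on_of_real continuous_on_sphere_point_comp h)
  fix d :: real assume d: "d > 0"
  obtain p where p: "real_polynomial_function p" "\<And>x. x \<in> sphere 0 1 \<Longrightarrow> \<bar>h x - p x\<bar> < d"
    using Stone_Weierstrass_real_polynomial_function[OF compact_sphere continuous_on_subset[OF h subset_UNIV] d, of 0 1] by blast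
  have "cmod (of_real (h (sphere_point z)) - of_real (p (sphere_point z))) \<le> d" for z
    using p(2)[of "sphere_point z"] by (simp add: norm_of_real less_imp_le flip: of_real_diff)
  then show "\<exists>g. spin_dense s g \<and> (AE z in sphere_measure. cmod (of_real (h (sphere_point z)) - g z) \<le> d)"
    using spin_dense_trig_fun[OF trig_fun_polynomial[OF p(1)], of s] by (intro exI conjI) auto
qed

lemma L2_sphere_indicator:
  assumes "D \<in> sets (borel :: (real ^ 3) measure)"
  shows "(\<lambda>z. of_real (indicator D (sphere_point z))) \<in> L2_sphere"
proof -
  have m: "(\<lambda>z. complex_of_real (indicator D (sphere_point z))) \<in> borel_measurable sphere_measure"
  proof (rule measurable_compose[OF measurable_sphere_measure[OF measurable_sphere_point]])
    show "(\<lambda>x. complex_of_real (indicator D x)) \<in> borel_measurable borel"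
      using assms by measurable
  qed
  moreover have "integrable sphere_measure (\<lambda>z. (cmod (of_real (indicator D (sphere_point z))))\<^sup>2)"
  proof (rule sphere.integrable_const_bound[where B = 1])
    show "(\<lambda>z. (cmod (of_real (indicator D (sphere_point z))))\<^sup>2) \<in> borel_measurable sphere_measure"
      by (intro borel_measurable_power measurable_compose[OF m borel_measurable_norm])
  qed (auto simp: indicator_def)
  ultimately show ?thesis by (simp only: L2_sphere_def mem_Collect_eq)
qed

lemma spin_dense_closed:
  assumes C: "closed (C :: (real ^ 3) set)"
  shows "spin_dense s (\<lambda>z. of_real (indicator C (sphere_point z)))"
proof (cases "C = {}")
  case True
  then show ?thesis by (simp add: spin_dense_span spin_span_zero)
next
  case False
  define h where "h n x = max 0 (1 - real n * infdist x C)" for n x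
  have hc: "continuous_on UNIV (h n)" for n unfolding h_def by (intro continuous_intros)
  have h1: "\<bar>h n x\<bar> \<le> 1" for n x using infdist_nonneg[of x C] by (auto simp: h_def)
  have lim: "(\<lambda>n. h n x) \<longlonglongrightarrow> indicator C x" for x
  proof (cases "x \<in> C")
    case True
    then show ?thesis by (simp add: h_def)
  next
    case xC: False
    then have pos: "infdist x C > 0" using C False by (simp add: infdist_pos_not_in_closed)
    obtain N0 where N0: "1 < real N0 * infdist x C" using reals_Archimedean3[OF pos] by blast
    have "h n x = 0" if "n \<ge> N0" for n
    proof -
      have "real N0 * infdist x C \<le> real n * infdist x C" using that pos by (intro mult_right_mono) auto
      with N0 have "1 - real n * infdist x C \<le> 0" by linarith
      then show ?thesis by (simp add: h_def)
    qed
    then have "\<forall>\<^sub>F n in sequentially. h n x = indicator C x"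
      using xC by (intro eventually_sequentiallyI[of N0]) auto
    then show ?thesis by (rule tendsto_eventually)
  qed
  show ?thesis
  proof (rule spin_dense_dominated[OF spin_dense_continuous[OF hc] L2_sphere_indicator, where w = "\<lambda>_. 1"])
    show "AE z in sphere_measure. (\<lambda>n. complex_of_real (h n (sphere_point z))) \<longlonglongrightarrow> of_real (indicator C (sphere_point z))"
      by (intro AE_I2 tendsto_of_real lim)
  qed (use C h1 in \<open>auto simp: indicator_def\<close>)
qed

text \<open>Closed sets are stable under intersection and generate the Borel sets. Complements are
  differences of functions in the closure, and disjoint unions are dominated limits of finite
  sums.\<close>

lemma spin_dense_borel:
  assumes "D \<in> sets (borel :: (real ^ 3) measure)"
  shows "spin_dense s (\<lambda>z. of_real (indicator D (sphere_point z)))"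
proof -
  have gen: "sets (borel :: (real ^ 3) measure) = sigma_sets UNIV {C. closed C}" unfolding borel_eq_closed by simp
  have "Int_stable {C :: (real ^ 3) set. closed C}" by (auto simp: Int_stable_def)
  moreover have "{C :: (real ^ 3) set. closed C} \<subseteq> Pow UNIV" by simp
  moreover have "D \<in> sigma_sets UNIV {C. closed C}" using assms gen by simp
  ultimately show ?thesis
  proof (induction rule: sigma_sets_induct_disjoint)
    case (basic A)
    then show ?case by (intro spin_dense_closed) simp
  next
    case empty
    show ?case by (simp add: spin_dense_span spin_span_zero)
  next
    case (compl A)
    have "spin_dense s (\<lambda>z. of_real (indicator UNIV (sphere_point z)) + (- 1) * of_real (indicator A (sphere_point z)))"
      by (intro spin_dense_add spin_dense_cmult spin_dense_closed compl.IH) simp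
    moreover have "(\<lambda>z. complex_of_real (indicator UNIV (sphere_point z)) + (- 1) * of_real (indicator A (sphere_point z)))
        = (\<lambda>z. of_real (indicator (UNIV - A) (sphere_point z)))"
      by (auto simp: fun_eq_iff indicator_def)
    ultimately show ?case by (simp only:)
  next
    case (union A)
    have A: "A i \<in> sets borel" for i using union gen by auto
    show ?case
    proof (rule spin_dense_dominated[where w = "\<lambda>_. 1" and g = "\<lambda>n z. \<Sum>i<n. of_real (indicator (A i) (sphere_point z))"])
      show "spin_dense s (\<lambda>z. \<Sum>i<n. of_real (indicator (A i) (sphere_point z)))" for n
        by (intro spin_dense_sum union.IH)
      show "(\<lambda>z. complex_of_real (indicator (\<Union> (range A)) (sphere_point z))) \<in> L2_sphere"
        using A by (intro L2_sphere_indicator) auto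
      have s1: "(\<lambda>i. indicator (A i) x :: real) sums indicator (\<Union> (range A)) x" for x
        using indicator_sums[of A x] union by (auto simp: disjoint_family_on_def)
      have "(\<Sum>i<n. indicator (A i) x :: real) \<le> 1" for n x
      proof -
        have "(\<Sum>i<n. indicator (A i) x :: real) \<le> (\<Sum>i. indicator (A i) x)"
          by (rule sum_le_suminf[OF sums_summable[OF s1]]) auto
        also have "\<dots> = indicator (\<Union> (range A)) x" by (rule sums_unique[OF s1, symmetric])
        also have "\<dots> \<le> 1" by (rule indicator_le_1)
        finally show ?thesis .
      qed
      then have "cmod (\<Sum>i<n. of_real (indicator (A i) x)) \<le> 1" for n x
        by (simp add: norm_of_real abs_of_nonneg sum_nonneg flip: of_real_sum)
      then show "AE z in sphere_measure. cmod (\<Sum>i<n. of_real (indicator (A i) (sphere_point z))) \<le> 1" for n by simp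
      show "AE z in sphere_measure. cmod (of_real (indicator (\<Union> (range A)) (sphere_point z))) \<le> 1" by (auto simp: indicator_def)
      show "AE z in sphere_measure. (\<lambda>n. \<Sum>i<n. complex_of_real (indicator (A i) (sphere_point z))) \<longlonglongrightarrow> of_real (indicator (\<Union> (range A)) (sphere_point z))"
      proof (rule AE_I2)
        fix z
        have "(\<lambda>n. complex_of_real (\<Sum>i<n. indicator (A i) (sphere_point z))) \<longlonglongrightarrow> of_real (indicator (\<Union> (range A)) (sphere_point z))"
          using s1[of "sphere_point z"] unfolding sums_def by (rule tendsto_of_real)
        then show "(\<lambda>n. \<Sum>i<n. complex_of_real (indicator (A i) (sphere_point z))) \<longlonglongrightarrow> of_real (indicator (\<Union> (range A)) (sphere_point z))"
          by simp
      qed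
    qed simp
  qed
qed

lemma spin_dense_AE_cong:
  assumes "spin_dense s f" "AE p in sphere_measure. f p = g p"
  shows "spin_dense s g"
proof (rule spin_dense_uniform)
  show "g \<in> L2_sphere" using assms L2_sphere_AE_cong by (auto simp: spin_dense_def)
  show "\<exists>h. spin_dense s h \<and> (AE p in sphere_measure. cmod (g p - h p) \<le> d)" if "d > 0" for d
    using assms that by (intro exI[of _ f] conjI) (auto elim: eventually_mono)
qed

text \<open>Off the poles the coordinates are a Borel function of the point. Hence E agrees, up to a
  null set, with the preimage of a Borel set in space.\<close>

lemma spin_dense_indicator:
  assumes E: "E \<in> sets sphere_measure"
  shows "spin_dense s (indicator E)"
proof -
  obtain h where h: "h \<in> borel_measurable borel" "\<And>x. norm x = 1 \<Longrightarrow> h x = polar_coords x" "\<And>x. h x \<in> sphere_coords"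
    using measurable_polar_coords by blast
  obtain B N N' where B: "E = B \<union> N'" "B \<in> sets sphere_borel" "N' \<subseteq> N" "N \<in> null_sets sphere_borel"
    using E unfolding sphere_measure_eq_completion by (auto elim: sets_completionE)
  obtain B' where B': "B' \<in> sets borel" "B = sphere_coords \<inter> B'"
    using B(2) by (auto simp: sets_sphere_borel sets_restrict_space)
  define D where "D = h -` B' \<inter> space borel"
  have D: "D \<in> sets borel" unfolding D_def by (rule measurable_sets[OF h(1) B'(1)])
  have "AE p in sphere_borel. p \<notin> N" using B(4) by (rule AE_not_in)
  then have "AE p in sphere_measure. p \<notin> N" by (simp add: AE_sphere_measure_iff)
  then have "AE p in sphere_measure. complex_of_real (indicator D (sphere_point p)) = indicator E p"
    using AE_sphere_interior
  proof eventually_elim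
    case (elim p)
    then have p: "p \<in> sphere_coords" "sin (fst p) \<noteq> 0"
      using sin_gt_zero[of "fst p"] by (auto simp: sphere_coords_def mem_Times_iff)
    then have "h (sphere_point p) = p" using polar_coords_sphere_point[of p] h(2)[of "sphere_point p"] by simp
    then show ?case using elim p B B' by (auto simp: D_def indicator_def)
  qed
  then show ?thesis by (rule spin_dense_AE_cong[OF spin_dense_borel[OF D]])
qed

theorem spin_dense_L2:
  assumes f: "f \<in> L2_sphere"
  shows "spin_dense s f"
proof -
  obtain F where F: "\<And>i. simple_function sphere_measure (F i)" "\<And>x. x \<in> space sphere_measure \<Longrightarrow> (\<lambda>i. F i x) \<longlonglongrightarrow> f x"
    "\<And>i x. x \<in> space sphere_measure \<Longrightarrow> dist (F i x) 0 \<le> 2 * dist (f x) 0"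
    using borel_measurable_implies_sequence_metric[OF L2_sphereD(1)[OF f], of 0] by blast
  have simple: "spin_dense s (F i)" for i
  proof -
    have fin: "finite (F i ` space sphere_measure)" using F(1) by (rule simple_functionD)
    have "spin_dense s (\<lambda>p. \<Sum>y\<in>F i ` space sphere_measure. y * indicator (F i -` {y} \<inter> space sphere_measure) p)"
      by (intro spin_dense_sum spin_dense_cmult spin_dense_indicator simple_functionD(2)[OF F(1)])
    moreover have "AE p in sphere_measure. (\<Sum>y\<in>F i ` space sphere_measure. y * indicator (F i -` {y} \<inter> space sphere_measure) p) = F i p"
    proof (rule AE_I2)
      fix p assume p: "p \<in> space sphere_measure"
      have "(\<Sum>y\<in>F i ` space sphere_measure. y * indicator (F i -` {y} \<inter> space sphere_measure) p) = (\<Sum>y\<in>F i ` space sphere_measure. if y = F i p then F i p else 0)"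
        using p by (intro sum.cong) (auto simp: indicator_def)
      also have "\<dots> = F i p" using fin p by (simp add: sum.delta)
      finally show "(\<Sum>y\<in>F i ` space sphere_measure. y * indicator (F i -` {y} \<inter> space sphere_measure) p) = F i p" .
    qed
    ultimately show ?thesis by (rule spin_dense_AE_cong)
  qed
  show ?thesis
  proof (rule spin_dense_dominated[OF simple f, where w = "\<lambda>p. 2 * cmod (f p)"])
    show "integrable sphere_measure (\<lambda>p. (2 * cmod (f p))\<^sup>2)"
      using L2_sphereD(2)[OF f] by (simp add: power_mult_distrib)
  qed (use F in \<open>auto intro!: AE_I2\<close>)
qed

section \<open>Fourier series of spin weighted functions\<close>

definition spin_index :: "int \<Rightarrow> nat \<Rightarrow> (nat \<times> int) set" where
  "spin_index s N = (SIGMA l:{l. \<bar>s\<bar> \<le> int l \<and> l \<le> N}. {-int l..int l})"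

definition spin_proj :: "int \<Rightarrow> nat \<Rightarrow> (real \<times> real \<Rightarrow> complex) \<Rightarrow> real \<times> real \<Rightarrow> complex" where
  "spin_proj s N f p = (\<Sum>(l, m)\<in>spin_index s N. sphere_inner (spinY s l m) f * spinY s l m p)"

lemma finite_spin_index [simp]: "finite (spin_index s N)"
proof -
  have "{l. \<bar>s\<bar> \<le> int l \<and> l \<le> N} \<subseteq> {..N}" by auto
  then show ?thesis unfolding spin_index_def by (intro finite_SigmaI) (auto intro: finite_subset)
qed

lemma spin_indexD: "(l, m) \<in> spin_index s N \<Longrightarrow> \<bar>m\<bar> \<le> int l \<and> \<bar>s\<bar> \<le> int l"
  by (auto simp: spin_index_def abs_le_iff)

lemma spin_index_sum:
  "(\<Sum>(l, m)\<in>spin_index s N. h l m) = (\<Sum>l\<le>N. if \<bar>s\<bar> \<le> int l then \<Sum>m=-int l..int l. h l m else 0)"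
proof -
  have fin: "finite {l. \<bar>s\<bar> \<le> int l \<and> l \<le> N}" by (rule finite_subset[of _ "{..N}"]) auto
  have "(\<Sum>(l, m)\<in>spin_index s N. h l m) = (\<Sum>l\<in>{l. \<bar>s\<bar> \<le> int l \<and> l \<le> N}. \<Sum>m=-int l..int l. h l m)"
    unfolding spin_index_def using fin by (subst sum.Sigma) auto
  also have "{l. \<bar>s\<bar> \<le> int l \<and> l \<le> N} = {..N} \<inter> {l. \<bar>s\<bar> \<le> int l}" by auto
  also have "(\<Sum>l\<in>\<dots>. \<Sum>m=-int l..int l. h l m) = (\<Sum>l\<le>N. if \<bar>s\<bar> \<le> int l then \<Sum>m=-int l..int l. h l m else 0)"
    by (subst sum.inter_restrict) (auto simp: sum.If_cases)
  finally show ?thesis .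
qed

lemma L2_spin_proj: "spin_proj s N f \<in> L2_sphere"
  unfolding spin_proj_def[abs_def] case_prod_beta' by (intro L2_sphere_sum L2_sphere_cmult L2_spinY)

lemma sphere_inner_spin_proj:
  assumes "h \<in> L2_sphere"
  shows "sphere_inner h (spin_proj s N f) = (\<Sum>(l, m)\<in>spin_index s N. sphere_inner (spinY s l m) f * sphere_inner h (spinY s l m))"
  unfolding spin_proj_def[abs_def] case_prod_beta'
  by (subst sphere_inner_sum_right) (auto intro: assms L2_sphere_cmult L2_spinY simp: sphere_inner_cmult_right)

lemma sphere_inner_spinY_proj:
  assumes "(l, m) \<in> spin_index s N"
  shows "sphere_inner (spinY s l m) (spin_proj s N f) = sphere_inner (spinY s l m) f"
proof -
  have "sphere_inner (spinY s l m) (spin_proj s N f) = (\<Sum>i\<in>spin_index s N. if i = (l, m) then sphere_inner (spinY s l m) f else 0)"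
    unfolding sphere_inner_spin_proj[OF L2_spinY] 
  proof (rule sum.cong[OF refl])
    fix i assume "i \<in> spin_index s N"
    then show "(case i of (l', m') \<Rightarrow> sphere_inner (spinY s l' m') f * sphere_inner (spinY s l m) (spinY s l' m')) = (if i = (l, m) then sphere_inner (spinY s l m) f else 0)"
      using spin_indexD[OF assms] by (cases i) (auto dest!: spin_indexD simp: sphere_inner_spinY)
  qed
  then show ?thesis using assms by (simp add: sum.delta)
qed

lemma spin_proj_norm2:
  assumes f: "f \<in> L2_sphere"
  shows "sphere_norm2 (\<lambda>p. f p - spin_proj s N f p) = sphere_norm2 f - (\<Sum>(l, m)\<in>spin_index s N. (cmod (sphere_inner (spinY s l m) f))\<^sup>2)"
proof -
  define P where "P = spin_proj s N f"
  define d where "d p = f p - P p" for p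
  have PL: "P \<in> L2_sphere" by (simp add: P_def L2_spin_proj)
  have dL: "d \<in> L2_sphere" unfolding d_def[abs_def] by (intro L2_sphere_diff f PL)
  have "sphere_inner (spinY s l m) d = 0" if "(l, m) \<in> spin_index s N" for l m
    using sphere_inner_diff_right[OF f PL L2_spinY] sphere_inner_spinY_proj[OF that, of f] by (simp add: d_def[abs_def] P_def)
  then have "sphere_inner d (spinY s l m) = 0" if "(l, m) \<in> spin_index s N" for l m
    using that sphere_inner_commute[of d "spinY s l m"] by simp
  then have 0: "sphere_inner d P = 0"
    unfolding P_def sphere_inner_spin_proj[OF dL] by (intro sum.neutral) auto
  have "of_real (sphere_norm2 d) = sphere_inner d (\<lambda>p. f p - P p)" by (simp add: sphere_inner_self flip: d_def)
  also have "\<dots> = sphere_inner d f" using sphere_inner_diff_right[OF f PL dL] 0 by simp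
  also have "\<dots> = cnj (sphere_inner f (\<lambda>p. f p - P p))" by (subst sphere_inner_commute) (simp flip: d_def)
  also have "\<dots> = of_real (sphere_norm2 f) - cnj (sphere_inner f P)"
    using sphere_inner_diff_right[OF f PL f] by (simp add: sphere_inner_self)
  also have "cnj (sphere_inner f P) = (\<Sum>(l, m)\<in>spin_index s N. of_real ((cmod (sphere_inner (spinY s l m) f))\<^sup>2))"
    unfolding P_def sphere_inner_spin_proj[OF f] cnj_sum complex_norm_square
    by (intro sum.cong) (auto simp: sphere_inner_commute[of f] mult.commute)
  also have "\<dots> = of_real (\<Sum>(l, m)\<in>spin_index s N. (cmod (sphere_inner (spinY s l m) f))\<^sup>2)"
    by (simp add: case_prod_beta')
  finally show ?thesis unfolding d_def[abs_def] P_def of_real_diff[symmetric] of_real_eq_iff by simp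
qed

lemma spin_bessel:
  assumes "f \<in> L2_sphere"
  shows "(\<Sum>(l, m)\<in>spin_index s N. (cmod (sphere_inner (spinY s l m) f))\<^sup>2) \<le> sphere_norm2 f"
  using spin_proj_norm2[OF assms, of s N] sphere_norm2_nonneg[of "\<lambda>p. f p - spin_proj s N f p"] by simp

lemma spin_proj_span:
  "h \<in> spin_span s \<Longrightarrow> \<exists>N0. \<forall>N\<ge>N0. spin_proj s N h = h"
proof (induction rule: spin_span.induct)
  case spin_span_zero
  show ?case by (auto simp: spin_proj_def[abs_def] sphere_inner_def case_prod_beta')
next
  case (spin_span_add h m l c)
  then obtain N0 where N0: "\<And>N. N \<ge> N0 \<Longrightarrow> spin_proj s N h = h" by blast
  have hL: "h \<in> L2_sphere" using spin_span_add spin_span_L2 by blast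
  have "spin_proj s N (\<lambda>p. h p + c * spinY s l m p) = (\<lambda>p. h p + c * spinY s l m p)" if N: "N \<ge> max N0 l" for N
  proof
    fix p
    have lm: "(l, m) \<in> spin_index s N" using N spin_span_add by (auto simp: spin_index_def abs_le_iff)
    have "spin_proj s N (\<lambda>p. h p + c * spinY s l m p) p = (\<Sum>i\<in>spin_index s N. (case i of (l', m') \<Rightarrow> sphere_inner (spinY s l' m') h * spinY s l' m' p)
         + (if i = (l, m) then c * spinY s l m p else 0))"
      unfolding spin_proj_def
    proof (rule sum.cong[OF refl])
      fix i assume i: "i \<in> spin_index s N"
      show "(case i of (l', m') \<Rightarrow> sphere_inner (spinY s l' m') (\<lambda>p. h p + c * spinY s l m p) * spinY s l' m' p) =
        (case i of (l', m') \<Rightarrow> sphere_inner (spinY s l' m') h * spinY s l' m' p) + (if i = (l, m) then c * spinY s l m p else 0)"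
        using i spin_span_add(2,3)
        by (cases i) (auto dest!: spin_indexD simp: sphere_inner_add_right hL L2_sphere_cmult[OF L2_spinY] L2_spinY sphere_inner_cmult_right sphere_inner_spinY distrib_right)
    qed
    also have "\<dots> = spin_proj s N h p + c * spinY s l m p"
      using lm by (simp add: sum.distrib sum.delta spin_proj_def)
    also have "spin_proj s N h p = h p" using N0[of N] N by simp
    finally show "spin_proj s N (\<lambda>p. h p + c * spinY s l m p) p = h p + c * spinY s l m p" .
  qed
  then show ?case by blast
qed

theorem spin_proj_tendsto:
  assumes f: "f \<in> L2_sphere"
  shows "(\<lambda>N. sphere_norm2 (\<lambda>p. f p - spin_proj s N f p)) \<longlonglongrightarrow> 0"
proof (rule LIMSEQ_I)
  fix e :: real assume e: "e > 0"
  obtain h where h: "h \<in> spin_span s" "sphere_norm2 (\<lambda>p. f p - h p) < e"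
    using spin_dense_L2[OF f, of s] e unfolding spin_dense_def by blast
  have hL: "h \<in> L2_sphere" using h spin_span_L2 by blast
  obtain N0 where N0: "\<And>N. N \<ge> N0 \<Longrightarrow> spin_proj s N h = h" using spin_proj_span[OF h(1)] by blast
  have "sphere_norm2 (\<lambda>p. f p - spin_proj s N f p) < e" if "N \<ge> N0" for N
  proof -
    \<comment> \<open>For large N the projection fixes h, so the remainder of f equals the remainder
      of f - h, and remainders do not increase the norm.\<close>
    define d where "d p = f p - h p" for p
    have dL: "d \<in> L2_sphere" unfolding d_def[abs_def] by (intro L2_sphere_diff f hL)
    have "spin_proj s N d p = spin_proj s N f p - spin_proj s N h p" for p
      unfolding spin_proj_def d_def[abs_def] sum_subtractf[symmetric]
      by (intro sum.cong) (auto simp: sphere_inner_diff_right[OF f hL L2_spinY] left_diff_distrib)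
    then have "(\<lambda>p. d p - spin_proj s N d p) = (\<lambda>p. f p - spin_proj s N f p)"
      using N0[OF that] by (simp add: d_def fun_eq_iff)
    then have "sphere_norm2 (\<lambda>p. f p - spin_proj s N f p) = sphere_norm2 (\<lambda>p. d p - spin_proj s N d p)" by simp
    also have "\<dots> \<le> sphere_norm2 d"
      unfolding spin_proj_norm2[OF dL] by (auto intro!: sum_nonneg)
    finally show ?thesis using h(2) by (simp add: d_def[abs_def])
  qed
  then show "\<exists>N0. \<forall>N\<ge>N0. norm (sphere_norm2 (\<lambda>p. f p - spin_proj s N f p) - 0) < e"
    using sphere_norm2_nonneg by (auto intro!: exI[of _ N0])
qed

lemma sphere_inner_proj_tendsto:
  assumes h: "h \<in> L2_sphere" and f: "f \<in> L2_sphere"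
  shows "(\<lambda>N. sphere_inner h (spin_proj s N f)) \<longlonglongrightarrow> sphere_inner h f"
proof (rule Lim_null[THEN iffD2], rule Lim_null_comparison)
  show "\<forall>\<^sub>F N in sequentially. norm (sphere_inner h (spin_proj s N f) - sphere_inner h f) \<le> sqrt (sphere_norm2 h) * sqrt (sphere_norm2 (\<lambda>p. f p - spin_proj s N f p))"
  proof (intro always_eventually allI)
    fix N
    have "norm (sphere_inner h (spin_proj s N f) - sphere_inner h f) = norm (sphere_inner h (\<lambda>p. f p - spin_proj s N f p))"
      by (subst sphere_inner_diff_right[OF f L2_spin_proj h]) (simp add: norm_minus_commute)
    also have "\<dots> \<le> sqrt (sphere_norm2 h) * sqrt (sphere_norm2 (\<lambda>p. f p - spin_proj s N f p))"
      by (intro sphere_Cauchy_Schwarz h L2_sphere_diff f L2_spin_proj)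
    finally show "norm (sphere_inner h (spin_proj s N f) - sphere_inner h f) \<le> sqrt (sphere_norm2 h) * sqrt (sphere_norm2 (\<lambda>p. f p - spin_proj s N f p))" .
  qed
  have "(\<lambda>N. sqrt (sphere_norm2 h) * sqrt (sphere_norm2 (\<lambda>p. f p - spin_proj s N f p))) \<longlonglongrightarrow> sqrt (sphere_norm2 h) * sqrt 0"
    by (intro tendsto_intros spin_proj_tendsto f)
  then show "(\<lambda>N. sqrt (sphere_norm2 h) * sqrt (sphere_norm2 (\<lambda>p. f p - spin_proj s N f p))) \<longlonglongrightarrow> 0" by simp
qed

lemma spin_proj_norm2_le:
  assumes f: "f \<in> L2_sphere"
  shows "sphere_norm2 (spin_proj s N f) \<le> sphere_norm2 f"
proof -
  have "of_real (sphere_norm2 (spin_proj s N f)) = (\<Sum>(l, m)\<in>spin_index s N. complex_of_real ((cmod (sphere_inner (spinY s l m) f))\<^sup>2))"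
    unfolding sphere_inner_self[symmetric] sphere_inner_spin_proj[OF L2_spin_proj] complex_norm_square
    by (intro sum.cong) (auto simp: sphere_inner_commute[of "spin_proj s N f"] sphere_inner_spinY_proj)
  also have "\<dots> = of_real (\<Sum>(l, m)\<in>spin_index s N. (cmod (sphere_inner (spinY s l m) f))\<^sup>2)"
    by (simp add: case_prod_beta')
  finally show ?thesis using spin_bessel[OF f, of s N] by (simp only: of_real_eq_iff)
qed

section \<open>Rotations of square integrable functions\<close>

lemma measurable_spin_phase:
  assumes Q: "Q \<in> SO3"
  shows "(\<lambda>p. exp (- \<i> * of_int s * of_real (third_euler_angle (Q ** frame p)))) \<in> borel_measurable sphere_measure"
proof -
  \<comment> \<open>The angle itself comes from a definite description; its phase is read off the
    matrix instead. The third row of a product of Euler rotations is (- sin b cos \<kappa>, sin b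
    sin \<kappa>, cos b), so that \<open>z p = cis (- \<kappa>)\<close> wherever sin b > 0.\<close>
  define z where "z p = - (of_real ((Q ** frame p) $ 3 $ 1) + \<i> * of_real ((Q ** frame p) $ 3 $ 2)) /
      of_real (sqrt (((Q ** frame p) $ 3 $ 1)\<^sup>2 + ((Q ** frame p) $ 3 $ 2)\<^sup>2))" for p
  define e where "e p = (if s \<ge> 0 then z p ^ nat s else cnj (z p) ^ nat (- s))" for p
  have c: "(\<lambda>p. (Q ** frame p) $ i $ j) \<in> borel_measurable sphere_measure" for i j
    unfolding matrix_mult3_nth
    by (intro measurable_sphere_measure borel_measurable_continuous_onI continuous_intros continuous_on_frame)
  have zm: "z \<in> borel_measurable sphere_measure"
    unfolding z_def using c[of 3 1] c[of 3 2] by measurable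
  have "e \<in> borel_measurable sphere_measure"
    unfolding e_def using zm by (cases "s \<ge> 0") simp_all
  moreover have "AE p in sphere_measure. e p = exp (- \<i> * of_int s * of_real (third_euler_angle (Q ** frame p)))"
    using AE_sphere_rot[OF Q AE_sphere_interior]
  proof eventually_elim
    case (elim p)
    define \<kappa> where "\<kappa> = third_euler_angle (Q ** frame p)"
    define b where "b = fst (sphere_rot Q p)"
    have sb: "sin b > 0" using elim by (auto simp: b_def intro: sin_gt_zero)
    have M: "Q ** frame p = frame (sphere_rot Q p) ** rot_z \<kappa>" unfolding \<kappa>_def by (rule frame_sphere_rot[OF Q])
    have m: "(Q ** frame p) $ 3 $ 1 = - sin b * cos \<kappa>" "(Q ** frame p) $ 3 $ 2 = sin b * sin \<kappa>"
      unfolding M by (simp_all add: matrix_mult3_nth frame_def b_def)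
    have "(- sin b * cos \<kappa>)\<^sup>2 + (sin b * sin \<kappa>)\<^sup>2 = (sin b)\<^sup>2 * ((sin \<kappa>)\<^sup>2 + (cos \<kappa>)\<^sup>2)"
      by (simp only: power_mult_distrib power2_minus) algebra
    then have "sqrt ((- sin b * cos \<kappa>)\<^sup>2 + (sin b * sin \<kappa>)\<^sup>2) = sin b" using sb by simp
    then have zp: "z p = cis (- \<kappa>)" unfolding z_def m using sb by (simp add: complex_eq_iff)
    have "e p = cis (- (of_int s * \<kappa>))"
    proof (cases "s \<ge> 0")
      case True
      then have n: "real (nat s) * - \<kappa> = - (of_int s * \<kappa>)" by simp
      then show ?thesis using True unfolding e_def zp by (simp only: Complex.DeMoivre if_True n)
    next
      case False
      then have n: "real (nat (- s)) * \<kappa> = - (of_int s * \<kappa>)" by simp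
      then show ?thesis using False unfolding e_def zp by (simp only: cis_cnj minus_minus Complex.DeMoivre if_False n)
    qed
    then show ?case unfolding \<kappa>_def[symmetric] by (simp only: exp_eq_cis)
  qed
  ultimately show ?thesis by (rule borel_measurable_sphere_AE)
qed

lemma cmod_phase: "cmod (exp (- \<i> * of_int s * of_real x)) = 1"
  by (simp only: exp_eq_cis norm_cis)

lemma spin_rotate_L2:
  assumes R: "R \<in> SO3" and f: "f \<in> L2_sphere"
  shows "spin_rotate s R f \<in> L2_sphere" and "sphere_norm2 (spin_rotate s R f) = sphere_norm2 f"
proof -
  have T: "transpose R \<in> SO3" by (rule SO3_transpose[OF R])
  have eq: "spin_rotate s R f = (\<lambda>p. exp (- \<i> * of_int s * of_real (third_euler_angle (transpose R ** frame p))) * f (sphere_rot (transpose R) p))"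
    using spin_rotate_eq[OF R] by (simp add: fun_eq_iff)
  have n: "(cmod (spin_rotate s R f p))\<^sup>2 = (cmod (f (sphere_rot (transpose R) p)))\<^sup>2" for p
    unfolding eq norm_mult cmod_phase by simp
  show "spin_rotate s R f \<in> L2_sphere"
    unfolding L2_sphere_def
  proof (intro CollectI conjI)
    show "spin_rotate s R f \<in> borel_measurable sphere_measure"
      unfolding eq
      by (intro borel_measurable_times measurable_spin_phase[OF T] measurable_compose[OF measurable_sphere_rot[OF T] L2_sphereD(1)[OF f]])
    show "integrable sphere_measure (\<lambda>p. (cmod (spin_rotate s R f p))\<^sup>2)"
      unfolding n by (rule integrable_sphere_rot[OF T L2_sphereD(2)[OF f]])
  qed
  show "sphere_norm2 (spin_rotate s R f) = sphere_norm2 f"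
    unfolding sphere_norm2_def n
    by (rule integral_sphere_rot[OF T borel_measurable_integrable[OF L2_sphereD(2)[OF f]]])
qed

text \<open>The rotation is moved from f to the harmonic, whose lift it transforms by D. The
  coefficients of f appear conjugated since the rotated function stands in the first
  argument.\<close>

lemma spin_rotate_coeff:
  assumes R: "R \<in> SO3" and f: "f \<in> L2_sphere" and lm: "\<bar>m\<bar> \<le> int l" "\<bar>s\<bar> \<le> int l"
  shows "sphere_inner (spin_rotate s R f) (spinY s l m) = (\<Sum>n=-int l..int l. wigD s l R m n * cnj (sphere_inner (spinY s l n) f))"
proof -
  have T: "transpose R \<in> SO3" by (rule SO3_transpose[OF R])
  define h where "h p = cnj (f p) * spinF s l m (R ** frame p)" for p
  have hm: "h \<in> borel_measurable sphere_measure"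
    unfolding h_def[abs_def] by (intro borel_measurable_integrable L2_inner_integrable f L2_spinF_frame)
  have "cnj (spin_rotate s R f p) * spinY s l m p = h (sphere_rot (transpose R) p)" for p
  proof -
    define e where "e = exp (- \<i> * of_int s * of_real (third_euler_angle (transpose R ** frame p)))"
    have "cnj (spin_rotate s R f p) * spinY s l m p = (cnj e * e) * h (sphere_rot (transpose R) p)"
      unfolding spin_rotate_eq[OF R] spinY_sphere_rot[OF lm T, of p, symmetric] e_def[symmetric] h_def by simp
    then show ?thesis unfolding e_def cnj_phase by simp
  qed
  then have "sphere_inner (spin_rotate s R f) (spinY s l m) = (LINT p|sphere_measure. h (sphere_rot (transpose R) p))"
    unfolding sphere_inner_def by simp
  also have "\<dots> = integral\<^sup>L sphere_measure h" by (rule integral_sphere_rot[OF T hm])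
  also have "\<dots> = sphere_inner f (\<lambda>p. \<Sum>n=-int l..int l. wigD s l R m n * spinY s l n p)"
    unfolding sphere_inner_def h_def
    using spin_linear_wigD[OF lm(2) R] spinF_frame[OF _ lm(2)] lm(1)
    by (intro Bochner_Integration.integral_cong refl) (auto simp: spin_linear_def abs_le_iff intro!: sum.cong)
  also have "\<dots> = (\<Sum>n=-int l..int l. wigD s l R m n * sphere_inner f (spinY s l n))"
    by (subst sphere_inner_sum_right) (auto intro: f L2_sphere_cmult L2_spinY simp: sphere_inner_cmult_right)
  finally show ?thesis by (simp add: sphere_inner_commute[of f])
qed

section \<open>Schur orthogonality and the wavelet transform\<close>

locale haar_rotation =
  fixes \<nu> :: "(real ^ 3 ^ 3) measure"
  assumes haar: "haar_SO3 \<nu>"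
begin

lemma sets_nu: "sets \<nu> = sets (restrict_space borel SO3)"
  using haar by (simp add: haar_SO3_def)

lemma space_nu [simp]: "space \<nu> = SO3"
  using sets_eq_imp_space_eq[OF sets_nu] by (simp add: space_restrict_space)

lemma measurable_nu: "f \<in> borel_measurable borel \<Longrightarrow> f \<in> borel_measurable \<nu>"
  unfolding measurable_cong_sets[OF sets_nu refl] by (rule measurable_restrict_space1)

lemma finite_nu: "finite_measure \<nu>"
  by (rule finite_measureI) (use haar in \<open>simp add: haar_SO3_def\<close>)

lemma measure_nu: "measure \<nu> SO3 = 8 * pi\<^sup>2"
  using haar by (simp add: haar_SO3_def measure_def)

lemma integral_nu_left:
  fixes g :: "real ^ 3 ^ 3 \<Rightarrow> complex"
  assumes Q: "Q \<in> SO3" and g: "g \<in> borel_measurable borel"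
  shows "(LINT R|\<nu>. g (Q ** R)) = integral\<^sup>L \<nu> g"
proof -
  have "continuous_on UNIV (\<lambda>R :: real ^ 3 ^ 3. Q ** R)"
  proof (rule continuous_on_matrixI)
    show "continuous_on UNIV (\<lambda>R :: real ^ 3 ^ 3. (Q ** R) $ i $ j)" for i j
      unfolding matrix_mult3_nth by (intro continuous_intros)
  qed
  then have "(\<lambda>R. Q ** R) \<in> measurable (restrict_space borel SO3) (restrict_space borel SO3)"
    by (intro measurable_restrict_space3 borel_measurable_continuous_onI) (auto intro: SO3_mult Q)
  then have m: "(\<lambda>R. Q ** R) \<in> measurable \<nu> \<nu>"
    unfolding measurable_cong_sets[OF sets_nu sets_nu] .
  have "integral\<^sup>L (distr \<nu> \<nu> (\<lambda>R. Q ** R)) g = (LINT R|\<nu>. g (Q ** R))"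
    by (rule integral_distr[OF m measurable_nu[OF g]])
  then show ?thesis using haar Q by (simp add: haar_SO3_def)
qed

end

text \<open>The rows of D contracted with a fixed vector, which will be the conjugate coefficients
  of the wavelet.\<close>

definition wig_coeff :: "int \<Rightarrow> (nat \<Rightarrow> int \<Rightarrow> complex) \<Rightarrow> nat \<Rightarrow> int \<Rightarrow> real ^ 3 ^ 3 \<Rightarrow> complex" where
  "wig_coeff s b l m R = (\<Sum>n=-int l..int l. wigD s l R m n * b l n)"

lemma measurable_wig_coeff: "wig_coeff s b l m \<in> borel_measurable borel"
  unfolding wig_coeff_def[abs_def]
  by (intro borel_measurable_sum borel_measurable_times measurable_wigD borel_measurable_const)

lemma wig_coeff_mult:
  assumes "\<bar>s\<bar> \<le> int l" "Q \<in> SO3" "R \<in> SO3" "m \<in> {-int l..int l}"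
  shows "wig_coeff s b l m (Q ** R) = (\<Sum>k=-int l..int l. wigD s l Q m k * wig_coeff s b l k R)"
proof -
  have "wig_coeff s b l m (Q ** R) = (\<Sum>n=-int l..int l. \<Sum>k=-int l..int l. wigD s l Q m k * (wigD s l R k n * b l n))"
    unfolding wig_coeff_def using assms
    by (intro sum.cong refl) (simp add: wigD_mult sum_distrib_right mult.assoc)
  also have "\<dots> = (\<Sum>k=-int l..int l. \<Sum>n=-int l..int l. wigD s l Q m k * (wigD s l R k n * b l n))"
    by (rule sum.swap)
  finally show ?thesis unfolding wig_coeff_def by (simp add: sum_distrib_left)
qed

text \<open>The columns of D are orthonormal. This yields both the uniform bound of the entries and
  the normalization of their integrals.\<close>

lemma wig_coeff_norm2:
  assumes s: "\<bar>s\<bar> \<le> int l" and R: "R \<in> SO3"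
  shows "(\<Sum>m=-int l..int l. cnj (wig_coeff s b l m R) * wig_coeff s b l m R) = of_real (\<Sum>n=-int l..int l. (cmod (b l n))\<^sup>2)"
proof -
  let ?I = "{-int l..int l}"
  have "(\<Sum>m\<in>?I. cnj (wig_coeff s b l m R) * wig_coeff s b l m R)
     = (\<Sum>m\<in>?I. \<Sum>n\<in>?I. \<Sum>n'\<in>?I. (cnj (b l n) * b l n') * (cnj (wigD s l R m n) * wigD s l R m n'))"
    unfolding wig_coeff_def cnj_sum sum_product by (intro sum.cong refl) (simp add: mult_ac)
  also have "\<dots> = (\<Sum>n\<in>?I. \<Sum>m\<in>?I. \<Sum>n'\<in>?I. (cnj (b l n) * b l n') * (cnj (wigD s l R m n) * wigD s l R m n'))"
    by (rule sum.swap)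
  also have "\<dots> = (\<Sum>n\<in>?I. \<Sum>n'\<in>?I. \<Sum>m\<in>?I. (cnj (b l n) * b l n') * (cnj (wigD s l R m n) * wigD s l R m n'))"
    by (rule sum.cong[OF refl], rule sum.swap)
  also have "\<dots> = (\<Sum>n\<in>?I. \<Sum>n'\<in>?I. if n = n' then cnj (b l n) * b l n else 0)"
    unfolding sum_distrib_left[symmetric] by (intro sum.cong refl) (simp add: wigD_orthogonal[OF s R])
  also have "\<dots> = (\<Sum>n\<in>?I. cnj (b l n) * b l n)"
    by (intro sum.cong refl) (simp add: sum.delta')
  also have "\<dots> = of_real (\<Sum>n\<in>?I. (cmod (b l n))\<^sup>2)"
    unfolding of_real_sum complex_norm_square by (simp add: mult.commute)
  finally show ?thesis .
qed

lemma wig_coeff_bound: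
  assumes s: "\<bar>s\<bar> \<le> int l" and R: "R \<in> SO3" and m: "m \<in> {-int l..int l}"
  shows "(cmod (wig_coeff s b l m R))\<^sup>2 \<le> (\<Sum>n=-int l..int l. (cmod (b l n))\<^sup>2)"
proof -
  have "complex_of_real (\<Sum>m=-int l..int l. (cmod (wig_coeff s b l m R))\<^sup>2) = (\<Sum>m=-int l..int l. cnj (wig_coeff s b l m R) * wig_coeff s b l m R)"
    unfolding of_real_sum complex_norm_square by (intro sum.cong refl mult.commute)
  also have "\<dots> = of_real (\<Sum>n=-int l..int l. (cmod (b l n))\<^sup>2)" by (rule wig_coeff_norm2[OF s R])
  finally have e: "(\<Sum>m=-int l..int l. (cmod (wig_coeff s b l m R))\<^sup>2) = (\<Sum>n=-int l..int l. (cmod (b l n))\<^sup>2)"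
    by (simp only: of_real_eq_iff)
  show ?thesis unfolding e[symmetric] by (rule member_le_sum) (use m in auto)
qed

context haar_rotation
begin

interpretation nu: finite_measure \<nu> by (rule finite_nu)

lemma integrable_nu_bounded:
  fixes g :: "real ^ 3 ^ 3 \<Rightarrow> complex"
  assumes "g \<in> borel_measurable \<nu>" "\<And>R. R \<in> SO3 \<Longrightarrow> cmod (g R) \<le> B"
  shows "integrable \<nu> g"
  by (rule nu.integrable_const_bound[of _ B]) (use assms in \<open>auto intro!: AE_I2\<close>)

text \<open>With the same b in both factors, only the row indices of the orthogonality relations are
  left. Left translations act on exactly these.\<close>

definition schur :: "int \<Rightarrow> (nat \<Rightarrow> int \<Rightarrow> complex) \<Rightarrow> nat \<Rightarrow> int \<Rightarrow> nat \<Rightarrow> int \<Rightarrow> complex" where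
  "schur s b l m l' m' = (LINT R|\<nu>. cnj (wig_coeff s b l m R) * wig_coeff s b l' m' R)"

lemma measurable_schur: "(\<lambda>R. cnj (wig_coeff s b l m R) * wig_coeff s b l' m' R) \<in> borel_measurable borel"
  by (intro borel_measurable_times borel_measurable_cnj measurable_wig_coeff)

lemma integrable_schur:
  assumes "\<bar>s\<bar> \<le> int l" "\<bar>s\<bar> \<le> int l'" "m \<in> {-int l..int l}" "m' \<in> {-int l'..int l'}"
  shows "integrable \<nu> (\<lambda>R. cnj (wig_coeff s b l m R) * wig_coeff s b l' m' R)"
proof (rule integrable_nu_bounded[OF measurable_nu[OF measurable_schur]])
  fix R assume R: "R \<in> SO3"
  show "cmod (cnj (wig_coeff s b l m R) * wig_coeff s b l' m' R) \<le> sqrt (\<Sum>n=-int l..int l. (cmod (b l n))\<^sup>2) * sqrt (\<Sum>n=-int l'..int l'. (cmod (b l' n))\<^sup>2)"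
    unfolding norm_mult complex_mod_cnj
    by (intro mult_mono real_le_rsqrt wig_coeff_bound assms R real_sqrt_ge_zero sum_nonneg) auto
qed

lemma schur_commute: "schur s b l' m' l m = cnj (schur s b l m l' m')"
proof -
  have "(\<lambda>R. cnj (wig_coeff s b l' m' R) * wig_coeff s b l m R) = (\<lambda>R. cnj (cnj (wig_coeff s b l m R) * wig_coeff s b l' m' R))"
    by (simp add: mult.commute)
  then show ?thesis unfolding schur_def by (simp only: Bochner_Integration.integral_cnj)
qed

lemma schur_invariant:
  assumes s: "\<bar>s\<bar> \<le> int l" "\<bar>s\<bar> \<le> int l'" and Q: "Q \<in> SO3" and m: "m \<in> {-int l..int l}" "m' \<in> {-int l'..int l'}"
  shows "schur s b l m l' m' = (\<Sum>n=-int l..int l. \<Sum>n'=-int l'..int l'. cnj (wigD s l Q m n) * wigD s l' Q m' n' * schur s b l n l' n')"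
proof -
  have "schur s b l m l' m' = (LINT R|\<nu>. cnj (wig_coeff s b l m (Q ** R)) * wig_coeff s b l' m' (Q ** R))"
    unfolding schur_def by (rule integral_nu_left[OF Q measurable_schur, symmetric])
  also have "\<dots> = (LINT R|\<nu>. (\<Sum>n=-int l..int l. \<Sum>n'=-int l'..int l'. (cnj (wigD s l Q m n) * wigD s l' Q m' n') * (cnj (wig_coeff s b l n R) * wig_coeff s b l' n' R)))"
  proof (rule Bochner_Integration.integral_cong[OF refl])
    fix R assume "R \<in> space \<nu>"
    then have R: "R \<in> SO3" by simp
    show "cnj (wig_coeff s b l m (Q ** R)) * wig_coeff s b l' m' (Q ** R) =
      (\<Sum>n=-int l..int l. \<Sum>n'=-int l'..int l'. (cnj (wigD s l Q m n) * wigD s l' Q m' n') * (cnj (wig_coeff s b l n R) * wig_coeff s b l' n' R))"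
      unfolding wig_coeff_mult[OF s(1) Q R m(1)] wig_coeff_mult[OF s(2) Q R m(2)] cnj_sum sum_product
      by (intro sum.cong refl) (simp add: mult_ac)
  qed
  also have "\<dots> = (\<Sum>n=-int l..int l. \<Sum>n'=-int l'..int l'. cnj (wigD s l Q m n) * wigD s l' Q m' n' * schur s b l n l' n')"
    unfolding schur_def
    by (subst Bochner_Integration.integral_sum, (intro Bochner_Integration.integrable_sum integrable_mult_right integrable_schur s; simp), intro sum.cong refl,
      subst Bochner_Integration.integral_sum, (intro integrable_mult_right integrable_schur s; simp), intro sum.cong refl) simp
  finally show ?thesis .
qed

text \<open>Invariance under the rotations about the z-axis makes the matrix of integrals diagonal in m.\<close>

lemma schur_offdiag:
  assumes s: "\<bar>s\<bar> \<le> int l" "\<bar>s\<bar> \<le> int l'" and m: "m \<in> {-int l..int l}" "m' \<in> {-int l'..int l'}" and ne: "m \<noteq> m'"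
  shows "schur s b l m l' m' = 0"
proof -
  \<comment> \<open>At this angle the character exp (i (m' - m) t) equals - 1, so invariance makes
    the integral its own negative.\<close>
  define t where "t = pi / of_int (m' - m)"
  have D: "wigD s l (rot_z t) m n = (if m = n then cis (of_int m * t) else 0)" if "n \<in> {-int l..int l}" for n
    using wigD_unique[OF s(1) spin_linear_rot_z[OF s(1)] m(1) that, of t] by (simp only: exp_eq_cis)
  have D': "wigD s l' (rot_z t) m' n = (if m' = n then cis (of_int m' * t) else 0)" if "n \<in> {-int l'..int l'}" for n
    using wigD_unique[OF s(2) spin_linear_rot_z[OF s(2)] m(2) that, of t] by (simp only: exp_eq_cis)
  have "schur s b l m l' m' = (\<Sum>n=-int l..int l. \<Sum>n'=-int l'..int l'. cnj (wigD s l (rot_z t) m n) * wigD s l' (rot_z t) m' n' * schur s b l n l' n')"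
    by (rule schur_invariant[OF s rot_z_SO3 m])
  also have "\<dots> = (\<Sum>n=-int l..int l. if m = n then (\<Sum>n'=-int l'..int l'. if m' = n' then cis (- (of_int m * t)) * cis (of_int m' * t) * schur s b l m l' m' else 0) else 0)"
    by (intro sum.cong refl) (auto simp: D D' cis_cnj simp del: sum.delta sum.delta' intro!: sum.cong sum.neutral)
  also have "\<dots> = cis (- (of_int m * t)) * cis (of_int m' * t) * schur s b l m l' m'"
    using m by (simp add: sum.delta')
  also have "cis (- (of_int m * t)) * cis (of_int m' * t) = cis pi"
  proof -
    have "of_int (m' - m) * t = pi" using ne by (simp add: t_def)
    then have "- (of_int m * t) + of_int m' * t = pi" by (simp add: left_diff_distrib)
    then show ?thesis by (simp only: cis_mult)
  qed
  finally show ?thesis by simp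
qed

text \<open>
  As the columns of the matrices are orthonormal, invariance under Q relates the diagonal entries of
  one block to each other.
\<close>

lemma schur_diag_relation:
  assumes s: "\<bar>s\<bar> \<le> int l" "\<bar>s\<bar> \<le> int l'" and m': "m' \<in> {-int l'..int l'}" and k: "k \<in> {-int l..int l}" and Q: "Q \<in> SO3"
  shows "(if m' \<in> {-int l..int l} then wigD s l Q m' k * schur s b l m' l' m' else 0)
    = (if k \<in> {-int l'..int l'} then wigD s l' Q m' k * schur s b l k l' k else 0)"
proof -
  let ?I = "{-int l..int l}" and ?I' = "{-int l'..int l'}"
  have "(\<Sum>m\<in>?I. wigD s l Q m k * schur s b l m l' m') = (\<Sum>m\<in>?I. if m' = m then wigD s l Q m' k * schur s b l m' l' m' else 0)"
    using schur_offdiag[OF s _ m'] by (intro sum.cong) auto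
  also have "\<dots> = (if m' \<in> ?I then wigD s l Q m' k * schur s b l m' l' m' else 0)"
    by (simp add: sum.delta')
  finally have L: "(\<Sum>m\<in>?I. wigD s l Q m k * schur s b l m l' m') = (if m' \<in> ?I then wigD s l Q m' k * schur s b l m' l' m' else 0)" .
  have "(\<Sum>m\<in>?I. wigD s l Q m k * schur s b l m l' m')
      = (\<Sum>m\<in>?I. \<Sum>n\<in>?I. (cnj (wigD s l Q m n) * wigD s l Q m k) * (\<Sum>n'\<in>?I'. wigD s l' Q m' n' * schur s b l n l' n'))"
    by (intro sum.cong refl, subst schur_invariant[OF s Q _ m']) (auto simp: sum_distrib_left mult_ac)
  also have "\<dots> = (\<Sum>n\<in>?I. (\<Sum>m\<in>?I. cnj (wigD s l Q m n) * wigD s l Q m k) * (\<Sum>n'\<in>?I'. wigD s l' Q m' n' * schur s b l n l' n'))"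
    by (subst sum.swap) (simp add: sum_distrib_right)
  also have "\<dots> = (\<Sum>n\<in>?I. if n = k then (\<Sum>n'\<in>?I'. wigD s l' Q m' n' * schur s b l k l' n') else 0)"
    by (intro sum.cong refl) (use wigD_orthogonal[OF s(1) Q _ k] in auto)
  also have "\<dots> = (\<Sum>n'\<in>?I'. wigD s l' Q m' n' * schur s b l k l' n')"
    using k by (simp add: sum.delta)
  also have "\<dots> = (\<Sum>n'\<in>?I'. if k = n' then wigD s l' Q m' k * schur s b l k l' k else 0)"
    using schur_offdiag[OF s k] by (intro sum.cong) auto
  also have "\<dots> = (if k \<in> ?I' then wigD s l' Q m' k * schur s b l k l' k else 0)"
    by (simp add: sum.delta')
  finally show ?thesis using L by simp
qed

lemma wigD_quarter_turn_nonzero: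
  assumes s: "\<bar>s\<bar> \<le> int l" and n: "n \<in> {-int l..int l}"
  shows "wigD s l (rot_y (pi / 2)) (int l) n \<noteq> 0"
proof -
  have "sin (pi / 2 / 2) \<noteq> 0" "cos (pi / 2 / 2) \<noteq> 0" using sin_45 cos_45 by auto
  then obtain E where "spin_linear s l (rot_y (pi / 2)) E" "E (int l) n \<noteq> 0"
    using spin_linear_rot_y[OF s, of "pi / 2"] n by metis
  then show ?thesis using wigD_unique[OF s _ _ n, of "rot_y (pi / 2)" E "int l"] by simp
qed

text \<open>The quarter turn replaces irreducibility. For l < l' the row l' does not occur in degree
  l, so one side of \<open>schur_diag_relation\<close> is 0 while the matrix entry on the other side
  is not. For l = l' the relation equates all 2 l + 1 diagonal integrals, whose sum is the total
  mass times the squared norm of b.\<close>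

lemma schur_orthogonality:
  assumes s: "\<bar>s\<bar> \<le> int l" "\<bar>s\<bar> \<le> int l'" and m: "m \<in> {-int l..int l}" "m' \<in> {-int l'..int l'}"
  shows "schur s b l m l' m' = (if l = l' \<and> m = m'
    then of_real (8 * pi\<^sup>2 / (2 * real l + 1) * (\<Sum>n=-int l..int l. (cmod (b l n))\<^sup>2)) else 0)"
proof -
  define Q where "Q = rot_y (pi / 2)"
  have Q: "Q \<in> SO3" by (simp add: Q_def rot_y_SO3)
  have zero: "schur s b l k l' k = 0" if "l < l'" "\<bar>s\<bar> \<le> int l" "\<bar>s\<bar> \<le> int l'" "k \<in> {-int l..int l}" for l l' k
  proof -
    have "k \<in> {-int l'..int l'}" "int l' \<notin> {-int l..int l}" using that by auto
    then have "wigD s l' Q (int l') k * schur s b l k l' k = 0"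
      using schur_diag_relation[OF that(2,3) _ that(4) Q, of "int l'" b] by simp
    then show ?thesis using wigD_quarter_turn_nonzero[OF that(3), of k] \<open>k \<in> {-int l'..int l'}\<close> by (simp add: Q_def)
  qed
  consider "m \<noteq> m'" | "m = m'" "l < l'" | "m = m'" "l' < l" | "m = m'" "l = l'" by linarith
  then show ?thesis
  proof cases
    case 1
    then show ?thesis using schur_offdiag[OF s m] by simp
  next
    case 2
    then show ?thesis using zero[OF 2(2) s, of m] m by simp
  next
    case 3
    then show ?thesis using zero[OF 3(2) s(2,1), of m] m schur_commute[of s b l m l' m'] by simp
  next
    case 4
    have const: "schur s b l k l k = schur s b l (int l) l (int l)" if "k \<in> {-int l..int l}" for k
      using schur_diag_relation[OF s(1) s(1) _ that Q, of "int l" b] wigD_quarter_turn_nonzero[OF s(1) that] that by (simp add: Q_def)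
    have "(\<Sum>k=-int l..int l. schur s b l k l k) = (LINT R|\<nu>. (\<Sum>k=-int l..int l. cnj (wig_coeff s b l k R) * wig_coeff s b l k R))"
      unfolding schur_def by (rule Bochner_Integration.integral_sum[symmetric]) (use integrable_schur[OF s(1) s(1)] in auto)
    also have "\<dots> = (LINT R|\<nu>. complex_of_real (\<Sum>n=-int l..int l. (cmod (b l n))\<^sup>2))"
      by (rule Bochner_Integration.integral_cong[OF refl]) (simp only: space_nu wig_coeff_norm2[OF s(1)])
    also have "\<dots> = of_real (8 * pi\<^sup>2 * (\<Sum>n=-int l..int l. (cmod (b l n))\<^sup>2))"
      using measure_nu by (simp add: scaleR_conv_of_real)
    also have "(\<Sum>k=-int l..int l. schur s b l k l k) = (\<Sum>k=-int l..int l. schur s b l m l m)"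
      by (intro sum.cong refl) (use const m in metis)
    also have "\<dots> = of_real (2 * real l + 1) * schur s b l m l m"
      by (simp add: nat_add_distrib nat_mult_distrib)
    finally have "of_real (2 * real l + 1) * schur s b l m l m = of_real (8 * pi\<^sup>2 * (\<Sum>n=-int l..int l. (cmod (b l n))\<^sup>2))" .
    moreover have "2 * real l + 1 \<noteq> 0" by linarith
    ultimately have "schur s b l m l m = of_real (8 * pi\<^sup>2 * (\<Sum>n=-int l..int l. (cmod (b l n))\<^sup>2)) / of_real (2 * real l + 1)"
      by (metis nonzero_mult_div_cancel_left of_real_eq_0_iff)
    also have "\<dots> = of_real (8 * pi\<^sup>2 / (2 * real l + 1) * (\<Sum>n=-int l..int l. (cmod (b l n))\<^sup>2))"
      by (simp add: field_simps)
    finally show ?thesis using 4 by simp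
  qed
qed

text \<open>The transform of the N-th projection is a finite combination of contracted rows, for
  which Schur orthogonality applies. Rotations preserve the norm of the wavelet, so all transforms
  are bounded uniformly on the group and dominated convergence over the finite Haar measure gives
  the limit.\<close>

lemma wavelet_integral:
  fixes s :: int and \<Psi> f g :: "real \<times> real \<Rightarrow> complex"
  assumes P: "\<Psi> \<in> L2_sphere" and f: "f \<in> L2_sphere" and g: "g \<in> L2_sphere"
  defines "W \<equiv> \<lambda>f R. sphere_inner (spin_rotate s R \<Psi>) f"
  shows "integrable \<nu> (\<lambda>R. cnj (W f R) * W g R)"
    and "(\<lambda>N. \<Sum>(l, m)\<in>spin_index s N. of_real (8 * pi\<^sup>2 / (2 * real l + 1) * (\<Sum>n=-int l..int l. (cmod (sphere_inner (spinY s l n) \<Psi>))\<^sup>2))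
        * (cnj (sphere_inner (spinY s l m) f) * sphere_inner (spinY s l m) g))
      \<longlonglongrightarrow> (LINT R|\<nu>. cnj (W f R) * W g R)"
proof -
  define b where "b l n = cnj (sphere_inner (spinY s l n) \<Psi>)" for l n
  define V where "V N f R = (\<Sum>(l, m)\<in>spin_index s N. sphere_inner (spinY s l m) f * wig_coeff s b l m R)" for N f R
  have coeff: "sphere_inner (spin_rotate s R \<Psi>) (spinY s l m) = wig_coeff s b l m R" if "R \<in> SO3" "(l, m) \<in> spin_index s N" for R l m N
    using spin_rotate_coeff[OF that(1) P] spin_indexD[OF that(2)] by (simp add: wig_coeff_def b_def)
  have V: "V N f R = W (spin_proj s N f) R" if "R \<in> SO3" for N f R
    unfolding V_def W_def sphere_inner_spin_proj[OF spin_rotate_L2(1)[OF that P]]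
    by (intro sum.cong refl) (use coeff[OF that] in auto)
  have Vm: "V N f \<in> borel_measurable \<nu>" for N f
    unfolding V_def[abs_def] case_prod_beta'
    by (intro measurable_nu borel_measurable_sum borel_measurable_times measurable_wig_coeff borel_measurable_const)
  have lim: "(\<lambda>N. V N f R) \<longlonglongrightarrow> W f R" if "f \<in> L2_sphere" "R \<in> SO3" for f R
    unfolding V[OF that(2)] W_def by (rule sphere_inner_proj_tendsto[OF spin_rotate_L2(1)[OF that(2) P] that(1)])
  \<comment> \<open>Measurability of the transform in R is obtained as a pointwise limit of the
    finite sums; Euler angles as functions of R are thereby avoided.\<close>
  have Wm: "W f \<in> borel_measurable \<nu>" if "f \<in> L2_sphere" for f
    by (rule borel_measurable_LIMSEQ_metric[OF Vm]) (use lim that in auto)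
  have Wb: "cmod (W f R) \<le> sqrt (sphere_norm2 \<Psi>) * sqrt (sphere_norm2 f)" if "f \<in> L2_sphere" "R \<in> SO3" for f R
    unfolding W_def using sphere_Cauchy_Schwarz[OF spin_rotate_L2(1)[OF that(2) P] that(1)] by (simp add: spin_rotate_L2(2)[OF that(2) P])
  have Vb: "cmod (V N f R) \<le> sqrt (sphere_norm2 \<Psi>) * sqrt (sphere_norm2 f)" if "f \<in> L2_sphere" "R \<in> SO3" for f R N
  proof -
    have "cmod (V N f R) \<le> sqrt (sphere_norm2 \<Psi>) * sqrt (sphere_norm2 (spin_proj s N f))"
      unfolding V[OF that(2)] by (rule Wb[OF L2_spin_proj that(2)])
    also have "\<dots> \<le> sqrt (sphere_norm2 \<Psi>) * sqrt (sphere_norm2 f)"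
      by (intro mult_left_mono real_sqrt_le_mono spin_proj_norm2_le that real_sqrt_ge_zero sphere_norm2_nonneg)
    finally show ?thesis .
  qed
  define B where "B = (sqrt (sphere_norm2 \<Psi>) * sqrt (sphere_norm2 f)) * (sqrt (sphere_norm2 \<Psi>) * sqrt (sphere_norm2 g))"
  have nn: "sqrt (sphere_norm2 \<Psi>) * sqrt (sphere_norm2 f) \<ge> 0" for f by (intro mult_nonneg_nonneg real_sqrt_ge_zero sphere_norm2_nonneg)
  show int: "integrable \<nu> (\<lambda>R. cnj (W f R) * W g R)"
  proof (rule integrable_nu_bounded)
    show "(\<lambda>R. cnj (W f R) * W g R) \<in> borel_measurable \<nu>" by (intro borel_measurable_times borel_measurable_cnj Wm f g)
    show "cmod (cnj (W f R) * W g R) \<le> B" if "R \<in> SO3" for R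
      unfolding norm_mult complex_mod_cnj B_def by (intro mult_mono Wb f g that nn) simp
  qed
  have conv: "(\<lambda>N. LINT R|\<nu>. cnj (V N f R) * V N g R) \<longlonglongrightarrow> (LINT R|\<nu>. cnj (W f R) * W g R)"
  proof (rule integral_dominated_convergence[where w = "\<lambda>_. B"])
    show "(\<lambda>R. cnj (W f R) * W g R) \<in> borel_measurable \<nu>" using int by (rule borel_measurable_integrable)
    show "(\<lambda>R. cnj (V N f R) * V N g R) \<in> borel_measurable \<nu>" for N by (intro borel_measurable_times borel_measurable_cnj Vm)
    show "AE R in \<nu>. (\<lambda>N. cnj (V N f R) * V N g R) \<longlonglongrightarrow> cnj (W f R) * W g R"
      by (rule AE_I2) (auto intro!: tendsto_intros lim f g)
    show "AE R in \<nu>. norm (cnj (V N f R) * V N g R) \<le> B" for N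
    proof (rule AE_I2)
      fix R assume "R \<in> space \<nu>"
      then have R: "R \<in> SO3" by simp
      show "norm (cnj (V N f R) * V N g R) \<le> B"
        unfolding norm_mult complex_mod_cnj B_def by (intro mult_mono Vb f g R nn) simp
    qed
  qed simp
  have "(LINT R|\<nu>. cnj (V N f R) * V N g R) = (\<Sum>(l, m)\<in>spin_index s N. of_real (8 * pi\<^sup>2 / (2 * real l + 1) * (\<Sum>n=-int l..int l. (cmod (sphere_inner (spinY s l n) \<Psi>))\<^sup>2))
        * (cnj (sphere_inner (spinY s l m) f) * sphere_inner (spinY s l m) g))" for N
  proof -
    let ?I = "spin_index s N"
    define a c where "a i = sphere_inner (spinY s (fst i) (snd i)) f" and "c i = sphere_inner (spinY s (fst i) (snd i)) g" for i
    define w where "w i = wig_coeff s b (fst i) (snd i)" for i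
    have idx: "\<bar>s\<bar> \<le> int (fst i)" "snd i \<in> {-int (fst i)..int (fst i)}" if "i \<in> ?I" for i
      using spin_indexD[of "fst i" "snd i" s N] that by (auto simp: abs_le_iff)
    have iw: "integrable \<nu> (\<lambda>R. cnj (w i R) * w j R)" if "i \<in> ?I" "j \<in> ?I" for i j
      unfolding w_def using idx that by (intro integrable_schur) auto
    have "(LINT R|\<nu>. cnj (V N f R) * V N g R) = (LINT R|\<nu>. (\<Sum>i\<in>?I. \<Sum>j\<in>?I. (cnj (a i) * c j) * (cnj (w i R) * w j R)))"
      unfolding V_def case_prod_beta' a_def[symmetric] c_def[symmetric] w_def[symmetric] cnj_sum sum_product
      by (intro Bochner_Integration.integral_cong sum.cong refl) (simp add: mult_ac)
    also have "\<dots> = (\<Sum>i\<in>?I. \<Sum>j\<in>?I. (cnj (a i) * c j) * (LINT R|\<nu>. cnj (w i R) * w j R))"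
      by (subst Bochner_Integration.integral_sum, (intro Bochner_Integration.integrable_sum integrable_mult_right iw; simp), intro sum.cong refl,
        subst Bochner_Integration.integral_sum, (intro integrable_mult_right iw; simp), intro sum.cong refl) simp
    also have "\<dots> = (\<Sum>i\<in>?I. \<Sum>j\<in>?I. if i = j then (cnj (a i) * c i) * of_real (8 * pi\<^sup>2 / (2 * real (fst i) + 1) * (\<Sum>n=-int (fst i)..int (fst i). (cmod (b (fst i) n))\<^sup>2)) else 0)"
    proof (intro sum.cong refl)
      fix i j assume ij: "i \<in> ?I" "j \<in> ?I"
      have "(LINT R|\<nu>. cnj (w i R) * w j R) = schur s b (fst i) (snd i) (fst j) (snd j)"
        by (simp add: w_def schur_def)
      also have "\<dots> = (if i = j then of_real (8 * pi\<^sup>2 / (2 * real (fst i) + 1) * (\<Sum>n=-int (fst i)..int (fst i). (cmod (b (fst i) n))\<^sup>2)) else 0)"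
        unfolding prod_eq_iff by (rule schur_orthogonality[OF idx(1)[OF ij(1)] idx(1)[OF ij(2)] idx(2)[OF ij(1)] idx(2)[OF ij(2)]])
      finally have eq: "(LINT R|\<nu>. cnj (w i R) * w j R) = (if i = j then of_real (8 * pi\<^sup>2 / (2 * real (fst i) + 1) * (\<Sum>n=-int (fst i)..int (fst i). (cmod (b (fst i) n))\<^sup>2)) else 0)" .
      show "(cnj (a i) * c j) * (LINT R|\<nu>. cnj (w i R) * w j R) = (if i = j then (cnj (a i) * c i) * of_real (8 * pi\<^sup>2 / (2 * real (fst i) + 1) * (\<Sum>n=-int (fst i)..int (fst i). (cmod (b (fst i) n))\<^sup>2)) else 0)"
        unfolding eq by (cases "i = j") (simp_all only: simp_thms if_True if_False mult_zero_right)
    qed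
    also have "\<dots> = (\<Sum>i\<in>?I. (cnj (a i) * c i) * of_real (8 * pi\<^sup>2 / (2 * real (fst i) + 1) * (\<Sum>n=-int (fst i)..int (fst i). (cmod (b (fst i) n))\<^sup>2)))"
      by (intro sum.cong refl) (simp add: sum.delta')
    finally show ?thesis unfolding case_prod_beta' a_def c_def b_def complex_mod_cnj by (simp only: mult.commute)
  qed
  then show "(\<lambda>N. \<Sum>(l, m)\<in>spin_index s N. of_real (8 * pi\<^sup>2 / (2 * real l + 1) * (\<Sum>n=-int l..int l. (cmod (sphere_inner (spinY s l n) \<Psi>))\<^sup>2))
        * (cnj (sphere_inner (spinY s l m) f) * sphere_inner (spinY s l m) g))
      \<longlonglongrightarrow> (LINT R|\<nu>. cnj (W f R) * W g R)"
    using conv by simp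
qed

end

section \<open>Integration over the scales and Parseval's identity\<close>

theorem theorem3p4:
  fixes s :: int and \<alpha> :: "real \<Rightarrow> real" and \<nu> :: "(real ^ 3 ^ 3) measure"
    and \<Psi> :: "real \<Rightarrow> real \<times> real \<Rightarrow> complex" and f g :: "real \<times> real \<Rightarrow> complex"
  assumes "haar_SO3 \<nu>"
    and "weight_function \<alpha>"
    and "admissible_wavelet s \<alpha> \<Psi>"
    and "f \<in> L2_sphere" and "g \<in> L2_sphere"
  shows "phase_inner_exists \<alpha> \<nu> (wavelet_transform s \<Psi> f) (wavelet_transform s \<Psi> g) \<and>
         phase_inner \<alpha> \<nu> (wavelet_transform s \<Psi> f) (wavelet_transform s \<Psi> g) = sphere_inner f g"
proof -
  interpret haar_rotation \<nu> by unfold_locales (rule assms(1))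
  note f = assms(4) and g = assms(5)
  have PL: "\<Psi> \<rho> \<in> L2_sphere" if "\<rho> > 0" for \<rho> using assms(3) that by (simp add: admissible_wavelet_def)
  have pos: "\<alpha> \<rho> > 0" if "\<rho> > 0" for \<rho> using assms(2) that by (simp add: weight_function_def)
  let ?L = "lebesgue_on {0<..} :: real measure"
  define Wf Wg where "Wf = wavelet_transform s \<Psi> f" and "Wg = wavelet_transform s \<Psi> g"
  have W: "wavelet_transform s \<Psi> h \<rho> R = sphere_inner (spin_rotate s R (\<Psi> \<rho>)) h" for h \<rho> R
    by (simp add: wavelet_transform_def sphere_inner_def)
  \<comment> \<open>The Schur constant times the energy of the wavelet in degree l. By admissibility
    its integral against \<alpha> is 1.\<close>
  define c where "c \<rho> l = 8 * pi\<^sup>2 / (2 * real l + 1) * (\<Sum>n=-int l..int l. (cmod (spin_coeff s (\<Psi> \<rho>) l n))\<^sup>2)" for \<rho> l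
  \<comment> \<open>The contribution of degree l to the scalar product of f and g. It is 0 for l <
    |s|, so that the series can run over all natural numbers.\<close>
  define u where "u l = (if \<bar>s\<bar> \<le> int l then \<Sum>m=-int l..int l. cnj (sphere_inner (spinY s l m) f) * sphere_inner (spinY s l m) g else 0)" for l
  have u_sum: "(\<Sum>(l, m)\<in>spin_index s N. h l * (cnj (sphere_inner (spinY s l m) f) * sphere_inner (spinY s l m) g)) = (\<Sum>l<Suc N. h l * u l)" for N h
    unfolding spin_index_sum lessThan_Suc_atMost u_def by (intro sum.cong refl) (simp add: sum_distrib_left)
  have cP: "c \<rho> l = 8 * pi\<^sup>2 / (2 * real l + 1) * (\<Sum>n=-int l..int l. (cmod (sphere_inner (spinY s l n) (\<Psi> \<rho>)))\<^sup>2)"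
    if "\<bar>s\<bar> \<le> int l" "\<rho> > 0" for \<rho> l
    using spin_coeff_eq[OF _ that(1) PL[OF that(2)]] unfolding c_def by (intro arg_cong2[of _ _ _ _ "(*)"] refl sum.cong) (auto simp: abs_le_iff)
  have c0: "c \<rho> l \<ge> 0" for \<rho> l unfolding c_def by (intro mult_nonneg_nonneg sum_nonneg) auto

  \<comment> \<open>The products of coefficients are bounded by half the sum of their squares, and
    Bessel's inequality applies to f and to g.\<close>
  have usum: "summable (\<lambda>l. cmod (u l))"
  proof (rule summableI_nonneg_bounded[where x = "(sphere_norm2 f + sphere_norm2 g) / 2"])
    fix N
    have "(\<Sum>l<N. cmod (u l)) \<le> (\<Sum>l\<le>N. if \<bar>s\<bar> \<le> int l then \<Sum>m=-int l..int l. ((cmod (sphere_inner (spinY s l m) f))\<^sup>2 + (cmod (sphere_inner (spinY s l m) g))\<^sup>2) / 2 else 0)"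
    proof (rule sum_le_included[where i = "\<lambda>l. l"])
      show "\<forall>l\<in>{..<N}. \<exists>l'\<in>{..N}. l' = l \<and> cmod (u l) \<le> (if \<bar>s\<bar> \<le> int l' then \<Sum>m=-int l'..int l'. ((cmod (sphere_inner (spinY s l' m) f))\<^sup>2 + (cmod (sphere_inner (spinY s l' m) g))\<^sup>2) / 2 else 0)"
      proof
        fix l assume l: "l \<in> {..<N}"
        have "cmod (cnj x * y) \<le> ((cmod x)\<^sup>2 + (cmod y)\<^sup>2) / 2" for x y
          using sum_squares_bound[of "cmod x" "cmod y"] by (simp add: norm_mult)
        then have "cmod (u l) \<le> (if \<bar>s\<bar> \<le> int l then \<Sum>m=-int l..int l. ((cmod (sphere_inner (spinY s l m) f))\<^sup>2 + (cmod (sphere_inner (spinY s l m) g))\<^sup>2) / 2 else 0)"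
          unfolding u_def by (auto intro!: sum_norm_le)
        then show "\<exists>l'\<in>{..N}. l' = l \<and> cmod (u l) \<le> (if \<bar>s\<bar> \<le> int l' then \<Sum>m=-int l'..int l'. ((cmod (sphere_inner (spinY s l' m) f))\<^sup>2 + (cmod (sphere_inner (spinY s l' m) g))\<^sup>2) / 2 else 0)"
          using l by auto
      qed
    qed (auto intro!: sum_nonneg)
    also have "\<dots> = (\<Sum>(l, m)\<in>spin_index s N. ((cmod (sphere_inner (spinY s l m) f))\<^sup>2 + (cmod (sphere_inner (spinY s l m) g))\<^sup>2) / 2)"
      unfolding spin_index_sum ..
    also have "\<dots> = ((\<Sum>(l, m)\<in>spin_index s N. (cmod (sphere_inner (spinY s l m) f))\<^sup>2) + (\<Sum>(l, m)\<in>spin_index s N. (cmod (sphere_inner (spinY s l m) g))\<^sup>2)) / 2"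
      by (simp add: case_prod_beta' sum.distrib sum_divide_distrib add_divide_distrib)
    also have "\<dots> \<le> (sphere_norm2 f + sphere_norm2 g) / 2"
      using spin_bessel[OF f, of s N] spin_bessel[OF g, of s N] by simp
    finally show "(\<Sum>l<N. cmod (u l)) \<le> (sphere_norm2 f + sphere_norm2 g) / 2" .
  qed simp

  have u_total: "(\<lambda>N. \<Sum>l<Suc N. u l) \<longlonglongrightarrow> sphere_inner f g"
  proof -
    have "sphere_inner f (spin_proj s N g) = (\<Sum>l<Suc N. 1 * u l)" for N
      unfolding u_sum[symmetric] sphere_inner_spin_proj[OF f] by (intro sum.cong refl) (auto simp: sphere_inner_commute[of f])
    then show ?thesis using sphere_inner_proj_tendsto[OF f g, of s] by simp
  qed
  \<comment> \<open>The projections include the degree N, so their partial sums are those of the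
    series shifted by one.\<close>
  have u_suminf: "(\<Sum>l. u l) = sphere_inner f g"
    using LIMSEQ_unique[OF LIMSEQ_Suc[OF summable_LIMSEQ[OF summable_norm_cancel[OF usum]]] u_total] .

  define B where "B \<rho> = (LINT R|\<nu>. cnj (Wf \<rho> R) * Wg \<rho> R)" for \<rho>
  have B_int: "integrable \<nu> (\<lambda>R. cnj (Wf \<rho> R) * Wg \<rho> R)" if "\<rho> > 0" for \<rho>
    unfolding Wf_def Wg_def W by (rule wavelet_integral(1)[OF PL[OF that] f g])
  have B_lim: "(\<lambda>N. \<Sum>l<Suc N. of_real (c \<rho> l) * u l) \<longlonglongrightarrow> B \<rho>" if "\<rho> > 0" for \<rho>
  proof -
    have "(\<Sum>(l, m)\<in>spin_index s N. of_real (8 * pi\<^sup>2 / (2 * real l + 1) * (\<Sum>n=-int l..int l. (cmod (sphere_inner (spinY s l n) (\<Psi> \<rho>)))\<^sup>2))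
        * (cnj (sphere_inner (spinY s l m) f) * sphere_inner (spinY s l m) g)) = (\<Sum>l<Suc N. of_real (c \<rho> l) * u l)" for N
      unfolding u_sum by (intro sum.cong refl) (auto simp: cP[OF _ that] u_def)
    then show ?thesis
      using wavelet_integral(2)[OF PL[OF that] f g, of s] unfolding B_def Wf_def Wg_def W by simp
  qed
  \<comment> \<open>At a fixed scale c is bounded in l by 8 pi^2 times the squared norm of the
    wavelet, again by Bessel's inequality. No uniformity in \<rho> is claimed.\<close>
  have cu: "summable (\<lambda>l. norm (of_real (c \<rho> l) * u l * of_real (\<alpha> \<rho>)))" if "\<rho> > 0" for \<rho>
  proof (rule summable_comparison_test'[where N = 0])
    show "summable (\<lambda>l. (8 * pi\<^sup>2 * sphere_norm2 (\<Psi> \<rho>) * \<alpha> \<rho>) * cmod (u l))" by (intro summable_mult usum)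
    fix l :: nat
    show "norm (norm (of_real (c \<rho> l) * u l * of_real (\<alpha> \<rho>))) \<le> (8 * pi\<^sup>2 * sphere_norm2 (\<Psi> \<rho>) * \<alpha> \<rho>) * cmod (u l)"
    proof (cases "\<bar>s\<bar> \<le> int l")
      case True
      have "(\<Sum>n=-int l..int l. (cmod (sphere_inner (spinY s l n) (\<Psi> \<rho>)))\<^sup>2) \<le> (\<Sum>(l, m)\<in>spin_index s l. (cmod (sphere_inner (spinY s l m) (\<Psi> \<rho>)))\<^sup>2)"
        unfolding spin_index_sum using True
        by (intro order_trans[OF _ member_le_sum[of l "{..l}" "\<lambda>l. if \<bar>s\<bar> \<le> int l then \<Sum>m=-int l..int l. (cmod (sphere_inner (spinY s l m) (\<Psi> \<rho>)))\<^sup>2 else 0"]]) (auto intro!: sum_nonneg)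
      also have "\<dots> \<le> sphere_norm2 (\<Psi> \<rho>)" by (rule spin_bessel[OF PL[OF that]])
      finally have "c \<rho> l \<le> 8 * pi\<^sup>2 / (2 * real l + 1) * sphere_norm2 (\<Psi> \<rho>)"
        unfolding cP[OF True that] by (intro mult_left_mono) auto
      also have "\<dots> \<le> 8 * pi\<^sup>2 * sphere_norm2 (\<Psi> \<rho>)"
        by (intro mult_right_mono sphere_norm2_nonneg) (auto simp: field_simps)
      finally have "c \<rho> l * (cmod (u l) * \<alpha> \<rho>) \<le> 8 * pi\<^sup>2 * sphere_norm2 (\<Psi> \<rho>) * (cmod (u l) * \<alpha> \<rho>)"
        using pos[OF that] by (intro mult_right_mono) auto
      then show ?thesis using c0[of \<rho> l] pos[OF that] by (simp add: norm_mult mult_ac)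
    next
      case False
      then show ?thesis by (simp add: u_def)
    qed
  qed
  have B_eq: "B \<rho> * of_real (\<alpha> \<rho>) = (\<Sum>l. of_real (c \<rho> l) * u l * of_real (\<alpha> \<rho>))" if "\<rho> > 0" for \<rho>
  proof -
    have "(\<lambda>N. (\<Sum>l<Suc N. of_real (c \<rho> l) * u l) * of_real (\<alpha> \<rho>)) \<longlonglongrightarrow> B \<rho> * of_real (\<alpha> \<rho>)"
      by (intro tendsto_intros B_lim that)
    then have "(\<lambda>N. \<Sum>l<Suc N. of_real (c \<rho> l) * u l * of_real (\<alpha> \<rho>)) \<longlonglongrightarrow> B \<rho> * of_real (\<alpha> \<rho>)"
      by (simp only: sum_distrib_right)
    from LIMSEQ_unique[OF this LIMSEQ_Suc[OF summable_LIMSEQ[OF summable_norm_cancel[OF cu[OF that]]]]] show ?thesis .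
  qed

  have c_int: "integrable ?L (\<lambda>\<rho>. c \<rho> l * \<alpha> \<rho>)" and c_one: "(LINT \<rho>|?L. c \<rho> l * \<alpha> \<rho>) = 1" if l: "\<bar>s\<bar> \<le> int l" for l
  proof -
    have I: "integrable ?L (\<lambda>\<rho>. (cmod (spin_coeff s (\<Psi> \<rho>) l m))\<^sup>2 * \<alpha> \<rho>)" if "m \<in> {-int l..int l}" for m
      using assms(3) l that by (auto simp: admissible_wavelet_def)
    have S: "(\<Sum>m=-int l..int l. LINT \<rho>|?L. (cmod (spin_coeff s (\<Psi> \<rho>) l m))\<^sup>2 * \<alpha> \<rho>) = (2 * real l + 1) / (8 * pi\<^sup>2)"
      using assms(3) l by (simp add: admissible_wavelet_def)
    have e: "c \<rho> l * \<alpha> \<rho> = 8 * pi\<^sup>2 / (2 * real l + 1) * (\<Sum>m=-int l..int l. (cmod (spin_coeff s (\<Psi> \<rho>) l m))\<^sup>2 * \<alpha> \<rho>)" for \<rho>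
      unfolding c_def by (simp only: sum_distrib_right mult.assoc)
    show "integrable ?L (\<lambda>\<rho>. c \<rho> l * \<alpha> \<rho>)"
      unfolding e by (intro integrable_mult_right Bochner_Integration.integrable_sum I)
    have "(LINT \<rho>|?L. c \<rho> l * \<alpha> \<rho>) = 8 * pi\<^sup>2 / (2 * real l + 1) * (LINT \<rho>|?L. (\<Sum>m=-int l..int l. (cmod (spin_coeff s (\<Psi> \<rho>) l m))\<^sup>2 * \<alpha> \<rho>))"
      unfolding e by (rule integral_mult_right_zero)
    also have "(LINT \<rho>|?L. (\<Sum>m=-int l..int l. (cmod (spin_coeff s (\<Psi> \<rho>) l m))\<^sup>2 * \<alpha> \<rho>)) = (2 * real l + 1) / (8 * pi\<^sup>2)"
      unfolding S[symmetric] by (rule Bochner_Integration.integral_sum[OF I])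
    also have "8 * pi\<^sup>2 / (2 * real l + 1) * ((2 * real l + 1) / (8 * pi\<^sup>2)) = 1"
      by (simp add: add_nonneg_eq_0_iff)
    finally show "(LINT \<rho>|?L. c \<rho> l * \<alpha> \<rho>) = 1" .
  qed
  define F where "F l \<rho> = of_real (c \<rho> l) * u l * of_real (\<alpha> \<rho>)" for l \<rho>
  have F_eq: "F l \<rho> = u l * of_real (c \<rho> l * \<alpha> \<rho>)" for l \<rho> by (simp add: F_def)
  have F_int: "integrable ?L (F l)" for l
  proof (cases "\<bar>s\<bar> \<le> int l")
    case True
    show ?thesis unfolding F_eq[abs_def] by (intro integrable_mult_right integrable_of_real c_int True)
  qed (simp add: F_def[abs_def] u_def)
  have F_val: "integral\<^sup>L ?L (F l) = u l" for l
  proof (cases "\<bar>s\<bar> \<le> int l")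
    case True
    have "integral\<^sup>L ?L (F l) = u l * of_real (LINT \<rho>|?L. c \<rho> l * \<alpha> \<rho>)"
      unfolding F_eq[abs_def] integral_complex_of_real[symmetric] by (rule integral_mult_right_zero)
    then show ?thesis by (simp add: c_one[OF True])
  qed (simp add: F_def[abs_def] u_def)
  \<comment> \<open>As c and \<alpha> are nonnegative, the normalization of c also gives the L1
    norms over the scales: they are |u l| and hence summable. This justifies the exchange of series
    and integral.\<close>
  have F_norm: "(LINT \<rho>|?L. norm (F l \<rho>)) = cmod (u l)" for l
  proof (cases "\<bar>s\<bar> \<le> int l")
    case True
    have "(LINT \<rho>|?L. norm (F l \<rho>)) = (LINT \<rho>|?L. cmod (u l) * (c \<rho> l * \<alpha> \<rho>))"
      using c0 pos by (intro Bochner_Integration.integral_cong refl) (auto simp: F_eq norm_mult abs_mult less_imp_le)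
    then show ?thesis by (simp add: c_one[OF True])
  qed (simp add: F_def[abs_def] u_def)
  have AEs: "AE \<rho> in ?L. summable (\<lambda>l. norm (F l \<rho>))"
    unfolding F_def by (rule AE_I2) (use cu in auto)
  have ns: "summable (\<lambda>l. LINT \<rho>|?L. norm (F l \<rho>))" unfolding F_norm by (rule usum)
  have BF: "B \<rho> * of_real (\<alpha> \<rho>) = (\<Sum>l. F l \<rho>)" if "\<rho> \<in> space ?L" for \<rho>
    using B_eq[of \<rho>] that by (simp add: F_def)
  have "integrable ?L (\<lambda>\<rho>. B \<rho> * of_real (\<alpha> \<rho>))"
    using integrable_suminf[OF F_int AEs ns] by (subst Bochner_Integration.integrable_cong[OF refl BF])
  moreover have "(LINT \<rho>|?L. B \<rho> * of_real (\<alpha> \<rho>)) = sphere_inner f g"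
  proof -
    have "(LINT \<rho>|?L. B \<rho> * of_real (\<alpha> \<rho>)) = (LINT \<rho>|?L. (\<Sum>l. F l \<rho>))"
      by (rule Bochner_Integration.integral_cong[OF refl BF])
    also have "\<dots> = (\<Sum>l. integral\<^sup>L ?L (F l))" by (rule integral_suminf[OF F_int AEs ns])
    finally show ?thesis by (simp add: F_val u_suminf)
  qed
  ultimately show ?thesis
    using B_int unfolding phase_inner_exists_def phase_inner_def B_def Wf_def Wg_def by blast
qed

end
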